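(* Let $X$ be a zero-dimensional metric space with derived set $X'$. Then the space $C_k(X,2)$ is a $k$-space if and only if one of the following conditions holds: (a) $X$ is a topological sum of a separable metrizable locally compact space $L$ and a discrete space $D$; (b) $X$ is not locally compact but $X'$ is compact. Moreover, in case (a), $C_k(X,2)$ is (topologically isomorphic to) the product of a Polish abelian group and a compact abelian group; and in case (b), $C_k(X,2)$ contains an open subgroup which is topologically isomorphic to the direct sum $\bigoplus_{n\in\mathbb{N}}2^{\kappa_n}$ endowed with the box topology for some sequence $(\kappa_n)_{n\in\mathbb{N}}$ of cardinal numbers.
   Context: Zero-dimensional means having a base of clopen sets. The derived set $X'$ is the set of all non-isolated points of $X$. $2=\{0,1\}=\mathbb{Z}(2)$ is the two-element discrete group, and $2^{\kappa}$ is the compact group $\mathbb{Z}(2)^\kappa$ with the product topology. $C_k(X,2)$ is the set of continuous functions $X\to 2$ with the compact-open topology, a topological abelian group under pointwise operations. In (a), $L$ or $D$ may be empty. A space $Z$ is a $k$-space if for each non-closed $A\subset Z$ there is a compact $K\subset Z$ such that $A\cap K$ is not closed in $K$. For topological groups $G_n$ ($n\in\mathbb{N}$), $\bigoplus_{n}G_n$ is the subgroup of $\prod_n G_n$ of all $(g_n)$ with $g_n=e_n$ for all but finitely many $n$. The box topology on $\prod_n G_n$ is the group topology with neighborhood base at the identity given by the sets $\prod_n U_n$, $U_n$ an open neighborhood of the identity of $G_n$; $\bigoplus_n G_n$ carries the subspace topology. *)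

theory Defs
  imports "HOL-Analysis.Analysis" "HOL-Algebra.Product_Groups"
begin

section \<open>Spaces\<close>

definition zero_dimensional_space :: "'a topology \<Rightarrow> bool" where
  "zero_dimensional_space X \<longleftrightarrow>
     (\<exists>\<B>. (\<forall>V\<in>\<B>. openin X V \<and> closedin X V) \<and>
          openin X = arbitrary union_of (\<lambda>V. V \<in> \<B>))"

definition polish_space :: "'a topology \<Rightarrow> bool" where
  "polish_space X \<longleftrightarrow> completely_metrizable_space X \<and> separable_space X"

text \<open>The summands \<open>L\<close> and \<open>D\<close> embed in \<open>X\<close>, so nothing is lost by taking them over the
  point type of \<open>X\<close>. Both may be empty.\<close>

definition separable_locally_compact_plus_discrete :: "'a topology \<Rightarrow> bool" where
  "separable_locally_compact_plus_discrete X \<longleftrightarrow>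
     (\<exists>(L :: 'a topology) (D :: 'a set).
        separable_space L \<and> metrizable_space L \<and> locally_compact_space L \<and>
        X homeomorphic_space
          sum_topology (\<lambda>b. if b then L else discrete_topology D) (UNIV :: bool set))"


section \<open>Topological groups\<close>

text \<open>A topological group is given by a group \<open>G\<close> and a topology \<open>T\<close> on its carrier.\<close>

definition topological_group :: "('a, 'b) monoid_scheme \<Rightarrow> 'a topology \<Rightarrow> bool" where
  "topological_group G T \<longleftrightarrow>
     group G \<and> topspace T = carrier G \<and>
     continuous_map (prod_topology T T) T (\<lambda>(x, y). x \<otimes>\<^bsub>G\<^esub> y) \<and>
     continuous_map T T (\<lambda>x. inv\<^bsub>G\<^esub> x)"

definition polish_abelian_group :: "('a, 'b) monoid_scheme \<Rightarrow> 'a topology \<Rightarrow> bool" where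
  "polish_abelian_group G T \<longleftrightarrow> topological_group G T \<and> comm_group G \<and> polish_space T"

text \<open>Compact groups are Hausdorff, as is usual in topological algebra.\<close>

definition compact_abelian_group :: "('a, 'b) monoid_scheme \<Rightarrow> 'a topology \<Rightarrow> bool" where
  "compact_abelian_group G T \<longleftrightarrow>
     topological_group G T \<and> comm_group G \<and> compact_space T \<and> Hausdorff_space T"

definition topologically_isomorphic ::
  "('a, 'c) monoid_scheme \<Rightarrow> 'a topology \<Rightarrow> ('b, 'd) monoid_scheme \<Rightarrow> 'b topology \<Rightarrow> bool" where
  "topologically_isomorphic G S H T \<longleftrightarrow> (\<exists>h. h \<in> iso G H \<and> homeomorphic_map S T h)"

text \<open>The box topology on a product of topological groups: products of open neighbourhoods of
  the identities form a neighbourhood base at the identity, and their translates give the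
  neighbourhoods of the other points.\<close>

definition box_topology ::
  "'i set \<Rightarrow> ('i \<Rightarrow> ('a, 'b) monoid_scheme) \<Rightarrow> ('i \<Rightarrow> 'a topology) \<Rightarrow> ('i \<Rightarrow> 'a) topology" where
  "box_topology I G T = topology (\<lambda>W.
     W \<subseteq> carrier (product_group I G) \<and>
     (\<forall>g\<in>W. \<exists>U. (\<forall>i\<in>I. openin (T i) (U i) \<and> \<one>\<^bsub>G i\<^esub> \<in> U i) \<and>
                g <#\<^bsub>product_group I G\<^esub> (\<Pi>\<^sub>E i\<in>I. U i) \<subseteq> W))"

lemma openin_box_topology:
  "openin (box_topology I G T) W \<longleftrightarrow>
     W \<subseteq> carrier (product_group I G) \<and>
     (\<forall>g\<in>W. \<exists>U. (\<forall>i\<in>I. openin (T i) (U i) \<and> \<one>\<^bsub>G i\<^esub> \<in> U i) \<and>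
                g <#\<^bsub>product_group I G\<^esub> (\<Pi>\<^sub>E i\<in>I. U i) \<subseteq> W)"
proof -
  define P where "P \<equiv> \<lambda>U. \<forall>i\<in>I. openin (T i) (U i) \<and> \<one>\<^bsub>G i\<^esub> \<in> U i"
  define tr where "tr \<equiv> \<lambda>g U. g <#\<^bsub>product_group I G\<^esub> (\<Pi>\<^sub>E i\<in>I. U i)"
  have "istopology (\<lambda>W. W \<subseteq> carrier (product_group I G) \<and> (\<forall>g\<in>W. \<exists>U. P U \<and> tr g U \<subseteq> W))"
    unfolding istopology_def
  proof (rule conjI; intro allI impI)
    fix S S'
    assume S: "S \<subseteq> carrier (product_group I G) \<and> (\<forall>g\<in>S. \<exists>U. P U \<and> tr g U \<subseteq> S)"
      and S': "S' \<subseteq> carrier (product_group I G) \<and> (\<forall>g\<in>S'. \<exists>U. P U \<and> tr g U \<subseteq> S')"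
    have *: "\<exists>U. P U \<and> tr g U \<subseteq> S \<inter> S'" if g: "g \<in> S" "g \<in> S'" for g
    proof -
      obtain U where U: "P U" "tr g U \<subseteq> S"
        using bspec[OF S[THEN conjunct2] g(1)] by (elim exE conjE)
      obtain U' where U': "P U'" "tr g U' \<subseteq> S'"
        using bspec[OF S'[THEN conjunct2] g(2)] by (elim exE conjE)
      have "P (\<lambda>i. U i \<inter> U' i)"
        using U(1) U'(1) unfolding P_def by (simp add: openin_Int)
      moreover have "(\<Pi>\<^sub>E i\<in>I. U i \<inter> U' i) \<subseteq> Pi\<^sub>E I U" "(\<Pi>\<^sub>E i\<in>I. U i \<inter> U' i) \<subseteq> Pi\<^sub>E I U'"
        by (rule PiE_mono, simp)+
      then have "tr g (\<lambda>i. U i \<inter> U' i) \<subseteq> tr g U" "tr g (\<lambda>i. U i \<inter> U' i) \<subseteq> tr g U'"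
        unfolding tr_def l_coset_def by (auto dest: subsetD)
      then have "tr g (\<lambda>i. U i \<inter> U' i) \<subseteq> S \<inter> S'"
        using U(2) U'(2) by (meson le_infI order_trans)
      ultimately show ?thesis by (intro exI conjI)
    qed
    show "S \<inter> S' \<subseteq> carrier (product_group I G) \<and>
        (\<forall>g\<in>S \<inter> S'. \<exists>U. P U \<and> tr g U \<subseteq> S \<inter> S')"
    proof (intro conjI ballI)
      show "S \<inter> S' \<subseteq> carrier (product_group I G)"
        using S[THEN conjunct1] by (rule le_infI1)
      show "\<exists>U. P U \<and> tr g U \<subseteq> S \<inter> S'" if "g \<in> S \<inter> S'" for g
        using that by (elim IntE) (rule *)
    qed
  next
    fix \<W>
    assume W: "\<forall>S\<in>\<W>. S \<subseteq> carrier (product_group I G) \<and> (\<forall>g\<in>S. \<exists>U. P U \<and> tr g U \<subseteq> S)"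
    have "\<exists>U. P U \<and> tr g U \<subseteq> \<Union>\<W>" if "g \<in> \<Union>\<W>" for g
    proof -
      obtain S where "S \<in> \<W>" "g \<in> S"
        using \<open>g \<in> \<Union>\<W>\<close> by (rule UnionE)
      moreover from this obtain U where "P U" "tr g U \<subseteq> S"
        using W by metis
      ultimately show ?thesis
        by (intro exI[of _ U] conjI order_trans[OF _ Union_upper])
    qed
    with W show "\<Union>\<W> \<subseteq> carrier (product_group I G) \<and> (\<forall>g\<in>\<Union>\<W>. \<exists>U. P U \<and> tr g U \<subseteq> \<Union>\<W>)"
      by (meson Union_least)
  qed
  then show ?thesis
    by (simp add: box_topology_def P_def tr_def topology_inverse')
qed


section \<open>Function groups\<close>

text \<open>Functions are represented by their \<open>extensional\<close> version, so that a continuous function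
  on \<open>X\<close> is determined by its values on \<open>topspace X\<close>.\<close>

definition continuous_functions :: "'a topology \<Rightarrow> 'b topology \<Rightarrow> ('a \<Rightarrow> 'b) set" where
  "continuous_functions X Y = {f \<in> extensional (topspace X). continuous_map X Y f}"

definition compact_open_topology :: "'a topology \<Rightarrow> 'b topology \<Rightarrow> ('a \<Rightarrow> 'b) topology" where
  "compact_open_topology X Y =
     topology_generated_by
       {{f \<in> continuous_functions X Y. f ` K \<subseteq> U} | K U. compactin X K \<and> openin Y U}"

lemma topspace_compact_open_topology:
  "topspace (compact_open_topology X Y) = continuous_functions X Y"
proof -
  let ?S = "{{f \<in> continuous_functions X Y. f ` K \<subseteq> U} | K U. compactin X K \<and> openin Y U}"
  have "{f \<in> continuous_functions X Y. f ` {} \<subseteq> {}} \<in> ?S"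
    using compactin_empty openin_empty by blast
  then have "continuous_functions X Y \<subseteq> \<Union>?S"
    by auto
  moreover have "\<Union>?S \<subseteq> continuous_functions X Y"
    by auto
  ultimately show ?thesis
    unfolding compact_open_topology_def topology_generated_by_topspace by (rule antisym[rotated])
qed


text \<open>The two-element group \<open>\<int>(2)\<close> has carrier \<open>{0, 1} :: int set\<close>.\<close>

abbreviation Z2 :: "int monoid" where
  "Z2 \<equiv> integer_mod_group 2"

abbreviation Z2_topology :: "int topology" where
  "Z2_topology \<equiv> discrete_topology (carrier Z2)"

text \<open>The compact group \<open>2\<^sup>\<kappa>\<close>; the cardinal \<open>\<kappa>\<close> is represented by an index set of that size.\<close>

definition Z2_power :: "'k set \<Rightarrow> ('k \<Rightarrow> int) monoid" where
  "Z2_power \<kappa> = product_group \<kappa> (\<lambda>_. Z2)"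

definition Z2_power_topology :: "'k set \<Rightarrow> ('k \<Rightarrow> int) topology" where
  "Z2_power_topology \<kappa> = product_topology (\<lambda>_. Z2_topology) \<kappa>"

text \<open>The group of continuous functions \<open>X \<rightarrow> 2\<close>, as a subgroup of \<open>2\<^sup>X\<close>, and its compact-open
  topology.\<close>

definition Ck2 :: "'a topology \<Rightarrow> ('a \<Rightarrow> int) monoid" where
  "Ck2 X = (product_group (topspace X) (\<lambda>_. Z2))
     \<lparr>carrier := continuous_functions X Z2_topology\<rparr>"

definition Ck2_topology :: "'a topology \<Rightarrow> ('a \<Rightarrow> int) topology" where
  "Ck2_topology X = compact_open_topology X Z2_topology"

text \<open>The direct sum of the groups \<open>2^(\<kappa> n)\<close> with the topology induced by the box topology of
  the full product.\<close>

definition Z2_power_sum :: "(nat \<Rightarrow> 'k set) \<Rightarrow> (nat \<Rightarrow> 'k \<Rightarrow> int) monoid" where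
  "Z2_power_sum \<kappa> = sum_group UNIV (\<lambda>n. Z2_power (\<kappa> n))"

definition Z2_power_sum_box_topology :: "(nat \<Rightarrow> 'k set) \<Rightarrow> (nat \<Rightarrow> 'k \<Rightarrow> int) topology" where
  "Z2_power_sum_box_topology \<kappa> =
     subtopology (box_topology UNIV (\<lambda>n. Z2_power (\<kappa> n)) (\<lambda>n. Z2_power_topology (\<kappa> n)))
       (carrier (Z2_power_sum \<kappa>))"

end

theory Submission
  imports Defs
begin

text \<open>
  A basic neighbourhood of \<open>f\<close> in \<open>C\<^sub>k(X,2)\<close> consists of the functions that agree with \<open>f\<close> on a
  compact set, and a compact subset of \<open>C\<^sub>k(X,2)\<close> is equicontinuous: near each point of \<open>X\<close> all of its
  members are constant.

  Necessity. If \<open>X\<close> is not locally compact at \<open>x\<^sub>0\<close> and \<open>X'\<close> is not compact, take a closed discrete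
  sequence \<open>y\<^sub>n\<close> in \<open>X'\<close> and, in clopen sets \<open>U\<^sub>n\<close> shrinking to \<open>x\<^sub>0\<close>, closed discrete sequences
  \<open>z\<^sub>n\<^sub>k\<close>. The indicators of \<open>W\<^sub>n\<^sub>k \<union> B\<^sub>n\<^sub>k\<close>, where the clopen sets \<open>W\<^sub>n\<^sub>k\<close> shrink to \<open>y\<^sub>n\<close> as \<open>k\<close> grows
  and \<open>B\<^sub>n\<^sub>k\<close> is a small neighbourhood of \<open>z\<^sub>n\<^sub>k\<close>, accumulate at \<open>0\<close>, but by equicontinuity a compact set
  contains only finitely many of them. If \<open>X'\<close> is not separable, it contains an uncountable uniformly
  separated set, and Kelley's argument that \<open>\<nat>\<^sup>I\<close> is not a \<open>k\<close>-space for uncountable \<open>I\<close> applies. Hence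
  \<open>X'\<close> is Lindelof, and if \<open>X\<close> is locally compact, countably many compact open sets cover \<open>X'\<close>; their
  union is the summand \<open>L\<close>.

  Case (a). \<open>L\<close> is a disjoint union of compact open sets \<open>D\<^sub>n\<close>, so \<open>C\<^sub>k(L,2)\<close> is the product of the
  countable discrete groups \<open>C(D\<^sub>n,2)\<close>, and \<open>C\<^sub>k(D,2) = 2\<^sup>D\<close>.

  Case (b). Let \<open>W\<^sub>n\<close> be a decreasing clopen neighbourhood base of \<open>X'\<close> with \<open>W\<^sub>0 = X\<close>. A compact set
  is, up to subsets, \<open>X'\<close> together with a finite part of each discrete clopen layer
  \<open>R\<^sub>n = W\<^sub>n - W\<^sub>n\<^sub>+\<^sub>1\<close>, and a continuous function vanishing on \<open>X'\<close> vanishes on some \<open>W\<^sub>n\<close>. So the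
  functions vanishing on \<open>X'\<close> form the box direct sum of the groups \<open>2^(R\<^sub>n)\<close>. To see that a set which is
  closed on compact sets is closed, the finite subsets of the layers defining a separating
  neighbourhood are chosen inductively, using the compactness of \<open>{f. f = f\<^sub>0 on W\<^sub>n}\<close>.
\<close>

section \<open>Metrizable and zero-dimensional spaces\<close>

lemma zero_dimensional_spaceD:
  assumes "zero_dimensional_space X" "openin X U" "x \<in> U"
  obtains V where "openin X V" "closedin X V" "x \<in> V" "V \<subseteq> U"
proof -
  obtain \<B> where \<B>: "\<forall>V\<in>\<B>. openin X V \<and> closedin X V"
    and eq: "openin X = arbitrary union_of (\<lambda>V. V \<in> \<B>)"
    using assms(1) by (auto simp: zero_dimensional_space_def)
  have "(arbitrary union_of (\<lambda>V. V \<in> \<B>)) U"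
    using assms(2) by (simp flip: eq)
  then obtain \<U> where "\<U> \<subseteq> Collect (\<lambda>V. V \<in> \<B>)" "\<Union>\<U> = U"
    by (auto simp: union_of_def)
  with \<B> assms(3) that show ?thesis
    by blast
qed

section \<open>Locally finite families of open sets\<close>

lemma finite_compactin_Int_of_locally_finite:
  assumes lf: "\<And>x. x \<in> topspace X \<Longrightarrow> \<exists>N. openin X N \<and> x \<in> N \<and> finite {i \<in> I. N \<inter> P i \<noteq> {}}"
    and K: "compactin X K"
  shows "finite {i \<in> I. K \<inter> P i \<noteq> {}}"
proof -
  obtain N where N: "\<And>x. x \<in> K \<Longrightarrow> openin X (N x) \<and> x \<in> N x \<and> finite {i \<in> I. N x \<inter> P i \<noteq> {}}"
    using lf compactin_subset_topspace[OF K] by (metis subsetD)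
  obtain \<F> where \<F>: "finite \<F>" "\<F> \<subseteq> N ` K" "K \<subseteq> \<Union>\<F>"
    using K[unfolded compactin_def, THEN conjunct2, rule_format, of "N ` K"] N by blast
  have "{i \<in> I. K \<inter> P i \<noteq> {}} \<subseteq> (\<Union>F\<in>\<F>. {i \<in> I. F \<inter> P i \<noteq> {}})"
    using \<F>(3) by blast
  moreover have "finite (\<Union>F\<in>\<F>. {i \<in> I. F \<inter> P i \<noteq> {}})"
    using \<F> N by blast
  ultimately show ?thesis
    by (rule finite_subset)
qed

text \<open>By Bolzano-Weierstrass a non-compact closed set contains an infinite set without
  accumulation points. Balls about its points with radii tending to 0 form a locally finite family,
  and a compact set meets only finitely many members of such a family. Dropping one point
  \<open>x0\<close> from the infinite set costs nothing.\<close>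

lemma noncompact_closed_obtains_discrete_family:
  assumes "metrizable_space X" "closedin X S" "\<not> compactin X S"
  obtains \<sigma> :: "nat \<Rightarrow> 'a" and P where "range \<sigma> \<subseteq> S" "x0 \<notin> range \<sigma>"
    "\<And>n. openin X (P n)" "\<And>n. \<sigma> n \<in> P n"
    "\<And>K. compactin X K \<Longrightarrow> finite {n. K \<inter> P n \<noteq> {}}"
proof -
  obtain M d where "Metric_space M d" and X: "X = Metric_space.mtopology M d"
    using assms(1) unfolding metrizable_space_def by blast
  then interpret Metric_space M d by simp
  have SM: "S \<subseteq> M"
    using closedin_subset[OF assms(2)] X by simp
  obtain T where T: "T \<subseteq> S" "infinite T" "S \<inter> mtopology derived_set_of T = {}"
    using assms(3) SM unfolding X compactin_eq_Bolzano_Weierstrass by blast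
  \<comment> \<open>\<open>T\<close> was chosen without accumulation points in \<open>S\<close>. As
    \<open>S\<close> is closed, all accumulation points of \<open>T\<close> lie in \<open>S\<close>,
    so there are none at all.\<close>
  have "mtopology derived_set_of T \<subseteq> S"
    using derived_set_of_mono[OF T(1), of mtopology] assms(2) unfolding X
    by (metis closedin_contains_derived_set order_trans)
  then have T0: "mtopology derived_set_of T = {}"
    using T(3) by blast
  obtain \<sigma> :: "nat \<Rightarrow> 'a" where \<sigma>: "inj \<sigma>" "range \<sigma> \<subseteq> T - {x0}"
    using T(2) infinite_countable_subset[of "T - {x0}"] by (metis infinite_remove)
  define P where "P \<equiv> \<lambda>n. mball (\<sigma> n) (inverse (Suc n))"
  have \<sigma>M: "\<sigma> n \<in> M" for n
    using \<sigma>(2) T(1) SM by blast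
  have lf: "\<exists>N. openin X N \<and> x \<in> N \<and> finite {n \<in> UNIV. N \<inter> P n \<noteq> {}}" if "x \<in> topspace X" for x
  proof -
    have xM: "x \<in> M" using that X by simp
    have "x \<notin> mtopology derived_set_of T" using T0 by simp
    then obtain N where N: "openin mtopology N" "x \<in> N" "\<And>y. y \<noteq> x \<Longrightarrow> y \<in> T \<Longrightarrow> y \<notin> N"
      using xM unfolding derived_set_of_def by auto
    obtain r where r: "r > 0" "mball x r \<subseteq> N"
      using N(1,2) unfolding openin_mtopology by blast
    obtain m :: nat where m: "inverse (Suc m) < r/2"
      using r(1) reals_Archimedean[of "r/2"] by auto
    \<comment> \<open>For \<open>n > m\<close> the radius of \<open>P n\<close> is below
      \<open>r/2\<close>, so a ball meeting \<open>mball x (r/2)\<close> has its centre in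
      \<open>N\<close>, where \<open>x\<close> is the only possible point of \<open>T\<close>. By
      injectivity at most one index has centre \<open>x\<close>.\<close>
    have "{n \<in> UNIV. mball x (r/2) \<inter> P n \<noteq> {}} \<subseteq> {..m} \<union> \<sigma> -` {x}"
    proof (intro subsetI)
      fix n assume "n \<in> {n \<in> UNIV. mball x (r/2) \<inter> P n \<noteq> {}}"
      then obtain z where z: "z \<in> mball x (r/2)" "z \<in> mball (\<sigma> n) (inverse (Suc n))"
        unfolding P_def by blast
      show "n \<in> {..m} \<union> \<sigma> -` {x}"
      proof (cases "n \<le> m")
        case False
        then have "inverse (real (Suc n)) < r/2"
          using m by (smt (verit) le_imp_inverse_le of_nat_0_less_iff of_nat_mono not_less_eq_eq Suc_le_mono zero_less_Suc nat_le_linear)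
        then have "d x (\<sigma> n) < r"
          using z triangle[of x z "\<sigma> n"] by (auto simp: commute)
        then have "\<sigma> n \<in> N"
          using r(2) xM \<sigma>M by auto
        then show ?thesis
          using N(3) \<sigma>(2) by blast
      qed simp
    qed
    moreover have "finite ({..m} \<union> \<sigma> -` {x})"
      using \<sigma>(1) by (simp add: finite_vimageI)
    ultimately have "finite {n \<in> UNIV. mball x (r/2) \<inter> P n \<noteq> {}}"
      by (rule finite_subset)
    then show ?thesis
      using r(1) xM X openin_mball centre_in_mball_iff by (intro exI[of _ "mball x (r/2)"]) auto
  qed
  show ?thesis
  proof
    show "range \<sigma> \<subseteq> S" "x0 \<notin> range \<sigma>" using \<sigma> T by auto
    show "openin X (P n)" for n unfolding P_def X by simp
    show "\<sigma> n \<in> P n" for n unfolding P_def using \<sigma>M by simp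
    show "finite {n. K \<inter> P n \<noteq> {}}" if "compactin X K" for K
      using finite_compactin_Int_of_locally_finite[of X UNIV P, OF lf that] by simp
  qed
qed

section \<open>Second countability of metrizable spaces\<close>

text \<open>The balls of radius \<open>inverse (Suc n)\<close> about the points of the n-th net, for
  all n together, form a countable base: inside \<open>mball x r\<close> take a net point whose ball
  has radius below \<open>r/2\<close> and contains \<open>x\<close>.\<close>

lemma (in Metric_space) second_countable_mtopology_if_countable_nets:
  assumes "\<And>n::nat. \<exists>Q. countable Q \<and> Q \<subseteq> M \<and> M \<subseteq> (\<Union>q\<in>Q. mball q (inverse (Suc n)))"
  shows "second_countable mtopology"
proof -
  obtain Q where Q: "\<And>n::nat. countable (Q n) \<and> Q n \<subseteq> M \<and> M \<subseteq> (\<Union>q\<in>Q n. mball q (inverse (Suc n)))"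
    using assms by metis
  define \<B> where "\<B> = (\<Union>n. (\<lambda>q. mball q (inverse (Suc n))) ` Q n)"
  have "countable \<B>" using Q unfolding \<B>_def by blast
  moreover have "\<forall>V\<in>\<B>. openin mtopology V" unfolding \<B>_def by auto
  moreover have "\<exists>V\<in>\<B>. x \<in> V \<and> V \<subseteq> U" if U: "openin mtopology U" "x \<in> U" for U x
  proof -
    have xM: "x \<in> M" using U openin_subset by fastforce
    obtain r where r: "r > 0" "mball x r \<subseteq> U"
      using U unfolding openin_mtopology by blast
    obtain n :: nat where n: "inverse (Suc n) < r/2"
      using r(1) reals_Archimedean[of "r/2"] by auto
    obtain q where q: "q \<in> Q n" "x \<in> mball q (inverse (Suc n))"
      using Q xM by blast
    have "mball q (inverse (Suc n)) \<subseteq> mball x r"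
    proof
      fix z assume "z \<in> mball q (inverse (Suc n))"
      then show "z \<in> mball x r"
        using q n triangle[of x q z] by (auto simp: commute)
    qed
    then show ?thesis
      using q r unfolding \<B>_def by blast
  qed
  ultimately show ?thesis
    unfolding second_countable_def by blast
qed

lemma metrizable_separable_imp_second_countable:
  assumes "metrizable_space X" "separable_space X"
  shows "second_countable X"
proof -
  obtain M d where "Metric_space M d" and X: "X = Metric_space.mtopology M d"
    using assms(1) unfolding metrizable_space_def by blast
  then interpret Metric_space M d by simp
  obtain C where C: "countable C" "C \<subseteq> M" "mtopology closure_of C = M"
    using assms(2) unfolding X separable_space_def by auto
  have "M \<subseteq> (\<Union>q\<in>C. mball q (inverse (Suc n)))" for n
  proof
    fix x assume "x \<in> M"
    then have "x \<in> mtopology closure_of C" using C by simp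
    then have "\<forall>r>0. \<exists>y\<in>C. y \<in> mball x r"
      by (simp add: metric_closure_of)
    moreover have "inverse (real (Suc n)) > 0" by simp
    ultimately obtain y where "y \<in> C" "y \<in> mball x (inverse (Suc n))"
      by blast
    then show "x \<in> (\<Union>q\<in>C. mball q (inverse (Suc n)))"
      by (auto simp: commute)
  qed
  then show ?thesis
    unfolding X using C by (intro second_countable_mtopology_if_countable_nets) blast
qed

lemma metrizable_Lindelof_imp_second_countable:
  assumes "metrizable_space X" "Lindelof_space X"
  shows "second_countable X"
proof -
  obtain M d where "Metric_space M d" and X: "X = Metric_space.mtopology M d"
    using assms(1) unfolding metrizable_space_def by blast
  then interpret Metric_space M d by simp
  have "\<exists>Q. countable Q \<and> Q \<subseteq> M \<and> M \<subseteq> (\<Union>q\<in>Q. mball q (inverse (Suc n)))" for n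
  proof -
    have "\<forall>U\<in>(\<lambda>q. mball q (inverse (Suc n))) ` M. openin mtopology U"
      by auto
    moreover have "topspace mtopology \<subseteq> \<Union>((\<lambda>q. mball q (inverse (Suc n))) ` M)"
      by auto
    ultimately obtain \<V> where \<V>: "countable \<V>" "\<V> \<subseteq> (\<lambda>q. mball q (inverse (Suc n))) ` M"
      "topspace mtopology \<subseteq> \<Union>\<V>"
      using assms(2)[unfolded X Lindelof_space_alt, rule_format,
          of "(\<lambda>q. mball q (inverse (Suc n))) ` M"] by blast
    obtain Q where "countable Q" "Q \<subseteq> M" "\<V> = (\<lambda>q. mball q (inverse (Suc n))) ` Q"
      using countable_subset_image[of \<V> "\<lambda>q. mball q (inverse (Suc n))" M] \<V>(1,2) by auto
    then show ?thesis using \<V>(3) by auto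
  qed
  then show ?thesis
    unfolding X by (rule second_countable_mtopology_if_countable_nets)
qed

text \<open>Without second countability some radius \<open>r\<close> admits no countable net. A
  maximal \<open>r\<close>-separated subset, which Zorn's lemma provides, is an \<open>r\<close>-net
  by maximality, hence uncountable.\<close>

lemma (in Metric_space) uncountable_separated_set:
  assumes "S \<subseteq> M" "\<not> second_countable (subtopology mtopology S)"
  obtains E r where "E \<subseteq> S" "uncountable E" "r > 0" "\<And>x y. \<lbrakk>x \<in> E; y \<in> E; x \<noteq> y\<rbrakk> \<Longrightarrow> r \<le> d x y"
proof -
  interpret S: Submetric M d S by unfold_locales (rule assms)
  have sub: "S.sub.mtopology = subtopology mtopology S"
    by (simp add: S.mtopology_submetric)
  have "\<not> (\<forall>n::nat. \<exists>Q. countable Q \<and> Q \<subseteq> S \<and> S \<subseteq> (\<Union>q\<in>Q. S.sub.mball q (inverse (Suc n))))"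
    using S.sub.second_countable_mtopology_if_countable_nets assms(2) unfolding sub by metis
  then obtain n :: nat where n: "\<And>Q. countable Q \<Longrightarrow> Q \<subseteq> S \<Longrightarrow> \<not> S \<subseteq> (\<Union>q\<in>Q. S.sub.mball q (inverse (Suc n)))"
    by metis
  define r where "r = inverse (real (Suc n))"
  have r0: "r > 0" by (simp add: r_def)
  define A where "A = {E. E \<subseteq> S \<and> (\<forall>x\<in>E. \<forall>y\<in>E. x \<noteq> y \<longrightarrow> r \<le> d x y)}"
  have "\<exists>E\<in>A. \<forall>F\<in>A. E \<subseteq> F \<longrightarrow> F = E"
  proof (rule subset_Zorn')
    fix C assume "subset.chain A C"
    then have C: "C \<subseteq> A" "\<And>c c'. c \<in> C \<Longrightarrow> c' \<in> C \<Longrightarrow> c \<subseteq> c' \<or> c' \<subseteq> c"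
      unfolding subset_chain_def by auto
    have "r \<le> d x y" if xy: "x \<in> \<Union>C" "y \<in> \<Union>C" "x \<noteq> y" for x y
    proof -
      obtain c where "c \<in> C" "x \<in> c" "y \<in> c" using xy C(2) by blast
      then show ?thesis using C(1) xy unfolding A_def by auto
    qed
    then show "\<Union>C \<in> A" using C(1) unfolding A_def by auto
  qed
  then obtain E where E: "E \<in> A" "\<And>F. F \<in> A \<Longrightarrow> E \<subseteq> F \<Longrightarrow> F = E" by blast
  have ES: "E \<subseteq> S" using E(1) unfolding A_def by blast
  \<comment> \<open>A point at distance at least \<open>r\<close> from all of \<open>E\<close> could
    be added to \<open>E\<close>.\<close>
  have "S \<subseteq> (\<Union>q\<in>E. S.sub.mball q r)"
  proof
    fix x assume x: "x \<in> S"
    show "x \<in> (\<Union>q\<in>E. S.sub.mball q r)"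
    proof (rule ccontr)
      assume "x \<notin> (\<Union>q\<in>E. S.sub.mball q r)"
      then have far: "r \<le> d q x" if "q \<in> E" for q
        using that ES x by (auto simp: S.sub.in_mball not_less)
      then have "insert x E \<in> A"
        using E(1) x unfolding A_def by (auto simp: commute)
      then have "x \<in> E" using E(2) by blast
      then show False using far[of x] r0 assms(1) x mdist_zero by fastforce
    qed
  qed
  then have "uncountable E" using n[OF _ ES] unfolding r_def by blast
  then show ?thesis using that[OF ES _ r0] E(1) unfolding A_def by blast
qed

text \<open>Around the points of an \<open>r\<close>-separated set take balls of radius
  \<open>r/4\<close>. Two centres within \<open>r/2\<close> of a common point coincide, so these
  balls are disjoint and every ball of radius \<open>r/4\<close> meets at most one of them.\<close>

lemma not_second_countable_obtains_discrete_family: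
  assumes "metrizable_space X" "S \<subseteq> topspace X" "\<not> second_countable (subtopology X S)"
  obtains E P where "E \<subseteq> S" "uncountable E" "\<And>i. i \<in> E \<Longrightarrow> openin X (P i)" "\<And>i. i \<in> E \<Longrightarrow> i \<in> P i"
    "disjoint_family_on P E"
    "\<And>x. x \<in> topspace X \<Longrightarrow> \<exists>N. openin X N \<and> x \<in> N \<and> finite {i \<in> E. N \<inter> P i \<noteq> {}}"
proof -
  obtain M d where "Metric_space M d" and X: "X = Metric_space.mtopology M d"
    using assms(1) unfolding metrizable_space_def by blast
  then interpret Metric_space M d by simp
  have SM: "S \<subseteq> M" using assms(2) X by simp
  obtain E r where E: "E \<subseteq> S" "uncountable E" "r > 0" "\<And>x y. \<lbrakk>x \<in> E; y \<in> E; x \<noteq> y\<rbrakk> \<Longrightarrow> r \<le> d x y"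
    using uncountable_separated_set[OF SM] assms(3) X by blast
  have eq: "i = j" if "i \<in> E" "j \<in> E" "d x i < r/2" "d x j < r/2" "x \<in> M" for x i j
  proof (rule ccontr)
    assume "i \<noteq> j"
    moreover have "i \<in> M" "j \<in> M" using that E(1) SM by auto
    ultimately show False
      using E(4)[OF that(1,2)] triangle[of i x j] that by (auto simp: commute)
  qed
  define P where "P \<equiv> \<lambda>i. mball i (r/4)"
  show ?thesis
  proof
    show "E \<subseteq> S" "uncountable E" by fact+
    show "openin X (P i)" for i unfolding P_def X by simp
    show "i \<in> P i" if "i \<in> E" for i using that E(1,3) SM unfolding P_def by auto
    show "disjoint_family_on P E"
      unfolding disjoint_family_on_def P_def
    proof (intro ballI impI equals0I)
      fix i j x assume "i \<in> E" "j \<in> E" "i \<noteq> j" "x \<in> mball i (r/4) \<inter> mball j (r/4)"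
      then show False using eq[of i j x] E(3) by (auto simp: commute)
    qed
    show "\<exists>N. openin X N \<and> x \<in> N \<and> finite {i \<in> E. N \<inter> P i \<noteq> {}}" if "x \<in> topspace X" for x
    proof (intro exI conjI)
      have xM: "x \<in> M" using that X by simp
      show "openin X (mball x (r/4))" "x \<in> mball x (r/4)" using X xM E(3) by auto
      have near: "d x i < r/2" if i: "i \<in> E" "mball x (r/4) \<inter> P i \<noteq> {}" for i
      proof -
        obtain z where "z \<in> mball x (r/4)" "z \<in> mball i (r/4)" using i unfolding P_def by blast
        then show ?thesis using triangle[of x z i] by (auto simp: commute)
      qed
      show "finite {i \<in> E. mball x (r/4) \<inter> P i \<noteq> {}}"
      proof (cases "{i \<in> E. mball x (r/4) \<inter> P i \<noteq> {}} = {}")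
        case False
        then obtain j where j: "j \<in> E" "mball x (r/4) \<inter> P j \<noteq> {}" by blast
        have "{i \<in> E. mball x (r/4) \<inter> P i \<noteq> {}} \<subseteq> {j}"
          using eq near j xM by blast
        then show ?thesis using finite_subset by blast
      qed (metis finite.emptyI)
    qed
  qed
qed

section \<open>The compact-open topology and equicontinuity\<close>

abbreviation Cf :: "'a topology \<Rightarrow> ('a \<Rightarrow> int) set" where
  "Cf X \<equiv> continuous_functions X Z2_topology"

lemma carrier_Z2: "carrier Z2 = {0, 1}"
  by (auto simp: carrier_integer_mod_group)

lemma mem_Cf_iff:
  "f \<in> Cf X \<longleftrightarrow> f \<in> extensional (topspace X) \<and> (\<forall>x\<in>topspace X. f x \<in> {0, 1}) \<and>
     openin X {x \<in> topspace X. f x = 0} \<and> openin X {x \<in> topspace X. f x = 1}"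
  (is "?L \<longleftrightarrow> ?R")
proof
  assume L: ?L
  have "openin X {x \<in> topspace X. f x \<in> {c}}" if "c \<in> {0, 1}" for c
    using L that by (intro openin_continuous_map_preimage[of X Z2_topology])
      (auto simp: continuous_functions_def carrier_Z2)
  from this[of 0] this[of 1] L show ?R
    by (auto simp: continuous_functions_def continuous_map_def carrier_Z2)
next
  assume R: ?R
  have "openin X {x \<in> topspace X. f x \<in> U}" if "U \<subseteq> {0, 1}" for U
  proof -
    have "{x \<in> topspace X. f x \<in> U} =
      (if 0 \<in> U then {x \<in> topspace X. f x = 0} else {}) \<union> (if 1 \<in> U then {x \<in> topspace X. f x = 1} else {})"
      using that R by auto
    moreover have "openin X ((if 0 \<in> U then {x \<in> topspace X. f x = 0} else {}) \<union>
        (if 1 \<in> U then {x \<in> topspace X. f x = 1} else {}))"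
      using R by (intro openin_Un) auto
    ultimately show ?thesis by simp
  qed
  with R show ?L
    by (auto simp: continuous_functions_def continuous_map_def carrier_Z2)
qed

lemma Cf_values: "f \<in> Cf X \<Longrightarrow> x \<in> topspace X \<Longrightarrow> f x = 0 \<or> f x = 1"
  by (auto simp: mem_Cf_iff)

lemma Cf_extensional: "f \<in> Cf X \<Longrightarrow> f \<in> extensional (topspace X)"
  by (simp add: mem_Cf_iff)

lemma openin_Cf_level:
  assumes "f \<in> Cf X"
  shows "openin X {x \<in> topspace X. f x = c}"
proof (cases "c = 0 \<or> c = 1")
  case False
  then have "{x \<in> topspace X. f x = c} = {}" using assms by (auto dest: Cf_values)
  then show ?thesis by (metis openin_empty)
qed (use assms in \<open>auto simp: mem_Cf_iff\<close>)

lemma closedin_Cf_level: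
  assumes "f \<in> Cf X"
  shows "closedin X {x \<in> topspace X. f x = c}"
proof -
  have "topspace X - {x \<in> topspace X. f x = c} = \<Union>((\<lambda>b. {x \<in> topspace X. f x = b}) ` (UNIV - {c}))"
    by auto
  then show ?thesis
    using assms by (auto simp: closedin_def intro!: openin_Union openin_Cf_level)
qed

lemma openin_Cf_eq:
  assumes "f \<in> Cf X" "g \<in> Cf X"
  shows "openin X {x \<in> topspace X. f x = g x}"
proof -
  have "{x \<in> topspace X. f x = g x} = \<Union>((\<lambda>c. {x \<in> topspace X. f x = c} \<inter> {x \<in> topspace X. g x = c}) ` UNIV)"
    by auto
  then show ?thesis
    using assms by (auto intro!: openin_Union openin_Int openin_Cf_level)
qed

lemma Cf_eqI: "\<lbrakk>f \<in> Cf X; g \<in> Cf X; \<And>x. x \<in> topspace X \<Longrightarrow> f x = g x\<rbrakk> \<Longrightarrow> f = g"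
  by (meson Cf_extensional extensionalityI)

lemma Cf_if:
  assumes "f \<in> Cf X" "g \<in> Cf X" "openin X U" "closedin X U"
  shows "(\<lambda>x\<in>topspace X. if x \<in> U then f x else g x) \<in> Cf X"
proof -
  have "{x \<in> topspace X. (\<lambda>x\<in>topspace X. if x \<in> U then f x else g x) x = c} =
     U \<inter> {x \<in> topspace X. f x = c} \<union> (topspace X - U) \<inter> {x \<in> topspace X. g x = c}" for c
    using openin_subset[OF assms(3)] by auto
  moreover have "openin X (U \<inter> {x \<in> topspace X. f x = c} \<union> (topspace X - U) \<inter> {x \<in> topspace X. g x = c})" for c
    using assms by (intro openin_Un openin_Int openin_Cf_level) auto
  ultimately show ?thesis
    unfolding mem_Cf_iff using assms by (auto dest: Cf_values)
qed

lemma zero_in_Cf: "(\<lambda>x\<in>topspace X. 0) \<in> Cf X"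
  and one_in_Cf: "(\<lambda>x\<in>topspace X. 1) \<in> Cf X"
  by (auto simp: mem_Cf_iff)

definition clopen_ind :: "'a topology \<Rightarrow> 'a set \<Rightarrow> 'a \<Rightarrow> int" where
  "clopen_ind X U = (\<lambda>x\<in>topspace X. if x \<in> U then 1 else 0)"

lemma clopen_ind_in_Cf:
  assumes "openin X U" "closedin X U"
  shows "clopen_ind X U \<in> Cf X"
  using Cf_if[OF one_in_Cf zero_in_Cf assms] unfolding clopen_ind_def
  by (simp cong: if_cong restrict_cong)

lemma compactin_Cf_level:
  assumes "f \<in> Cf X" "compactin X K"
  shows "compactin X {x \<in> K. f x = c}"
proof -
  have "{x \<in> K. f x = c} = K \<inter> {x \<in> topspace X. f x = c}"
    using compactin_subset_topspace[OF assms(2)] by auto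
  then show ?thesis
    using compact_Int_closedin[OF assms(2) closedin_Cf_level[OF assms(1)]] by simp
qed

section \<open>Neighbourhoods, closed sets and compact sets in \<open>C_k(X,2)\<close>\<close>

text \<open>This replaces the subbase by a neighbourhood base. A subbasic set given by
  \<open>K\<close> contains, with \<open>f\<close>, all functions agreeing with \<open>f\<close> on
  \<open>K\<close>. Conversely, agreement with \<open>f\<close> on \<open>K\<close> is the
  intersection of two subbasic conditions, one for each of the compact level sets of
  \<open>f\<close> on \<open>K\<close>, since \<open>{0}\<close> and \<open>{1}\<close> are open in
  the target.\<close>

lemma openin_Ck2_topology:
  "openin (Ck2_topology X) W \<longleftrightarrow>
     W \<subseteq> Cf X \<and> (\<forall>f\<in>W. \<exists>K. compactin X K \<and> {g \<in> Cf X. \<forall>x\<in>K. g x = f x} \<subseteq> W)" (is "_ \<longleftrightarrow> ?R W")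
proof
  let ?B = "{{f \<in> Cf X. f ` K \<subseteq> U} | K U. compactin X K \<and> openin Z2_topology U}"
  assume "openin (Ck2_topology X) W"
  then have "generate_topology_on ?B W"
    by (simp add: Ck2_topology_def compact_open_topology_def openin_topology_generated_by_iff)
  then show "?R W"
  proof induction
    case Empty
    then show ?case by simp
  next
    case (Int a b)
    show ?case
    proof (intro conjI ballI)
      show "a \<inter> b \<subseteq> Cf X" using Int.IH by blast
      fix f assume "f \<in> a \<inter> b"
      then obtain K L where "compactin X K" "{g \<in> Cf X. \<forall>x\<in>K. g x = f x} \<subseteq> a"
        "compactin X L" "{g \<in> Cf X. \<forall>x\<in>L. g x = f x} \<subseteq> b"
        using Int.IH by (meson IntD1 IntD2)
      then show "\<exists>K. compactin X K \<and> {g \<in> Cf X. \<forall>x\<in>K. g x = f x} \<subseteq> a \<inter> b"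
        by (intro exI[of _ "K \<union> L"]) (auto intro: compactin_Un)
    qed
  next
    case (UN \<W>)
    show ?case
    proof (intro conjI ballI)
      show "\<Union>\<W> \<subseteq> Cf X" using UN.IH by blast
      fix f assume "f \<in> \<Union>\<W>"
      then obtain k where k: "k \<in> \<W>" "f \<in> k" by blast
      then obtain K where "compactin X K" "{g \<in> Cf X. \<forall>x\<in>K. g x = f x} \<subseteq> k"
        using UN.IH[OF k(1)] by blast
      then show "\<exists>K. compactin X K \<and> {g \<in> Cf X. \<forall>x\<in>K. g x = f x} \<subseteq> \<Union>\<W>"
        using k(1) by (intro exI[of _ K]) blast
    qed
  next
    case (Basis s)
    then obtain K U where K: "s = {f \<in> Cf X. f ` K \<subseteq> U}" "compactin X K" by blast
    show ?case unfolding K(1)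
    proof (intro conjI ballI)
      fix f assume "f \<in> {f \<in> Cf X. f ` K \<subseteq> U}"
      then show "\<exists>L. compactin X L \<and> {g \<in> Cf X. \<forall>x\<in>L. g x = f x} \<subseteq> {f \<in> Cf X. f ` K \<subseteq> U}"
        using K(2) by (intro exI[of _ K]) auto
    qed auto
  qed
next
  assume R: "?R W"
  have op: "openin (Ck2_topology X) {g \<in> Cf X. \<forall>x\<in>K. g x = f x}" if f: "f \<in> Cf X" and K: "compactin X K" for f K
  proof -
    have *: "openin (Ck2_topology X) {g \<in> Cf X. g ` {x \<in> K. f x = c} \<subseteq> {c}}" if "c \<in> {0, 1}" for c
      unfolding Ck2_topology_def compact_open_topology_def
    proof (rule topology_generated_by_Basis)
      have "compactin X {x \<in> K. f x = c} \<and> openin Z2_topology {c}"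
        using compactin_Cf_level[OF f K] that by (simp add: carrier_Z2)
      then show "{g \<in> Cf X. g ` {x \<in> K. f x = c} \<subseteq> {c}}
          \<in> {{f \<in> Cf X. f ` K \<subseteq> U} |K U. compactin X K \<and> openin Z2_topology U}"
        by blast
    qed
    have "{g \<in> Cf X. \<forall>x\<in>K. g x = f x} =
        {g \<in> Cf X. g ` {x \<in> K. f x = 0} \<subseteq> {0}} \<inter> {g \<in> Cf X. g ` {x \<in> K. f x = 1} \<subseteq> {1}}"
      (is "?l = ?a \<inter> ?b")
    proof (intro equalityI subsetI)
      fix g assume g: "g \<in> ?a \<inter> ?b"
      have "g x = f x" if "x \<in> K" for x
        using Cf_values[OF f subsetD[OF compactin_subset_topspace[OF K] that]] g that by auto
      with g show "g \<in> ?l" by blast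
    qed auto
    then show ?thesis
      using *[of 0] *[of 1] by (simp add: openin_Int)
  qed
  show "openin (Ck2_topology X) W"
  proof (subst openin_subopen, intro ballI)
    fix f assume f: "f \<in> W"
    then obtain K where "compactin X K" "{g \<in> Cf X. \<forall>x\<in>K. g x = f x} \<subseteq> W" using R by blast
    then show "\<exists>T. openin (Ck2_topology X) T \<and> f \<in> T \<and> T \<subseteq> W"
      using op[of f K] f R by blast
  qed
qed

lemma topspace_Ck2_topology [simp]: "topspace (Ck2_topology X) = Cf X"
  by (simp add: Ck2_topology_def topspace_compact_open_topology)

lemma openin_Ck2_agree:
  assumes "compactin X K"
  shows "openin (Ck2_topology X) {g \<in> Cf X. \<forall>x\<in>K. g x = f x}"
  unfolding openin_Ck2_topology
proof (intro conjI ballI)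
  fix h assume "h \<in> {g \<in> Cf X. \<forall>x\<in>K. g x = f x}"
  then show "\<exists>L. compactin X L \<and> {g \<in> Cf X. \<forall>x\<in>L. g x = h x} \<subseteq> {g \<in> Cf X. \<forall>x\<in>K. g x = f x}"
    using assms by (intro exI[of _ K]) simp
qed blast

text \<open>Finite sets are compact, so the compact-open topology is finer than pointwise
  convergence and pointwise closed sets are closed.\<close>

lemma closedin_Ck2I:
  assumes "A \<subseteq> Cf X"
    and "\<And>f. \<lbrakk>f \<in> Cf X; \<And>F. \<lbrakk>finite F; F \<subseteq> topspace X\<rbrakk> \<Longrightarrow> \<exists>g\<in>A. \<forall>x\<in>F. g x = f x\<rbrakk> \<Longrightarrow> f \<in> A"
  shows "closedin (Ck2_topology X) A"
proof -
  have "\<exists>K. compactin X K \<and> {g \<in> Cf X. \<forall>x\<in>K. g x = f x} \<subseteq> Cf X - A" if f: "f \<in> Cf X - A" for f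
  proof -
    obtain F where "finite F" "F \<subseteq> topspace X" "\<not> (\<exists>g\<in>A. \<forall>x\<in>F. g x = f x)"
      using assms(2)[of f] f by blast
    then show ?thesis
      by (intro exI[of _ F]) (auto intro: finite_imp_compactin)
  qed
  then show ?thesis
    using assms(1) by (auto simp: closedin_def openin_Ck2_topology)
qed

lemma closedin_Ck2_agree:
  assumes "f \<in> Cf X" "S \<subseteq> topspace X"
  shows "closedin (Ck2_topology X) {g \<in> Cf X. \<forall>x\<in>S. g x = f x}"
proof (rule closedin_Ck2I)
  fix h assume h: "h \<in> Cf X" "\<And>F. \<lbrakk>finite F; F \<subseteq> topspace X\<rbrakk> \<Longrightarrow> \<exists>g\<in>{g \<in> Cf X. \<forall>x\<in>S. g x = f x}. \<forall>x\<in>F. g x = h x"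
  have "h x = f x" if "x \<in> S" for x
    using h(2)[of "{x}"] that assms(2) by fastforce
  then show "h \<in> {g \<in> Cf X. \<forall>x\<in>S. g x = f x}" using h by blast
qed blast

lemma Hausdorff_Ck2_topology: "Hausdorff_space (Ck2_topology X)"
  unfolding Hausdorff_space_def
proof (intro allI impI, elim conjE)
  fix f g assume fg: "f \<in> topspace (Ck2_topology X)" "g \<in> topspace (Ck2_topology X)" "f \<noteq> g"
  then obtain x where x: "x \<in> topspace X" "f x \<noteq> g x" by (auto intro: Cf_eqI)
  then show "\<exists>U V. openin (Ck2_topology X) U \<and> openin (Ck2_topology X) V \<and> f \<in> U \<and> g \<in> V \<and> disjnt U V"
    using fg by (intro exI[of _ "{h \<in> Cf X. \<forall>y\<in>{x}. h y = f y}"] exI[of _ "{h \<in> Cf X. \<forall>y\<in>{x}. h y = g y}"]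
        conjI openin_Ck2_agree) (auto simp: disjnt_def)
qed

lemma continuous_map_into_Ck2:
  assumes "\<And>y. y \<in> topspace Y \<Longrightarrow> F y \<in> Cf X"
    and "\<And>y K. \<lbrakk>y \<in> topspace Y; compactin X K\<rbrakk> \<Longrightarrow>
           \<exists>N. openin Y N \<and> y \<in> N \<and> (\<forall>z\<in>N. \<forall>x\<in>K. F z x = F y x)"
  shows "continuous_map Y (Ck2_topology X) F"
proof (clarsimp simp: continuous_map_def assms)
  fix W assume W: "openin (Ck2_topology X) W"
  show "openin Y {x \<in> topspace Y. F x \<in> W}"
  proof (subst openin_subopen, clarify)
    fix y assume y: "y \<in> topspace Y" "F y \<in> W"
    then obtain K where K: "compactin X K" "{g \<in> Cf X. \<forall>x\<in>K. g x = F y x} \<subseteq> W"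
      using W unfolding openin_Ck2_topology by blast
    obtain N where N: "openin Y N" "y \<in> N" "\<forall>z\<in>N. \<forall>x\<in>K. F z x = F y x"
      using assms(2)[OF y(1) K(1)] by blast
    have "N \<subseteq> {x \<in> topspace Y. F x \<in> W}"
      using N K assms(1) openin_subset[OF N(1)] by blast
    then show "\<exists>T. openin Y T \<and> y \<in> T \<and> T \<subseteq> {x \<in> topspace Y. F x \<in> W}"
      using N by blast
  qed
qed

text \<open>Otherwise there are \<open>f n\<close> in \<open>C\<close> and points \<open>y n\<close>
  tending to \<open>x\<close> with \<open>f n (y n) \<noteq> f n x\<close>. The sequence with its
  limit is compact, so by compactness of \<open>C\<close> only finitely many restrictions of members
  of \<open>C\<close> to it occur. These are continuous at \<open>x\<close>, hence for large n all
  of them take the same value at \<open>y n\<close> as at \<open>x\<close>.\<close>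

lemma compactin_Ck2_equicontinuous:
  assumes X: "metrizable_space X" and C: "compactin (Ck2_topology X) C" and x: "x \<in> topspace X"
  obtains N where "openin X N" "x \<in> N" "\<And>f y. \<lbrakk>f \<in> C; y \<in> N\<rbrakk> \<Longrightarrow> f y = f x"
proof -
  obtain M d where "Metric_space M d" and Xd: "X = Metric_space.mtopology M d"
    using X unfolding metrizable_space_def by blast
  then interpret Metric_space M d by simp
  have xM: "x \<in> M" using x Xd by simp
  have CX: "C \<subseteq> Cf X" using compactin_subset_topspace[OF C] by simp
  have "\<exists>n::nat. \<forall>f\<in>C. \<forall>y\<in>mball x (inverse (Suc n)). f y = f x"
  proof (rule ccontr)
    assume "\<nexists>n::nat. \<forall>f\<in>C. \<forall>y\<in>mball x (inverse (Suc n)). f y = f x"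
    then have "\<forall>n::nat. \<exists>f y. f \<in> C \<and> y \<in> mball x (inverse (Suc n)) \<and> f y \<noteq> f x"
      by blast
    then obtain f y where fy: "\<And>n::nat. f n \<in> C" "\<And>n. y n \<in> mball x (inverse (Suc n))" "\<And>n. f n (y n) \<noteq> f n x"
      by metis
    have lim: "limitin X y x sequentially"
    proof -
      have "(\<lambda>n. d (y n) x) \<longlonglongrightarrow> 0"
      proof (rule real_tendsto_sandwich[OF _ _ tendsto_const LIMSEQ_inverse_real_of_nat])
        show "\<forall>\<^sub>F n in sequentially. d (y n) x \<le> inverse (real (Suc n))"
          using fy(2) by (intro always_eventually) (auto simp: commute less_imp_le)
      qed simp
      then show ?thesis
        unfolding Xd limitin_metric_dist_null using xM fy(2) by auto
    qed
    have "range y \<subseteq> topspace X" using fy(2) Xd by auto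
    then have K: "compactin X (insert x (range y))"
      using compactin_sequence_with_limit[OF lim order_refl] by simp
    \<comment> \<open>Each member of this cover collects the functions with one fixed restriction to
      the convergent sequence, so a finite subcover leaves finitely many restrictions.\<close>
    define \<U> where "\<U> = (\<lambda>h. {g \<in> Cf X. \<forall>z\<in>insert x (range y). g z = h z}) ` C"
    have op: "\<And>U. U \<in> \<U> \<Longrightarrow> openin (Ck2_topology X) U"
      unfolding \<U>_def using K openin_Ck2_agree by blast
    have cov: "C \<subseteq> \<Union>\<U>" unfolding \<U>_def using CX by blast
    obtain \<F> where \<F>: "finite \<F>" "\<F> \<subseteq> \<U>" "C \<subseteq> \<Union>\<F>"
      using compactinD[OF C op cov] by metis
    then obtain H where H: "finite H" "H \<subseteq> C" "\<F> = (\<lambda>h. {g \<in> Cf X. \<forall>z\<in>insert x (range y). g z = h z}) ` H"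
      unfolding \<U>_def by (meson finite_subset_image)
    have "\<forall>\<^sub>F n in sequentially. h (y n) = h x" if "h \<in> H" for h
    proof -
      have "openin X {z \<in> topspace X. h z = h x}"
        using openin_Cf_level H(2) CX that by blast
      then show ?thesis
        using lim x unfolding limitin_def by (auto elim: eventually_mono)
    qed
    then have "\<forall>\<^sub>F n in sequentially. \<forall>h\<in>H. h (y n) = h x"
      using H(1) by (simp add: eventually_ball_finite)
    then obtain n where n: "\<forall>h\<in>H. h (y n) = h x"
      by (auto simp: eventually_sequentially)
    obtain h where "h \<in> H" "\<forall>z\<in>insert x (range y). f n z = h z"
      using \<F>(3) H(3) fy(1)[of n] by blast
    then show False using n fy(3)[of n] by simp
  qed
  then obtain n :: nat where "\<forall>f\<in>C. \<forall>y\<in>mball x (inverse (Suc n)). f y = f x" by blast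
  then show ?thesis
    using that[of "mball x (inverse (Suc n))"] xM Xd by auto
qed

section \<open>Necessity: local compactness\<close>

lemma closedin_UN_locally_finite:
  assumes lf: "\<And>x. x \<in> topspace X \<Longrightarrow> \<exists>N. openin X N \<and> x \<in> N \<and> finite {i \<in> I. N \<inter> P i \<noteq> {}}"
    and Q: "\<And>i. i \<in> I \<Longrightarrow> closedin X (Q i)" "\<And>i. i \<in> I \<Longrightarrow> Q i \<subseteq> P i"
  shows "closedin X (\<Union>i\<in>I. Q i)"
proof -
  have sub: "(\<Union>i\<in>I. Q i) \<subseteq> topspace X"
    using Q(1) closedin_subset by blast
  have "\<exists>T. openin X T \<and> x \<in> T \<and> T \<subseteq> topspace X - (\<Union>i\<in>I. Q i)" if x: "x \<in> topspace X - (\<Union>i\<in>I. Q i)" for x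
  proof -
    obtain N where N: "openin X N" "x \<in> N" "finite {i \<in> I. N \<inter> P i \<noteq> {}}"
      using lf x by blast
    have "closedin X (\<Union>(Q ` {i \<in> I. N \<inter> P i \<noteq> {}}))"
      using N(3) Q(1) by (intro closedin_Union) auto
    then have "openin X (N - \<Union>(Q ` {i \<in> I. N \<inter> P i \<noteq> {}}))"
      using N(1) by (rule openin_diff[rotated])
    moreover have "N - \<Union>(Q ` {i \<in> I. N \<inter> P i \<noteq> {}}) \<subseteq> topspace X - (\<Union>i\<in>I. Q i)"
      using openin_subset[OF N(1)] Q(2) by blast
    moreover have "x \<in> N - \<Union>(Q ` {i \<in> I. N \<inter> P i \<noteq> {}})"
      using x N(2) by blast
    ultimately show ?thesis by blast
  qed
  then have "openin X (topspace X - (\<Union>i\<in>I. Q i))"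
    by (subst openin_subopen) blast
  then show ?thesis using sub by (simp add: closedin_def)
qed

text \<open>The two necessity arguments supply a set \<open>B\<close> closed in the whole space: a
  finite set in one, a finite union of closed sets in the other.\<close>

lemma k_space_closedinI:
  assumes "k_space Y" "A \<subseteq> topspace Y"
    and "\<And>C. compactin Y C \<Longrightarrow> \<exists>B. closedin Y B \<and> C \<inter> A = C \<inter> B"
  shows "closedin Y A"
proof -
  have "closedin (subtopology Y C) (C \<inter> A)" if C: "compactin Y C" for C
  proof -
    obtain B where "closedin Y B" "C \<inter> A = C \<inter> B"
      using assms(3)[OF C] by blast
    then show ?thesis
      by (auto simp: closedin_subtopology_Int_closed)
  qed
  then show ?thesis
    using assms(1,2) unfolding k_space_def by blast
qed

text \<open>The hypothesis on compact sets says that the zero function is in the closure of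
  \<open>A\<close>. Both necessity arguments end here, with a set \<open>A\<close> that does not
  contain it.\<close>

lemma zero_in_closed_of_Ck2:
  assumes "closedin (Ck2_topology X) A"
    and "\<And>K. compactin X K \<Longrightarrow> \<exists>g\<in>A. \<forall>x\<in>K. g x = 0"
  shows "(\<lambda>x\<in>topspace X. 0) \<in> A"
proof (rule ccontr)
  let ?z = "\<lambda>x\<in>topspace X. 0::int"
  assume "?z \<notin> A"
  then have "?z \<in> Cf X - A" using zero_in_Cf by blast
  moreover have "openin (Ck2_topology X) (Cf X - A)"
    using assms(1) by (simp add: closedin_def)
  ultimately obtain K where K: "compactin X K" "{g \<in> Cf X. \<forall>x\<in>K. g x = ?z x} \<subseteq> Cf X - A"
    unfolding openin_Ck2_topology by blast
  obtain g where g: "g \<in> A" "\<forall>x\<in>K. g x = 0"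
    using assms(2)[OF K(1)] by blast
  moreover have "g \<in> Cf X" using closedin_subset[OF assms(1)] g(1) by auto
  moreover have "\<forall>x\<in>K. ?z x = 0" using compactin_subset_topspace[OF K(1)] by auto
  ultimately show False using K(2) by auto
qed

lemma clopen_ind_simps:
  "x \<in> topspace X \<Longrightarrow> x \<in> U \<Longrightarrow> clopen_ind X U x = 1"
  "x \<in> topspace X \<Longrightarrow> x \<notin> U \<Longrightarrow> clopen_ind X U x = 0"
  by (auto simp: clopen_ind_def)

text \<open>The sets need not be nested. As \<open>W k\<close> lies in the ball of radius
  \<open>inverse (Suc k)\<close> about \<open>x\<close>, they nevertheless enter every neighbourhood
  of \<open>x\<close> for good.\<close>

lemma shrinking_clopen_neighbourhoods:
  assumes "metrizable_space X" "zero_dimensional_space X" "openin X P" "x \<in> P"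
  obtains W :: "nat \<Rightarrow> 'a set" where "\<And>k. openin X (W k)" "\<And>k. closedin X (W k)" "\<And>k. x \<in> W k" "\<And>k. W k \<subseteq> P"
    "\<And>N. openin X N \<Longrightarrow> x \<in> N \<Longrightarrow> \<exists>m. \<forall>k\<ge>m. W k \<subseteq> N"
proof -
  obtain M d where "Metric_space M d" and X: "X = Metric_space.mtopology M d"
    using assms(1) unfolding metrizable_space_def by blast
  then interpret Metric_space M d by simp
  have xM: "x \<in> M" using openin_subset[OF assms(3)] assms(4) X by auto
  have "\<exists>V. openin X V \<and> closedin X V \<and> x \<in> V \<and> V \<subseteq> P \<inter> mball x (inverse (Suc k))" for k
  proof -
    have "openin X (P \<inter> mball x (inverse (Suc k)))" "x \<in> P \<inter> mball x (inverse (Suc k))"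
      using assms(3,4) X xM by auto
    then show ?thesis using zero_dimensional_spaceD[OF assms(2)] by metis
  qed
  then obtain W where W: "\<And>k. openin X (W k) \<and> closedin X (W k) \<and> x \<in> W k \<and> W k \<subseteq> P \<inter> mball x (inverse (Suc k))"
    by metis
  have "\<exists>m. \<forall>k\<ge>m. W k \<subseteq> N" if N: "openin X N" "x \<in> N" for N
  proof -
    obtain r where r: "r > 0" "mball x r \<subseteq> N"
      using N unfolding X openin_mtopology by blast
    obtain m :: nat where m: "inverse (Suc m) < r"
      using r(1) reals_Archimedean by auto
    have "W k \<subseteq> N" if "k \<ge> m" for k
    proof -
      have "inverse (real (Suc k)) \<le> inverse (Suc m)"
        using that by (intro le_imp_inverse_le) auto
      then have "mball x (inverse (Suc k)) \<subseteq> mball x r"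
        using m by (intro mball_subset_concentric) linarith
      then show ?thesis using W r(2) by blast
    qed
    then show ?thesis by blast
  qed
  then show ?thesis using that[of W] W by blast
qed

lemma nonisolated_obtains:
  assumes "x \<in> X derived_set_of topspace X" "openin X N" "x \<in> N"
  obtains p where "p \<in> N" "p \<noteq> x" "p \<in> topspace X"
  using assms unfolding derived_set_of_def by blast

lemma shrinking_neighbourhoods_miss:
  assumes "Hausdorff_space X" "x \<in> topspace X" "p \<in> topspace X" "p \<noteq> x"
    and "\<And>N. openin X N \<Longrightarrow> x \<in> N \<Longrightarrow> \<exists>m::nat. \<forall>k\<ge>m. W k \<subseteq> N"
  shows "\<exists>m. \<forall>k\<ge>m. p \<notin> W k"
proof -
  have "openin X (topspace X - {p})"
    using closedin_Hausdorff_singleton[OF assms(1,3)] by blast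
  then show ?thesis using assms(5)[of "topspace X - {p}"] assms(2,4) by blast
qed

text \<open>The set \<open>A\<close> of all \<open>f n k\<close> has the zero function as an
  accumulation point without containing it, yet meets each compact set in a finite set:
  equicontinuity at \<open>x0\<close> bounds \<open>n\<close>, and for each \<open>n\<close>
  equicontinuity at the non-isolated point \<open>y n\<close> bounds \<open>k\<close>.\<close>

lemma k_space_Ck2_imp_locally_compact:
  assumes X: "metrizable_space X" "zero_dimensional_space X" and k: "k_space (Ck2_topology X)"
    and nc: "\<not> compactin X (X derived_set_of topspace X)"
  shows "locally_compact_space X"
proof (rule ccontr)
  assume "\<not> locally_compact_space X"
  then obtain x0 where x0: "x0 \<in> topspace X" "\<And>U K. \<lbrakk>openin X U; compactin X K; x0 \<in> U\<rbrakk> \<Longrightarrow> \<not> U \<subseteq> K"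
    unfolding locally_compact_space_def by blast
  have H: "Hausdorff_space X" using X(1) by (rule metrizable_imp_Hausdorff_space)
  let ?D = "X derived_set_of topspace X"
  have clD: "closedin X ?D"
    using closedin_derived_set_of[OF H] .
  obtain y :: "nat \<Rightarrow> 'a" and P where y: "range y \<subseteq> ?D" "x0 \<notin> range y" and P: "\<And>n. openin X (P n)" "\<And>n. y n \<in> P n"
    "\<And>K. compactin X K \<Longrightarrow> finite {n. K \<inter> P n \<noteq> {}}"
    using noncompact_closed_obtains_discrete_family[OF X(1) clD nc, of x0] by metis
  have yX: "y n \<in> topspace X" for n using P openin_subset by blast
  have "\<exists>V. openin X V \<and> closedin X V \<and> y n \<in> V \<and> V \<subseteq> P n - {x0}" for n
  proof -
    have "openin X (P n - {x0})" "y n \<in> P n - {x0}"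
      using P y(2) closedin_Hausdorff_singleton[OF H x0(1)] by (auto intro: openin_diff)
    then show ?thesis using zero_dimensional_spaceD[OF X(2)] by metis
  qed
  then obtain V where V: "\<And>n. openin X (V n)" "\<And>n. closedin X (V n)" "\<And>n. y n \<in> V n" "\<And>n. V n \<subseteq> P n" "\<And>n. x0 \<notin> V n"
    by (metis Diff_iff insertI1 subset_Diff_insert subset_iff)
  have "\<exists>W. \<forall>k::nat. openin X (W k) \<and> closedin X (W k) \<and> y n \<in> W k \<and> W k \<subseteq> V n \<and>
      (\<forall>N. openin X N \<longrightarrow> y n \<in> N \<longrightarrow> (\<exists>m. \<forall>k\<ge>m. W k \<subseteq> N))" for n
    by (rule shrinking_clopen_neighbourhoods[OF X V(1) V(3), of n]) blast
  then obtain W where W: "\<And>n k::nat. openin X (W n k)" "\<And>n k. closedin X (W n k)" "\<And>n k. y n \<in> W n k"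
    "\<And>n k. W n k \<subseteq> V n" "\<And>n N. openin X N \<Longrightarrow> y n \<in> N \<Longrightarrow> \<exists>m. \<forall>k\<ge>m. W n k \<subseteq> N"
    by metis
  obtain G :: "nat \<Rightarrow> 'a set" where G: "\<And>n. openin X (G n)" "\<And>n. closedin X (G n)" "\<And>n. x0 \<in> G n"
    "\<And>N. openin X N \<Longrightarrow> x0 \<in> N \<Longrightarrow> \<exists>m. \<forall>n\<ge>m. G n \<subseteq> N"
    using shrinking_clopen_neighbourhoods[OF X openin_topspace x0(1)] by metis
  \<comment> \<open>Removing \<open>V n\<close> keeps the sets \<open>B n k\<close> chosen below
    disjoint from \<open>V n\<close>, so on \<open>V n\<close> the function \<open>f n k\<close> is
    the indicator of \<open>W n k\<close> alone.\<close>
  define U where "U \<equiv> \<lambda>n. G n - V n"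
  have U: "openin X (U n)" "closedin X (U n)" "x0 \<in> U n" for n
    unfolding U_def using G V by (auto intro: openin_diff closedin_diff)
  have "\<exists>z Q. (\<forall>k::nat. z k \<in> U n \<and> z k \<noteq> x0 \<and> openin X (Q k) \<and> z k \<in> Q k) \<and>
      (\<forall>K. compactin X K \<longrightarrow> finite {k. K \<inter> Q k \<noteq> {}})" for n
  proof -
    \<comment> \<open>No neighbourhood of \<open>x0\<close> lies in a compact set, so each
      \<open>U n\<close> contains a sequence of its own with a locally finite family of
      neighbourhoods.\<close>
    have "\<not> compactin X (U n)" using U x0(2) by blast
    then obtain z :: "nat \<Rightarrow> 'a" and Q where "range z \<subseteq> U n" "x0 \<notin> range z" "\<And>k. openin X (Q k)" "\<And>k. z k \<in> Q k"
      "\<And>K. compactin X K \<Longrightarrow> finite {k. K \<inter> Q k \<noteq> {}}"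
      using noncompact_closed_obtains_discrete_family[OF X(1) U(2), of n x0] by metis
    then show ?thesis by (intro exI[of _ z] exI[of _ Q]) auto
  qed
  then obtain z Q where z: "\<And>n k::nat. z n k \<in> U n" "\<And>n k. z n k \<noteq> x0" "\<And>n k. openin X (Q n k)" "\<And>n k. z n k \<in> Q n k"
    "\<And>n K. compactin X K \<Longrightarrow> finite {k. K \<inter> Q n k \<noteq> {}}"
    by metis
  have "\<exists>B. openin X B \<and> closedin X B \<and> z n k \<in> B \<and> B \<subseteq> Q n k \<inter> U n - {x0}" for n k
  proof -
    have "openin X (Q n k \<inter> U n - {x0})" "z n k \<in> Q n k \<inter> U n - {x0}"
      using z U closedin_Hausdorff_singleton[OF H x0(1)] by (auto intro!: openin_diff openin_Int)
    then show ?thesis using zero_dimensional_spaceD[OF X(2)] by metis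
  qed
  then obtain B where B: "\<And>n k. openin X (B n k) \<and> closedin X (B n k) \<and> z n k \<in> B n k \<and> B n k \<subseteq> Q n k \<inter> U n - {x0}"
    by metis
  have zX: "z n k \<in> topspace X" for n k using z openin_subset by blast
  define f where "f \<equiv> \<lambda>n k. clopen_ind X (W n k \<union> B n k)"
  have fC: "f n k \<in> Cf X" for n k
    unfolding f_def using W B by (intro clopen_ind_in_Cf) (auto intro: openin_Un closedin_Un)
  define A where "A = range (\<lambda>(n, k). f n k)"
  have fy: "f n k (y n) = 1" and fz: "f n k (z n k) = 1" and fx0: "f n k x0 = 0" for n k
  proof -
    have "y n \<in> W n k \<union> B n k" "z n k \<in> W n k \<union> B n k" "x0 \<notin> W n k \<union> B n k"
      using W(3,4)[of n k] B[of n k] V(5)[of n] by blast+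
    then show "f n k (y n) = 1" "f n k (z n k) = 1" "f n k x0 = 0"
      unfolding f_def using yX zX x0(1) by (auto simp: clopen_ind_def)
  qed
  have "closedin (Ck2_topology X) A"
  proof (rule k_space_closedinI[OF k])
    show "A \<subseteq> topspace (Ck2_topology X)" unfolding A_def using fC by auto
    fix C assume C: "compactin (Ck2_topology X) C"
    obtain N0 where N0: "openin X N0" "x0 \<in> N0" "\<And>g x. \<lbrakk>g \<in> C; x \<in> N0\<rbrakk> \<Longrightarrow> g x = g x0"
      using compactin_Ck2_equicontinuous[OF X(1) C x0(1)] by metis
    obtain m where m: "\<And>n. n \<ge> m \<Longrightarrow> G n \<subseteq> N0" using G(4)[OF N0(1,2)] by blast
    have n_less: "n < m" if "f n k \<in> C" for n k
    proof (rule ccontr)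
      assume "\<not> n < m"
      then have "z n k \<in> N0" using m[of n] z(1) unfolding U_def by auto
      then show False using N0(3)[OF that] fz fx0 by (metis zero_neq_one)
    qed
    have "\<exists>j. \<forall>k. f n k \<in> C \<longrightarrow> k < j" for n
    proof -
      obtain N where N: "openin X N" "y n \<in> N" "\<And>g x. \<lbrakk>g \<in> C; x \<in> N\<rbrakk> \<Longrightarrow> g x = g (y n)"
        using compactin_Ck2_equicontinuous[OF X(1) C yX] by metis
      \<comment> \<open>The sets \<open>W n k\<close> shrink to \<open>y n\<close> and eventually
        miss \<open>p\<close>. Then \<open>f n k\<close> is 0 at \<open>p\<close> and 1 at
        \<open>y n\<close>, which is impossible for a member of \<open>C\<close>.\<close>
      obtain p where p: "p \<in> N \<inter> V n" "p \<noteq> y n" "p \<in> topspace X"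
        using nonisolated_obtains[of "y n" X "N \<inter> V n"] y(1) N V by blast
      obtain j where j: "\<And>k. k \<ge> j \<Longrightarrow> p \<notin> W n k"
        using shrinking_neighbourhoods_miss[OF H yX p(3,2) W(5)] by blast
      have "k < j" if "f n k \<in> C" for k
      proof (rule ccontr)
        assume "\<not> k < j"
        then have "f n k p = 0"
          using j[of k] p B[of n k] unfolding f_def U_def by (intro clopen_ind_simps) auto
        then show False using N(3)[OF that] p(1) fy by (metis IntD1 zero_neq_one)
      qed
      then show ?thesis by blast
    qed
    then obtain j where j: "\<And>n k. f n k \<in> C \<Longrightarrow> k < j n" by metis
    have "C \<inter> A \<subseteq> (\<lambda>(n, k). f n k) ` (SIGMA n:{..<m}. {..<j n})"
      unfolding A_def using j n_less by auto
    then have "finite (C \<inter> A)" by (rule finite_subset) auto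
    moreover have "C \<inter> A \<subseteq> Cf X" using compactin_subset_topspace[OF C] by auto
    ultimately have "closedin (Ck2_topology X) (C \<inter> A)"
      using Hausdorff_Ck2_topology by (intro compactin_imp_closedin finite_imp_compactin) auto
    then show "\<exists>B. closedin (Ck2_topology X) B \<and> C \<inter> A = C \<inter> B"
      by (intro exI[of _ "C \<inter> A"]) auto
  qed
  then have "(\<lambda>x\<in>topspace X. 0) \<in> A"
  proof (rule zero_in_closed_of_Ck2)
    fix K assume K: "compactin X K"
    \<comment> \<open>First \<open>n\<close> is chosen with \<open>K\<close> off \<open>P n\<close>,
      hence off all \<open>W n k\<close>; then, for this \<open>n\<close>, some \<open>k\<close>
      with \<open>K\<close> off \<open>Q n k\<close>, hence off \<open>B n k\<close>.\<close>
    obtain n where n: "K \<inter> P n = {}"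
      using P(3)[OF K] infinite_UNIV_nat by (metis (mono_tags, lifting) UNIV_eq_I mem_Collect_eq)
    obtain k where kk: "K \<inter> Q n k = {}"
      using z(5)[OF K, of n] infinite_UNIV_nat by (metis (mono_tags, lifting) UNIV_eq_I mem_Collect_eq)
    have "f n k x = 0" if "x \<in> K" for x
      unfolding f_def using that n kk W(4)[of n k] V(4)[of n] B[of n k] compactin_subset_topspace[OF K]
      by (intro clopen_ind_simps) auto
    then show "\<exists>g\<in>A. \<forall>x\<in>K. g x = 0" unfolding A_def by blast
  qed
  then obtain n k where "f n k = (\<lambda>x\<in>topspace X. 0)" unfolding A_def by auto
  then show False using fy[of n k] yX[of n] by simp
qed

section \<open>Necessity: separability of the derived set\<close>

text \<open>An uncountable locally finite family around points of the derived set lets Kelley's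
  example be copied: \<open>h n F\<close> is 1 on the n-th neighbourhood of every \<open>i\<close>
  in \<open>E - F\<close> and 0 elsewhere. The union of the sets \<open>T n\<close> is not closed,
  since it accumulates at the zero function and omits it. Each \<open>T n\<close> is closed, and a
  compact set meets only finitely many of them.\<close>

lemma k_space_Ck2_imp_second_countable_derived_set:
  assumes X: "metrizable_space X" "zero_dimensional_space X" and k: "k_space (Ck2_topology X)"
  shows "second_countable (subtopology X (X derived_set_of topspace X))"
proof (rule ccontr)
  let ?D = "X derived_set_of topspace X"
  assume nsc: "\<not> second_countable (subtopology X ?D)"
  have H: "Hausdorff_space X" using X(1) by (rule metrizable_imp_Hausdorff_space)
  have DX: "?D \<subseteq> topspace X" by (rule derived_set_of_subset_topspace)
  obtain E P where E: "E \<subseteq> ?D" "uncountable E" and P: "\<And>i. i \<in> E \<Longrightarrow> openin X (P i)" "\<And>i. i \<in> E \<Longrightarrow> i \<in> P i"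
    "disjoint_family_on P E"
    and lf: "\<And>x. x \<in> topspace X \<Longrightarrow> \<exists>N. openin X N \<and> x \<in> N \<and> finite {i \<in> E. N \<inter> P i \<noteq> {}}"
    by (rule not_second_countable_obtains_discrete_family[OF X(1) DX nsc]) (rule that)
  have EX: "E \<subseteq> topspace X" using E(1) DX by blast
  have infE: "infinite E" using E(2) countable_finite by blast
  have "\<exists>W. \<forall>k::nat. openin X (W k) \<and> closedin X (W k) \<and> i \<in> W k \<and> W k \<subseteq> P i \<and>
      (\<forall>N. openin X N \<longrightarrow> i \<in> N \<longrightarrow> (\<exists>m. \<forall>k\<ge>m. W k \<subseteq> N))" if "i \<in> E" for i
    by (rule shrinking_clopen_neighbourhoods[OF X P(1) P(2), OF that that]) blast
  then obtain W where W': "\<And>i k. i \<in> E \<Longrightarrow> openin X (W i k) \<and> closedin X (W i k) \<and> i \<in> W i k \<and> W i k \<subseteq> P i \<and>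
      (\<forall>N. openin X N \<longrightarrow> i \<in> N \<longrightarrow> (\<exists>m::nat. \<forall>k\<ge>m. W i k \<subseteq> N))"
    by metis
  then have W: "\<And>i k. i \<in> E \<Longrightarrow> openin X (W i k)" "\<And>i k. i \<in> E \<Longrightarrow> closedin X (W i k)"
    "\<And>i k. i \<in> E \<Longrightarrow> i \<in> W i k" "\<And>i k. i \<in> E \<Longrightarrow> W i k \<subseteq> P i"
    "\<And>i N. \<lbrakk>i \<in> E; openin X N; i \<in> N\<rbrakk> \<Longrightarrow> \<exists>m. \<forall>k\<ge>m. W i k \<subseteq> N"
    by blast+
  have disj: "i = j" if "i \<in> E" "j \<in> E" "x \<in> P i" "x \<in> P j" for i j x
    using P(3) that unfolding disjoint_family_on_def by blast
  define h where "h \<equiv> \<lambda>n F. clopen_ind X (\<Union>i\<in>E - F. W i n)"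
  have hC: "h n F \<in> Cf X" for n F
  proof -
    have "openin X (\<Union>i\<in>E - F. W i n)" using W(1) by blast
    \<comment> \<open>An infinite union of closed sets; local finiteness of \<open>P\<close> makes
      it closed.\<close>
    moreover have "closedin X (\<Union>i\<in>E - F. W i n)"
    proof (rule closedin_UN_locally_finite[where P = P])
      fix x assume "x \<in> topspace X"
      then obtain N where N: "openin X N" "x \<in> N" "finite {i \<in> E. N \<inter> P i \<noteq> {}}" using lf by blast
      have "finite {i \<in> E - F. N \<inter> P i \<noteq> {}}" by (rule finite_subset[OF _ N(3)]) blast
      then show "\<exists>N. openin X N \<and> x \<in> N \<and> finite {i \<in> E - F. N \<inter> P i \<noteq> {}}" using N by blast
    qed (use W in auto)
    ultimately show ?thesis unfolding h_def by (rule clopen_ind_in_Cf)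
  qed
  have h_in: "h n F x = (if i \<in> F then 0 else 1)" if "i \<in> E" "x \<in> W i n" for n F i x
  proof -
    have xX: "x \<in> topspace X" using that W(1) openin_subset by blast
    have "x \<in> (\<Union>i\<in>E - F. W i n) \<longleftrightarrow> i \<notin> F"
      using that disj W(4) by blast
    then show ?thesis unfolding h_def clopen_ind_def using xX by simp
  qed
  have h_out: "h n F x = 0" if "x \<in> topspace X" "\<And>i. i \<in> E \<Longrightarrow> x \<notin> W i n" for n F x
    unfolding h_def clopen_ind_def using that by simp
  \<comment> \<open>In terms of \<open>\<nat>\<^sup>E\<close>: the points that take the value \<open>n\<close> except for at most \<open>n\<close> zeros.\<close>
  define T where "T \<equiv> \<lambda>n::nat. {h n F | F. F \<subseteq> E \<and> finite F \<and> card F \<le> n}"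
  have clT: "closedin (Ck2_topology X) (T n)" for n
  proof (rule closedin_Ck2I)
    show "T n \<subseteq> Cf X" unfolding T_def using hC by blast
    fix f assume f: "f \<in> Cf X" and approx: "\<And>S. \<lbrakk>finite S; S \<subseteq> topspace X\<rbrakk> \<Longrightarrow> \<exists>g\<in>T n. \<forall>x\<in>S. g x = f x"
    have ap: "\<exists>F. F \<subseteq> E \<and> finite F \<and> card F \<le> n \<and> (\<forall>x\<in>S. h n F x = f x)" if "finite S" "S \<subseteq> topspace X" for S
      using approx[OF that] unfolding T_def by blast
    \<comment> \<open>The zeros of the limit function in \<open>E\<close>. Any finite set of them
      lies in the exceptional set of an approximating member of \<open>T n\<close>, so there are at
      most \<open>n\<close>.\<close>
    define F where "F = {i \<in> E. f i = 0}"
    have no: "card B \<le> n" if B: "finite B" "B \<subseteq> F" for B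
    proof -
      have "B \<subseteq> topspace X" using B EX unfolding F_def by blast
      then obtain F' where F': "finite F'" "card F' \<le> n" "\<forall>x\<in>B. h n F' x = f x"
        using ap B(1) by blast
      have "B \<subseteq> F'"
      proof
        fix i assume "i \<in> B"
        then have "i \<in> E" "h n F' i = 0" using F'(3) B(2) unfolding F_def by auto
        then show "i \<in> F'" using h_in[of i i n F'] W(3) by (auto split: if_splits)
      qed
      then show ?thesis using F' card_mono by (metis order_trans)
    qed
    have fin: "finite F"
    proof (rule ccontr)
      assume "infinite F"
      then obtain B where "finite B" "card B = Suc n" "B \<subseteq> F" using infinite_arbitrarily_large by blast
      then show False using no[of B] by simp
    qed
    have "f = h n F"
    proof (rule Cf_eqI[OF f hC])
      fix x assume x: "x \<in> topspace X"
      show "f x = h n F x"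
      proof (cases "\<exists>i\<in>E. x \<in> W i n")
        case True
        then obtain i where i: "i \<in> E" "x \<in> W i n" by blast
        have "{x, i} \<subseteq> topspace X" using x i EX by blast
        then obtain F' where F': "\<forall>x\<in>{x, i}. h n F' x = f x" using ap[of "{x, i}"] by blast
        have "f x = f i" using F' h_in[OF i, of F'] h_in[OF i(1) W(3)[OF i(1)], of n F'] by simp
        also have "f i = (if i \<in> F then 0 else 1)"
          using Cf_values[OF f, of i] i EX unfolding F_def by auto
        finally show ?thesis using h_in[OF i, of F] by simp
      next
        case False
        then have out: "x \<notin> W i n" if "i \<in> E" for i using that by blast
        obtain F' where "\<forall>x\<in>{x}. h n F' x = f x" using ap[of "{x}"] x by blast
        then show ?thesis using h_out[OF x out] by simp
      qed
    qed
    moreover have "F \<subseteq> E" unfolding F_def by blast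
    ultimately show "f \<in> T n" unfolding T_def using fin no[OF fin order_refl] by blast
  qed
  have "closedin (Ck2_topology X) (\<Union>n. T n)"
  proof (rule k_space_closedinI[OF k])
    show "(\<Union>n. T n) \<subseteq> topspace (Ck2_topology X)" unfolding T_def using hC by auto
    fix C assume C: "compactin (Ck2_topology X) C"
    \<comment> \<open>Members of \<open>C\<close> take equal values at \<open>i\<close> and at a
      nearby \<open>p\<close>, while \<open>W i k\<close> misses \<open>p\<close> from the index
      \<open>j\<close> on. So \<open>h k F\<close> with \<open>k \<ge> j\<close> and
      \<open>i\<close> outside \<open>F\<close> cannot belong to \<open>C\<close>.\<close>
    have "\<exists>j p. p \<in> P i \<and> (\<forall>g\<in>C. g p = g i) \<and> (\<forall>k\<ge>j. p \<notin> W i k)" if i: "i \<in> E" for i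
    proof -
      have iX: "i \<in> topspace X" using i EX by blast
      obtain N where N: "openin X N" "i \<in> N" "\<And>g x. \<lbrakk>g \<in> C; x \<in> N\<rbrakk> \<Longrightarrow> g x = g i"
        using compactin_Ck2_equicontinuous[OF X(1) C iX] by metis
      obtain p where p: "p \<in> N \<inter> P i" "p \<noteq> i" "p \<in> topspace X"
        using nonisolated_obtains[of i X "N \<inter> P i"] E(1) i N P by blast
      obtain j where j: "\<forall>k\<ge>j. p \<notin> W i k"
        using shrinking_neighbourhoods_miss[OF H iX p(3,2) W(5)[OF i]] by blast
      then show ?thesis using p N by blast
    qed
    then obtain j p where jp: "\<And>i. i \<in> E \<Longrightarrow> p i \<in> P i \<and> (\<forall>g\<in>C. g (p i) = g i) \<and> (\<forall>k\<ge>j i. p i \<notin> W i k)"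
      by metis
    \<comment> \<open>Uncountability enters here: the thresholds \<open>j i\<close> are natural
      numbers, so one value \<open>m\<close> is taken infinitely often. For \<open>n \<ge> m\<close>
      a finite exceptional set \<open>F\<close> misses some \<open>i\<close> with
      \<open>j i = m\<close>.\<close>
    have "\<exists>m. infinite {i \<in> E. j i = m}"
    proof (rule ccontr)
      assume "\<nexists>m. infinite {i \<in> E. j i = m}"
      then have "countable (\<Union>m. {i \<in> E. j i = m})" by (intro countable_UN) (auto intro: countable_finite)
      moreover have "(\<Union>m. {i \<in> E. j i = m}) = E" by blast
      ultimately show False using E(2) by simp
    qed
    then obtain m where m: "infinite {i \<in> E. j i = m}" by blast
    have less: "n < m" if g: "g \<in> C" "g \<in> T n" for g n
    proof (rule ccontr)
      assume n: "\<not> n < m"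
      obtain F where F: "g = h n F" "finite F" using g(2) unfolding T_def by blast
      have "\<not> {i \<in> E. j i = m} \<subseteq> F" using m F(2) finite_subset by metis
      then obtain i where i: "i \<in> E" "j i = m" "i \<notin> F" by blast
      have pi: "p i \<in> P i" "g (p i) = g i" "p i \<notin> W i n"
        using jp[OF i(1)] g(1) n i(2) by auto
      have "p i \<notin> W i' n" if "i' \<in> E" for i'
        using that pi disj[OF i(1) that pi(1)] W(4)[OF that] by blast
      moreover have "p i \<in> topspace X" using pi(1) P(1)[OF i(1)] openin_subset by blast
      ultimately have "g (p i) = 0" unfolding F(1) using h_out by blast
      moreover have "g i = 1" unfolding F(1) using h_in[OF i(1) W(3)[OF i(1)]] i(3) by simp
      ultimately show False using pi(2) by simp
    qed
    have "C \<inter> (\<Union>n. T n) = C \<inter> (\<Union>n\<in>{..<m}. T n)" using less by blast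
    moreover have "closedin (Ck2_topology X) (\<Union>n\<in>{..<m}. T n)" using clT by (intro closedin_Union) auto
    ultimately show "\<exists>B. closedin (Ck2_topology X) B \<and> C \<inter> (\<Union>n. T n) = C \<inter> B" by blast
  qed
  then have "(\<lambda>x\<in>topspace X. 0) \<in> (\<Union>n. T n)"
  proof (rule zero_in_closed_of_Ck2)
    fix K assume K: "compactin X K"
    \<comment> \<open>\<open>F\<close> collects the indices whose sets \<open>P i\<close> meet
      \<open>K\<close>. Taking \<open>card F\<close> as the level puts \<open>h (card F) F\<close>
      into the union, and it vanishes on \<open>K\<close>.\<close>
    define F where "F = {i \<in> E. K \<inter> P i \<noteq> {}}"
    have F: "finite F" "F \<subseteq> E"
      unfolding F_def using finite_compactin_Int_of_locally_finite[of X E P, OF lf K] by auto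
    have "h (card F) F x = 0" if x: "x \<in> K" for x
    proof -
      have "x \<notin> (\<Union>i\<in>E - F. W i (card F))" using x W(4) unfolding F_def by blast
      then show ?thesis
        unfolding h_def using x compactin_subset_topspace[OF K] by (intro clopen_ind_simps) auto
    qed
    moreover have "h (card F) F \<in> (\<Union>n. T n)" unfolding T_def using F by blast
    ultimately show "\<exists>g\<in>(\<Union>n. T n). \<forall>x\<in>K. g x = 0" by blast
  qed
  then obtain n F where F: "(\<lambda>x\<in>topspace X. 0) = h n F" "finite F" unfolding T_def by blast
  have "\<not> E \<subseteq> F" using infE F(2) finite_subset by metis
  then obtain i where i: "i \<in> E" "i \<notin> F" by blast
  have "h n F i = 1" using h_in[OF i(1) W(3)[OF i(1)]] i(2) by simp
  moreover have "h n F i = 0" unfolding F(1)[symmetric] using EX i(1) by auto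
  ultimately show False by simp
qed

section \<open>The topological group of continuous functions\<close>

lemma carrier_Ck2 [simp]: "carrier (Ck2 X) = Cf X"
  and mult_Ck2 [simp]: "f \<otimes>\<^bsub>Ck2 X\<^esub> g = (\<lambda>x\<in>topspace X. (f x + g x) mod 2)"
  and one_Ck2 [simp]: "\<one>\<^bsub>Ck2 X\<^esub> = (\<lambda>x\<in>topspace X. 0)"
  by (simp_all add: Ck2_def)

lemma Cf_add:
  assumes f: "f \<in> Cf X" and g: "g \<in> Cf X"
  shows "(\<lambda>x\<in>topspace X. (f x + g x) mod 2) \<in> Cf X"
proof -
  let ?h = "\<lambda>x\<in>topspace X. (f x + g x) mod 2"
  have val: "?h x = (if f x = g x then 0 else 1)" if "x \<in> topspace X" for x
    using Cf_values[OF f that] Cf_values[OF g that] that by auto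
  have "{x \<in> topspace X. ?h x = 0} = {x \<in> topspace X. f x = g x}"
    using val by auto
  moreover have "{x \<in> topspace X. ?h x = 1} = \<Union>((\<lambda>c. {x \<in> topspace X. f x = c} \<inter> {x \<in> topspace X. g x = 1 - c}) ` {0, 1})"
  proof -
    have "?h x = 1 \<longleftrightarrow> (\<exists>c\<in>{0, 1}. f x = c \<and> g x = 1 - c)" if "x \<in> topspace X" for x
      using val[OF that] Cf_values[OF f that] Cf_values[OF g that] by (elim disjE) simp_all
    then show ?thesis by blast
  qed
  moreover have "openin X (\<Union>((\<lambda>c. {x \<in> topspace X. f x = c} \<inter> {x \<in> topspace X. g x = 1 - c}) ` {0, 1}))"
    using f g by (intro openin_Union) (auto intro!: openin_Int openin_Cf_level)
  ultimately show ?thesis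
    unfolding mem_Cf_iff using openin_Cf_eq[OF f g] val by simp
qed

lemma comm_group_Ck2: "comm_group (Ck2 X)"
proof (rule comm_groupI)
  fix f g h assume f: "f \<in> carrier (Ck2 X)"
  show "\<one>\<^bsub>Ck2 X\<^esub> \<otimes>\<^bsub>Ck2 X\<^esub> f = f"
  proof (rule Cf_eqI[of _ X])
    show "\<one>\<^bsub>Ck2 X\<^esub> \<otimes>\<^bsub>Ck2 X\<^esub> f \<in> Cf X" "f \<in> Cf X"
      using f Cf_add[OF zero_in_Cf, of f X] by simp_all
    fix x assume "x \<in> topspace X"
    then show "(\<one>\<^bsub>Ck2 X\<^esub> \<otimes>\<^bsub>Ck2 X\<^esub> f) x = f x"
      using f Cf_values[of f X x] by auto
  qed
  show "\<exists>g\<in>carrier (Ck2 X). g \<otimes>\<^bsub>Ck2 X\<^esub> f = \<one>\<^bsub>Ck2 X\<^esub>"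
    using f by (intro bexI[of _ f]) (auto intro: restrict_ext)
  show "f \<otimes>\<^bsub>Ck2 X\<^esub> g = g \<otimes>\<^bsub>Ck2 X\<^esub> f"
    by (simp add: add.commute)
  show "f \<otimes>\<^bsub>Ck2 X\<^esub> g \<otimes>\<^bsub>Ck2 X\<^esub> h = f \<otimes>\<^bsub>Ck2 X\<^esub> (g \<otimes>\<^bsub>Ck2 X\<^esub> h)"
    unfolding mult_Ck2 by (rule restrict_ext) (simp add: mod_simps add.assoc)
qed (auto intro: Cf_add zero_in_Cf)

lemma group_Ck2: "group (Ck2 X)"
  using comm_group_Ck2 by (rule comm_group.axioms(2))

lemma inv_Ck2:
  assumes "f \<in> Cf X"
  shows "inv\<^bsub>Ck2 X\<^esub> f = f"
  using assms by (intro group.inv_equality[OF group_Ck2]) (auto intro: restrict_ext)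

lemma topological_group_Ck2: "topological_group (Ck2 X) (Ck2_topology X)"
  unfolding topological_group_def
proof (intro conjI)
  show "group (Ck2 X)" by (rule group_Ck2)
  show "topspace (Ck2_topology X) = carrier (Ck2 X)" by simp
  show "continuous_map (prod_topology (Ck2_topology X) (Ck2_topology X)) (Ck2_topology X) (\<lambda>(x, y). x \<otimes>\<^bsub>Ck2 X\<^esub> y)"
  proof (rule continuous_map_into_Ck2)
    fix p K assume p: "p \<in> topspace (prod_topology (Ck2_topology X) (Ck2_topology X))" and K: "compactin X K"
    let ?N = "{a \<in> Cf X. \<forall>x\<in>K. a x = fst p x} \<times> {b \<in> Cf X. \<forall>x\<in>K. b x = snd p x}"
    have "openin (prod_topology (Ck2_topology X) (Ck2_topology X)) ?N"
      using openin_Ck2_agree[OF K] by (simp add: openin_prod_Times_iff)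
    moreover have "p \<in> ?N" using p by auto
    moreover have "\<forall>z\<in>?N. \<forall>x\<in>K. (case z of (f, g) \<Rightarrow> f \<otimes>\<^bsub>Ck2 X\<^esub> g) x = (case p of (f, g) \<Rightarrow> f \<otimes>\<^bsub>Ck2 X\<^esub> g) x"
      using compactin_subset_topspace[OF K] by (auto simp: case_prod_beta)
    ultimately show "\<exists>N. openin (prod_topology (Ck2_topology X) (Ck2_topology X)) N \<and> p \<in> N \<and>
        (\<forall>z\<in>N. \<forall>x\<in>K. (case z of (f, g) \<Rightarrow> f \<otimes>\<^bsub>Ck2 X\<^esub> g) x = (case p of (f, g) \<Rightarrow> f \<otimes>\<^bsub>Ck2 X\<^esub> g) x)"
      by blast
  qed (auto intro: Cf_add)
  show "continuous_map (Ck2_topology X) (Ck2_topology X) (\<lambda>x. inv\<^bsub>Ck2 X\<^esub> x)"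
    by (rule continuous_map_eq[OF continuous_map_id]) (simp add: inv_Ck2)
qed

section \<open>Restriction, gluing and clopen partitions\<close>

lemma Cf_restrict:
  assumes "f \<in> Cf X" "S \<subseteq> topspace X"
  shows "restrict f S \<in> Cf (subtopology X S)"
proof -
  have "topspace (subtopology X S) = S" using assms(2) by auto
  moreover have "continuous_map (subtopology X S) Z2_topology (restrict f S)"
    using assms(1) continuous_map_eq[OF continuous_map_from_subtopology, of X Z2_topology f S "restrict f S"]
    unfolding continuous_functions_def by auto
  ultimately show ?thesis unfolding continuous_functions_def by auto
qed

lemma Cf_glue:
  assumes L: "openin X L" "openin X R" "L \<inter> R = {}" "L \<union> R = topspace X"
    and a: "a \<in> Cf (subtopology X L)" and b: "b \<in> Cf (subtopology X R)"
  shows "(\<lambda>x\<in>topspace X. if x \<in> L then a x else b x) \<in> Cf X"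
proof -
  let ?g = "\<lambda>x\<in>topspace X. if x \<in> L then a x else b x"
  have LR: "L \<subseteq> topspace X" "R \<subseteq> topspace X" using L by blast+
  have "openin X {x \<in> topspace X. ?g x = c}" for c
  proof -
    have "{x \<in> topspace X. ?g x = c} = {x \<in> L. a x = c} \<union> {x \<in> R. b x = c}"
      using L by auto
    moreover have "openin X {x \<in> L. a x = c}" "openin X {x \<in> R. b x = c}"
      using openin_Cf_level[OF a, of c] openin_Cf_level[OF b, of c] LR L
      by (simp_all add: Int_absorb1 openin_open_subtopology)
    ultimately show ?thesis by auto
  qed
  moreover have "a x \<in> {0, 1}" if "x \<in> L" for x using Cf_values[OF a, of x] that LR by auto
  moreover have "b x \<in> {0, 1}" if "x \<in> R" for x using Cf_values[OF b, of x] that LR by auto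
  ultimately show ?thesis unfolding mem_Cf_iff using L(4) by auto
qed

lemma continuous_map_restrict_Ck2:
  assumes "S \<subseteq> topspace X"
  shows "continuous_map (Ck2_topology X) (Ck2_topology (subtopology X S)) (\<lambda>f. restrict f S)"
proof (rule continuous_map_into_Ck2)
  fix f K assume f: "f \<in> topspace (Ck2_topology X)" and "compactin (subtopology X S) K"
  then have K: "compactin X K" "K \<subseteq> S" by (auto simp: compactin_subtopology)
  show "\<exists>N. openin (Ck2_topology X) N \<and> f \<in> N \<and> (\<forall>z\<in>N. \<forall>x\<in>K. restrict z S x = restrict f S x)"
    using f K(2) by (intro exI[of _ "{g \<in> Cf X. \<forall>x\<in>K. g x = f x}"] conjI openin_Ck2_agree[OF K(1)]) auto
qed (use assms in \<open>auto intro: Cf_restrict\<close>)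

text \<open>Restriction and gluing are mutually inverse. Gluing is continuous because both pieces
  are clopen, so a compact set splits into a compact part in each.\<close>

lemma Ck2_clopen_decomposition:
  assumes L: "openin X L" "openin X R" "L \<inter> R = {}" "L \<union> R = topspace X"
  shows "topologically_isomorphic (Ck2 X) (Ck2_topology X)
    (Ck2 (subtopology X L) \<times>\<times> Ck2 (subtopology X R))
    (prod_topology (Ck2_topology (subtopology X L)) (Ck2_topology (subtopology X R)))"
proof -
  let ?P = "prod_topology (Ck2_topology (subtopology X L)) (Ck2_topology (subtopology X R))"
  define h where "h \<equiv> \<lambda>f::'a \<Rightarrow> int. (restrict f L, restrict f R)"
  define k where "k \<equiv> \<lambda>p::('a \<Rightarrow> int) \<times> ('a \<Rightarrow> int). \<lambda>x\<in>topspace X. if x \<in> L then fst p x else snd p x"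
  have LR: "L \<subseteq> topspace X" "R \<subseteq> topspace X" using L by blast+
  then have [simp]: "topspace X \<inter> L = L" "topspace X \<inter> R = R" by blast+
  have hc: "continuous_map (Ck2_topology X) ?P h"
    unfolding h_def using LR by (intro continuous_map_pairedI continuous_map_restrict_Ck2)
  have kc: "continuous_map ?P (Ck2_topology X) k"
  proof (rule continuous_map_into_Ck2)
    fix p K assume p: "p \<in> topspace ?P" and K: "compactin X K"
    have KL: "compactin (subtopology X L) (K \<inter> L)" "compactin (subtopology X R) (K \<inter> R)"
    proof -
      have "closedin X L" "closedin X R"
        using L LR by (auto simp: closedin_def Diff_Un Int_absorb1 intro: back_subst[of "openin X"])
      then show "compactin (subtopology X L) (K \<inter> L)" "compactin (subtopology X R) (K \<inter> R)"
        using K by (auto simp: compactin_subtopology intro: compact_Int_closedin)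
    qed
    let ?N = "{a \<in> Cf (subtopology X L). \<forall>x\<in>K \<inter> L. a x = fst p x} \<times> {b \<in> Cf (subtopology X R). \<forall>x\<in>K \<inter> R. b x = snd p x}"
    have "openin ?P ?N"
      using openin_Ck2_agree[OF KL(1)] openin_Ck2_agree[OF KL(2)] by (simp add: openin_prod_Times_iff)
    moreover have "p \<in> ?N" using p by auto
    moreover have "\<forall>z\<in>?N. \<forall>x\<in>K. k z x = k p x"
      using compactin_subset_topspace[OF K] L(4) unfolding k_def by auto
    ultimately show "\<exists>N. openin ?P N \<and> p \<in> N \<and> (\<forall>z\<in>N. \<forall>x\<in>K. k z x = k p x)" by blast
  next
    fix p assume "p \<in> topspace ?P"
    then show "k p \<in> Cf X" unfolding k_def using L by (auto intro: Cf_glue)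
  qed
  have kh: "k (h f) = f" if "f \<in> Cf X" for f
    unfolding k_def h_def using L(4)
    by (intro extensionalityI[OF restrict_extensional Cf_extensional[OF that]]) auto
  have hk: "h (k p) = p" if "p \<in> topspace ?P" for p
  proof -
    obtain a b where p: "p = (a, b)" "a \<in> Cf (subtopology X L)" "b \<in> Cf (subtopology X R)"
      using \<open>p \<in> topspace ?P\<close> by auto
    have "restrict (k p) L = a"
      using Cf_extensional[OF p(2)] LR by (intro extensionalityI[OF restrict_extensional]) (auto simp: k_def p(1))
    moreover have "restrict (k p) R = b"
      using Cf_extensional[OF p(3)] LR L(3) by (intro extensionalityI[OF restrict_extensional]) (auto simp: k_def p(1))
    ultimately show ?thesis unfolding h_def p(1) by simp
  qed
  have hom: "homeomorphic_maps (Ck2_topology X) ?P h k"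
    unfolding homeomorphic_maps_def using hc kc kh hk by simp
  then have hm: "homeomorphic_map (Ck2_topology X) ?P h"
    using homeomorphic_map_maps by blast
  have "bij_betw h (Cf X) (Cf (subtopology X L) \<times> Cf (subtopology X R))"
    using homeomorphic_imp_surjective_map[OF hm] homeomorphic_imp_injective_map[OF hm] by (simp add: bij_betw_def)
  moreover have "h f \<in> Cf (subtopology X L) \<times> Cf (subtopology X R)" if "f \<in> Cf X" for f
    using that LR unfolding h_def by (auto intro: Cf_restrict)
  moreover have "h (f \<otimes>\<^bsub>Ck2 X\<^esub> g) = h f \<otimes>\<^bsub>Ck2 (subtopology X L) \<times>\<times> Ck2 (subtopology X R)\<^esub> h g" for f g
    unfolding h_def using LR by (auto intro!: restrict_ext simp: restrict_restrict Int_absorb1)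
  ultimately have "h \<in> iso (Ck2 X) (Ck2 (subtopology X L) \<times>\<times> Ck2 (subtopology X R))"
    unfolding iso_def hom_def by auto
  then show ?thesis unfolding topologically_isomorphic_def using hm by blast
qed

section \<open>Discrete spaces\<close>

lemma Cf_discrete_topology: "Cf (discrete_topology R) = (\<Pi>\<^sub>E i\<in>R. carrier Z2)"
  unfolding continuous_functions_def by (auto simp: PiE_def)

lemma compact_space_Z2_power_topology: "compact_space (Z2_power_topology R)"
  by (auto simp: Z2_power_topology_def compact_space_product_topology compact_space_discrete_topology carrier_Z2)

text \<open>Compact subsets of a discrete space are finite, so the identity is continuous from the
  product topology. It is a bijection from a compact to a Hausdorff space, which gives the other
  direction.\<close>

lemma Ck2_topology_discrete: "Ck2_topology (discrete_topology R) = Z2_power_topology R"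
proof -
  let ?Y = "product_topology (\<lambda>_. Z2_topology) R"
  have "continuous_map ?Y (Ck2_topology (discrete_topology R)) id"
  proof (rule continuous_map_into_Ck2)
    fix f assume "f \<in> topspace ?Y"
    then show "id f \<in> Cf (discrete_topology R)" by (simp add: Cf_discrete_topology)
  next
    fix f K assume f: "f \<in> topspace ?Y" and K: "compactin (discrete_topology R) K"
    have K': "finite K" "K \<subseteq> R" using K by (auto simp: compactin_discrete_topology)
    let ?N = "\<Pi>\<^sub>E i\<in>R. if i \<in> K then {f i} else carrier Z2"
    have "finite {i. i \<in> R \<and> (if i \<in> K then {f i} else carrier Z2) \<noteq> carrier Z2}"
      by (rule finite_subset[OF _ K'(1)]) auto
    then have "openin ?Y ?N"
      using f K'(2) unfolding openin_PiE_gen by (auto simp: PiE_iff)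
    moreover have "f \<in> ?N" using f by (auto simp: PiE_iff)
    moreover have "\<forall>z\<in>?N. \<forall>x\<in>K. id z x = id f x" using K'(2) by (fastforce simp: PiE_iff)
    ultimately show "\<exists>N. openin ?Y N \<and> f \<in> N \<and> (\<forall>z\<in>N. \<forall>x\<in>K. id z x = id f x)" by blast
  qed
  then have "homeomorphic_map ?Y (Ck2_topology (discrete_topology R)) id"
    using compact_space_Z2_power_topology[of R] Hausdorff_Ck2_topology
    by (intro continuous_imp_homeomorphic_map) (auto simp: Cf_discrete_topology Z2_power_topology_def)
  then show ?thesis unfolding Z2_power_topology_def by simp
qed

lemma compact_abelian_group_Ck2_discrete:
  "compact_abelian_group (Ck2 (discrete_topology R)) (Ck2_topology (discrete_topology R))"
  unfolding compact_abelian_group_def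
  using topological_group_Ck2 comm_group_Ck2 Hausdorff_Ck2_topology compact_space_Z2_power_topology
  by (metis Ck2_topology_discrete)

section \<open>Polish function groups\<close>

lemma compactin_obtains_subcover:
  assumes "compactin X S" "\<forall>U\<in>\<U>. openin X U" "S \<subseteq> \<Union>\<U>"
  obtains \<F> where "finite \<F>" "\<F> \<subseteq> \<U>" "S \<subseteq> \<Union>\<F>"
  using assms unfolding compactin_def by auto

lemma second_countable_if_countable_compact_cover:
  assumes "metrizable_space Y" "countable \<C>" "\<And>C. C \<in> \<C> \<Longrightarrow> compactin Y C" "\<Union>\<C> = topspace Y"
  shows "second_countable Y"
proof -
  have "Lindelof_space (subtopology Y (\<Union>\<C>))"
    using assms(2,3) by (intro Lindelof_space_Union compact_imp_Lindelof_space) (auto simp: compactin_subspace)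
  then show ?thesis
    using assms(1,4) metrizable_Lindelof_imp_second_countable by simp
qed

text \<open>The functions whose set of ones is compact form a countable dense set. Countable: a
  compact open set is a finite union of members of a countable base. Dense: replacing
  \<open>f\<close> by 0 off a compact clopen set containing \<open>K\<close> does not change it on
  \<open>K\<close>.\<close>

lemma separable_space_Ck2:
  assumes sc: "second_countable Y"
    and cov: "\<And>K. compactin Y K \<Longrightarrow> \<exists>C. openin Y C \<and> closedin Y C \<and> compactin Y C \<and> K \<subseteq> C"
  shows "separable_space (Ck2_topology Y)"
proof -
  obtain \<B> where \<B>: "countable \<B>" "\<And>V. V \<in> \<B> \<Longrightarrow> openin Y V"
    "\<And>U x. \<lbrakk>openin Y U; x \<in> U\<rbrakk> \<Longrightarrow> \<exists>V\<in>\<B>. x \<in> V \<and> V \<subseteq> U"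
    using sc unfolding second_countable_def by metis
  define Q where "Q = {f \<in> Cf Y. compactin Y {x \<in> topspace Y. f x = 1}}"
  have inj: "inj_on (\<lambda>f. {x \<in> topspace Y. f x = 1}) Q"
  proof (rule inj_onI)
    fix f g assume fg: "f \<in> Q" "g \<in> Q" "{x \<in> topspace Y. f x = 1} = {x \<in> topspace Y. g x = 1}"
    then have "f x = 1 \<longleftrightarrow> g x = 1" if "x \<in> topspace Y" for x using that by blast
    then show "f = g"
      using fg Cf_values[of f Y] Cf_values[of g Y] unfolding Q_def by (intro Cf_eqI[of f Y]) fastforce+
  qed
  have img: "(\<lambda>f. {x \<in> topspace Y. f x = 1}) ` Q \<subseteq> Union ` {\<F>. finite \<F> \<and> \<F> \<subseteq> \<B>}"
  proof (clarify)
    fix f assume f: "f \<in> Q"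
    let ?S = "{x \<in> topspace Y. f x = 1}"
    have S: "openin Y ?S" "compactin Y ?S"
      using f openin_Cf_level unfolding Q_def by auto
    have op: "\<forall>U\<in>{V \<in> \<B>. V \<subseteq> ?S}. openin Y U" using \<B>(2) by blast
    have cv: "?S \<subseteq> \<Union>{V \<in> \<B>. V \<subseteq> ?S}" using \<B>(3)[OF S(1)] by blast
    obtain \<F> where "finite \<F>" "\<F> \<subseteq> {V \<in> \<B>. V \<subseteq> ?S}" "?S \<subseteq> \<Union>\<F>"
      by (rule compactin_obtains_subcover[OF S(2) op cv])
    then show "?S \<in> Union ` {\<F>. finite \<F> \<and> \<F> \<subseteq> \<B>}"
      by (intro image_eqI[of _ _ \<F>]) blast+
  qed
  have cnt: "countable (Union ` {\<F>. finite \<F> \<and> \<F> \<subseteq> \<B>})"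
    using countable_Collect_finite_subset[OF \<B>(1)] by blast
  have "countable Q"
    by (rule countable_image_inj_on[OF countable_subset[OF img cnt] inj])
  moreover have "Q \<subseteq> topspace (Ck2_topology Y)" unfolding Q_def by auto
  moreover have "topspace (Ck2_topology Y) \<subseteq> (Ck2_topology Y) closure_of Q"
  proof (clarsimp simp: in_closure_of)
    fix f T assume f: "f \<in> Cf Y" and T: "f \<in> T" "openin (Ck2_topology Y) T"
    obtain K where K: "compactin Y K" "{g \<in> Cf Y. \<forall>x\<in>K. g x = f x} \<subseteq> T"
      using T unfolding openin_Ck2_topology by blast
    obtain C where C: "openin Y C" "closedin Y C" "compactin Y C" "K \<subseteq> C"
      using cov[OF K(1)] by blast
    define g where "g = (\<lambda>x\<in>topspace Y. if x \<in> C then f x else (\<lambda>x\<in>topspace Y. 0) x)"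
    have g: "g \<in> Cf Y" unfolding g_def by (rule Cf_if[OF f zero_in_Cf C(1,2)])
    have CY: "C \<subseteq> topspace Y" using C(1) openin_subset by blast
    have "{x \<in> topspace Y. g x = 1} = {x \<in> C. f x = 1}"
      using CY by (auto simp: g_def split: if_splits)
    then have "g \<in> Q" using g compactin_Cf_level[OF f C(3), of 1] unfolding Q_def by simp
    moreover have "\<forall>x\<in>K. g x = f x" using C(4) CY unfolding g_def by auto
    then have "g \<in> T" using g K(2) by blast
    ultimately show "\<exists>y. y \<in> Q \<and> y \<in> T" by blast
  qed
  ultimately show ?thesis
    unfolding separable_space_def using closure_of_subset_topspace[of "Ck2_topology Y" Q] by blast
qed

text \<open>Subtract from each compact open set the earlier ones. Compact sets are closed in a
  Hausdorff space, so the differences stay clopen and compact; they partition \<open>Y\<close>, and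
  a compact set is covered by finitely many of them.\<close>

lemma obtains_disjoint_compact_cover:
  assumes "Hausdorff_space Y" "countable \<C>" "\<And>C. C \<in> \<C> \<Longrightarrow> openin Y C \<and> compactin Y C" "\<Union>\<C> = topspace Y"
  obtains D :: "nat \<Rightarrow> 'a set" where "disjoint_family D" "\<And>n. openin Y (D n)" "\<And>n. closedin Y (D n)"
    "\<And>n. compactin Y (D n)" "(\<Union>n. D n) = topspace Y"
    "\<And>K. compactin Y K \<Longrightarrow> \<exists>n. K \<subseteq> (\<Union>i<n. D i)"
proof -
  \<comment> \<open>Inserting the empty set makes the enumerated family nonempty even when the cover
    is empty.\<close>
  define C where "C = from_nat_into (insert {} \<C>)"
  have rC: "range C = insert {} \<C>" unfolding C_def using assms(2) by (intro range_from_nat_into) auto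
  have C: "openin Y (C n)" "compactin Y (C n)" for n
    using rC assms(3) by (metis insert_iff openin_empty rangeI, metis compactin_empty insert_iff rangeI)
  have clC: "closedin Y (C n)" for n using C compactin_imp_closedin assms(1) by blast
  define D where "D = disjointed C"
  have un: "(\<Union>n. D n) = topspace Y" unfolding D_def UN_disjointed_eq using rC assms(4) by auto
  have clU: "closedin Y (\<Union>i\<in>{0..<n}. C i)" for n using clC by (intro closedin_Union) auto
  have op: "openin Y (D n)" and cl: "closedin Y (D n)" for n
  proof -
    show "openin Y (D n)" unfolding D_def disjointed_def using C clU by blast
    have "openin Y (\<Union>i\<in>{0..<n}. C i)" using C by blast
    then show "closedin Y (D n)" unfolding D_def disjointed_def using clC by blast
  qed
  have cp: "compactin Y (D n)" for n
    using closed_compactin[OF C(2)[of n] _ cl] disjointed_subset[of C n] unfolding D_def by blast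
  have "\<exists>n. K \<subseteq> (\<Union>i<n. D i)" if K: "compactin Y K" for K
  proof -
    have 1: "\<forall>U\<in>range D. openin Y U" using op by blast
    have 2: "K \<subseteq> \<Union>(range D)" using un compactin_subset_topspace[OF K] by simp
    obtain \<F> where \<F>: "finite \<F>" "\<F> \<subseteq> range D" "K \<subseteq> \<Union>\<F>" by (rule compactin_obtains_subcover[OF K 1 2])
    then obtain I where I: "finite I" "\<F> = D ` I" by (meson finite_subset_image)
    obtain n where "I \<subseteq> {..<n}" using finite_nat_iff_bounded[of I] I(1) by blast
    then have "\<Union>(D ` I) \<subseteq> (\<Union>i<n. D i)" by blast
    then show ?thesis using \<F>(3) unfolding I(2) by (meson order_trans)
  qed
  then show ?thesis
    using op cl cp un disjoint_family_disjointed[of C, folded D_def] by (intro that[of D])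
qed

text \<open>Restriction to the pieces identifies \<open>C_k(Y,2)\<close> with a countable product of
  discrete spaces. Each coordinate map is locally constant because \<open>D n\<close> is compact,
  and gluing is continuous because a compact set meets only finitely many pieces. Such a product is
  completely metrizable.\<close>

lemma completely_metrizable_Ck2:
  fixes D :: "nat \<Rightarrow> 'a set"
  assumes D: "disjoint_family D" "\<And>n. openin Y (D n)" "\<And>n. compactin Y (D n)" "(\<Union>n. D n) = topspace Y"
    "\<And>K. compactin Y K \<Longrightarrow> \<exists>n. K \<subseteq> (\<Union>i<n. D i)"
  shows "completely_metrizable_space (Ck2_topology Y)"
proof -
  let ?P = "product_topology (\<lambda>n. discrete_topology (Cf (subtopology Y (D n)))) (UNIV :: nat set)"
  define F where "F \<equiv> \<lambda>f::'a \<Rightarrow> int. \<lambda>n. restrict f (D n)"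
  define ix where "ix \<equiv> \<lambda>x. THE n. x \<in> D n"
  define G where "G \<equiv> \<lambda>u::nat \<Rightarrow> 'a \<Rightarrow> int. \<lambda>x\<in>topspace Y. u (ix x) x"
  have ix: "ix x = n" if "x \<in> D n" for x n
    unfolding ix_def using that D(1) by (intro the_equality) (auto simp: disjoint_family_on_def)
  have DY: "D n \<subseteq> topspace Y" for n using D(4) by blast
  have TD: "topspace (subtopology Y (D n)) = D n" for n using DY by auto
  have "continuous_map (Ck2_topology Y) ?P F"
    unfolding continuous_map_componentwise_UNIV
  proof
    fix n
    show "continuous_map (Ck2_topology Y) (discrete_topology (Cf (subtopology Y (D n)))) (\<lambda>f. F f n)"
      unfolding continuous_map_def
    proof (intro conjI allI impI)
      show "(\<lambda>f. F f n) \<in> topspace (Ck2_topology Y) \<rightarrow> topspace (discrete_topology (Cf (subtopology Y (D n))))"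
        unfolding F_def using Cf_restrict[OF _ DY] by auto
      fix U
      show "openin (Ck2_topology Y) {f \<in> topspace (Ck2_topology Y). F f n \<in> U}"
        unfolding openin_Ck2_topology
      proof (intro conjI ballI)
        fix f assume f: "f \<in> {f \<in> topspace (Ck2_topology Y). F f n \<in> U}"
        have eq: "F g n = F f n" if "\<forall>x\<in>D n. g x = f x" for g
          unfolding F_def using that by (intro restrict_ext) simp
        show "\<exists>K. compactin Y K \<and> {g \<in> Cf Y. \<forall>x\<in>K. g x = f x} \<subseteq> {f \<in> topspace (Ck2_topology Y). F f n \<in> U}"
        proof (intro exI conjI subsetI)
          fix g assume "g \<in> {g \<in> Cf Y. \<forall>x\<in>D n. g x = f x}"
          then show "g \<in> {f \<in> topspace (Ck2_topology Y). F f n \<in> U}"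
            using f eq[of g] by simp
        qed (rule D(3))
      qed auto
    qed
  qed
  moreover have GC: "G u \<in> Cf Y" if u: "u \<in> topspace ?P" for u
  proof -
    have un: "u n \<in> Cf (subtopology Y (D n))" for n using u by auto
    have val: "G u x \<in> {0, 1}" if x: "x \<in> topspace Y" for x
    proof -
      obtain n where "x \<in> D n" using x D(4) by blast
      then show ?thesis using Cf_values[OF un[of n], of x] x ix TD unfolding G_def by auto
    qed
    have "openin Y {x \<in> topspace Y. G u x = c}" for c
    proof -
      have "{x \<in> topspace Y. G u x = c} = (\<Union>n. {x \<in> D n. u n x = c})"
      proof (intro equalityI subsetI)
        fix x assume x: "x \<in> {x \<in> topspace Y. G u x = c}"
        then obtain n where "x \<in> D n" using D(4) by blast
        then show "x \<in> (\<Union>n. {x \<in> D n. u n x = c})" using x ix unfolding G_def by auto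
      next
        fix x assume "x \<in> (\<Union>n. {x \<in> D n. u n x = c})"
        then obtain n where "x \<in> D n" "u n x = c" by blast
        then show "x \<in> {x \<in> topspace Y. G u x = c}" using ix DY unfolding G_def by auto
      qed
      moreover have "openin Y {x \<in> D n. u n x = c}" for n
        using openin_Cf_level[OF un[of n], of c] unfolding TD openin_open_subtopology[OF D(2)] by blast
      ultimately show ?thesis by auto
    qed
    then show ?thesis unfolding mem_Cf_iff using val unfolding G_def by auto
  qed
  moreover have "continuous_map ?P (Ck2_topology Y) G"
  proof (rule continuous_map_into_Ck2[OF GC])
    fix u K assume u: "u \<in> topspace ?P" and K: "compactin Y K"
    obtain n where n: "K \<subseteq> (\<Union>i<n. D i)" using D(5)[OF K] by blast
    let ?N = "\<Pi>\<^sub>E i\<in>UNIV. if i < n then {u i} else Cf (subtopology Y (D i))"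
    have "finite {i \<in> UNIV. (if i < n then {u i} else Cf (subtopology Y (D i))) \<noteq> Cf (subtopology Y (D i))}"
      by (rule finite_subset[of _ "{..<n}"]) auto
    then have "openin ?P ?N" using u unfolding openin_PiE_gen by auto
    moreover have "u \<in> ?N" using u by auto
    moreover have "G z x = G u x" if "z \<in> ?N" "x \<in> K" for z x
    proof -
      obtain i where i: "i < n" "x \<in> D i" using \<open>x \<in> K\<close> n by blast
      have "z i = u i" using \<open>z \<in> ?N\<close> i(1) by (auto simp: PiE_iff dest: spec[of _ i])
      then show ?thesis unfolding G_def using ix[OF i(2)] by simp
    qed
    ultimately show "\<exists>N. openin ?P N \<and> u \<in> N \<and> (\<forall>z\<in>N. \<forall>x\<in>K. G z x = G u x)" by blast
  qed
  moreover have "G (F f) = f" if "f \<in> Cf Y" for f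
  proof (rule extensionalityI[OF _ Cf_extensional[OF that]])
    fix x assume x: "x \<in> topspace Y"
    then obtain n where "x \<in> D n" using D(4) by blast
    then show "G (F f) x = f x" using x ix unfolding G_def F_def by simp
  qed (simp add: G_def)
  moreover have "F (G u) = u" if u: "u \<in> topspace ?P" for u
  proof
    fix n
    have un: "u n \<in> Cf (subtopology Y (D n))" using u by auto
    show "F (G u) n = u n"
      unfolding F_def
    proof (rule extensionalityI[OF restrict_extensional])
      show "u n \<in> extensional (D n)" using Cf_extensional[OF un] unfolding TD .
      fix x assume "x \<in> D n"
      then show "restrict (G u) (D n) x = u n x" unfolding G_def using ix DY by auto
    qed
  qed
  ultimately have "homeomorphic_maps (Ck2_topology Y) ?P F G"
    unfolding homeomorphic_maps_def by simp
  then have "Ck2_topology Y homeomorphic_space ?P"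
    unfolding homeomorphic_space_def by blast
  moreover have "completely_metrizable_space ?P"
    unfolding completely_metrizable_space_product_topology
    by (auto intro: completely_metrizable_space_discrete_topology)
  ultimately show ?thesis
    using homeomorphic_completely_metrizable_space by blast
qed

lemma polish_abelian_group_Ck2:
  assumes "metrizable_space Y" "countable \<C>" "\<And>C. C \<in> \<C> \<Longrightarrow> openin Y C \<and> compactin Y C" "\<Union>\<C> = topspace Y"
  shows "polish_abelian_group (Ck2 Y) (Ck2_topology Y)"
proof -
  have H: "Hausdorff_space Y" using assms(1) by (rule metrizable_imp_Hausdorff_space)
  obtain D :: "nat \<Rightarrow> 'a set" where D: "disjoint_family D" "\<And>n. openin Y (D n)" "\<And>n. closedin Y (D n)"
    "\<And>n. compactin Y (D n)" "(\<Union>n. D n) = topspace Y" "\<And>K. compactin Y K \<Longrightarrow> \<exists>n. K \<subseteq> (\<Union>i<n. D i)"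
    by (rule obtains_disjoint_compact_cover[OF H assms(2-4)]) (assumption | rule that)+
  have "completely_metrizable_space (Ck2_topology Y)"
    by (rule completely_metrizable_Ck2[OF D(1,2,4,5,6)])
  moreover have "separable_space (Ck2_topology Y)"
  proof (rule separable_space_Ck2)
    show "second_countable Y"
      using assms by (intro second_countable_if_countable_compact_cover) auto
    fix K assume "compactin Y K"
    then obtain n where n: "K \<subseteq> (\<Union>i<n. D i)" using D(6) by blast
    have "openin Y (\<Union>i<n. D i)" using D(2) by blast
    moreover have "closedin Y (\<Union>i<n. D i)" using D(3) by (intro closedin_Union) auto
    moreover have "compactin Y (\<Union>i<n. D i)" using D(4) by (intro compactin_Union) auto
    ultimately show "\<exists>C. openin Y C \<and> closedin Y C \<and> compactin Y C \<and> K \<subseteq> C" using n by blast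
  qed
  ultimately show ?thesis
    unfolding polish_abelian_group_def polish_space_def using topological_group_Ck2 comm_group_Ck2 by blast
qed

section \<open>Spaces with compact derived set\<close>

lemma clopen_between_compact_and_open:
  assumes "zero_dimensional_space X" "compactin X S" "openin X U" "S \<subseteq> U"
  obtains V where "openin X V" "closedin X V" "S \<subseteq> V" "V \<subseteq> U"
proof -
  have 1: "\<forall>V\<in>{V. openin X V \<and> closedin X V \<and> V \<subseteq> U}. openin X V" by blast
  have 2: "S \<subseteq> \<Union>{V. openin X V \<and> closedin X V \<and> V \<subseteq> U}"
  proof
    fix x assume "x \<in> S"
    then have "x \<in> U" using assms(4) by blast
    then show "x \<in> \<Union>{V. openin X V \<and> closedin X V \<and> V \<subseteq> U}"
      by (rule zero_dimensional_spaceD[OF assms(1,3)]) blast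
  qed
  obtain \<F> where \<F>: "finite \<F>" "\<F> \<subseteq> {V. openin X V \<and> closedin X V \<and> V \<subseteq> U}" "S \<subseteq> \<Union>\<F>"
    by (rule compactin_obtains_subcover[OF assms(2) 1 2])
  show ?thesis
  proof
    show "openin X (\<Union>\<F>)" using \<F>(2) by blast
    show "closedin X (\<Union>\<F>)" using \<F>(1,2) by (intro closedin_Union) auto
  qed (use \<F> in blast)+
qed

text \<open>Clopen sets between \<open>S\<close> and its metric neighbourhoods of radius
  \<open>inverse (Suc n)\<close> are intersected successively. By the Lebesgue number lemma, every
  open set containing \<open>S\<close> contains one of these metric neighbourhoods.\<close>

lemma clopen_base_at_compact:
  assumes X: "metrizable_space X" "zero_dimensional_space X" and S: "compactin X S"
  obtains W :: "nat \<Rightarrow> 'a set" where "W 0 = topspace X" "\<And>n. W (Suc n) \<subseteq> W n"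
    "\<And>n. openin X (W n)" "\<And>n. closedin X (W n)" "\<And>n. S \<subseteq> W n"
    "\<And>U. \<lbrakk>openin X U; S \<subseteq> U\<rbrakk> \<Longrightarrow> \<exists>n. W n \<subseteq> U"
proof -
  obtain M d where "Metric_space M d" and Xd: "X = Metric_space.mtopology M d"
    using X(1) unfolding metrizable_space_def by blast
  then interpret Metric_space M d by simp
  have SM: "S \<subseteq> M" using compactin_subset_topspace[OF S] Xd by simp
  define N where "N \<equiv> \<lambda>n::nat. \<Union>x\<in>S. mball x (inverse (Suc n))"
  have N: "openin X (N n)" "S \<subseteq> N n" for n
    unfolding N_def using SM Xd by auto
  have "\<exists>V. openin X V \<and> closedin X V \<and> S \<subseteq> V \<and> V \<subseteq> N n" for n
    by (rule clopen_between_compact_and_open[OF X(2) S N]) blast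
  then obtain V where V: "\<And>n. openin X (V n) \<and> closedin X (V n) \<and> S \<subseteq> V n \<and> V n \<subseteq> N n" by metis
  \<comment> \<open>Starting with the whole space ensures that the differences
    \<open>W n - W (Suc n)\<close> leave out no isolated point.\<close>
  define W where "W \<equiv> rec_nat (topspace X) (\<lambda>n A. A \<inter> V n)"
  have W0: "W 0 = topspace X" and WS: "W (Suc n) = W n \<inter> V n" for n by (simp_all add: W_def)
  show ?thesis
  proof
    show "W 0 = topspace X" by (rule W0)
    show "W (Suc n) \<subseteq> W n" for n using WS by blast
    show "openin X (W n)" for n by (induction n) (use V in \<open>auto simp: W0 WS\<close>)
    show "closedin X (W n)" for n by (induction n) (use V in \<open>auto simp: W0 WS\<close>)
    show "S \<subseteq> W n" for n by (induction n) (use V compactin_subset_topspace[OF S] in \<open>auto simp: W0 WS\<close>)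
    show "\<exists>n. W n \<subseteq> U" if U: "openin X U" "S \<subseteq> U" for U
    proof -
      obtain e where e: "e > 0" "\<forall>x\<in>S. mball x e \<subseteq> U"
        using lebesgue_number[of S "{U}"] S U unfolding Xd by auto
      obtain n :: nat where n: "inverse (Suc n) < e" using e(1) reals_Archimedean by auto
      have "N n \<subseteq> U"
        unfolding N_def using e(2) n mball_subset_concentric[of "inverse (Suc n)" e] by fastforce
      then have "W (Suc n) \<subseteq> U" using WS V by blast
      then show ?thesis by blast
    qed
  qed
qed

lemma openin_subset_isolated:
  assumes "A \<subseteq> topspace X - X derived_set_of topspace X"
  shows "openin X A"
proof (subst openin_subopen, intro ballI)
  fix x assume x: "x \<in> A"
  then have "x \<in> topspace X" "x \<notin> X derived_set_of topspace X" using assms by auto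
  then obtain T where T: "x \<in> T" "openin X T" "\<And>y. y \<noteq> x \<Longrightarrow> y \<in> topspace X \<Longrightarrow> y \<notin> T"
    unfolding derived_set_of_def by blast
  then have "T = {x}" using openin_subset by blast
  then show "\<exists>T. openin X T \<and> x \<in> T \<and> T \<subseteq> A" using T x by blast
qed

lemma subtopology_isolated_eq_discrete:
  assumes "A \<subseteq> topspace X - X derived_set_of topspace X"
  shows "subtopology X A = discrete_topology A"
proof -
  have "openin (subtopology X A) {x}" if "x \<in> A" for x
    unfolding openin_subtopology using that assms
    by (intro exI[of _ "{x}"]) (auto intro: openin_subset_isolated)
  moreover have "topspace (subtopology X A) = A" using assms by auto
  ultimately show ?thesis by (metis discrete_topology_unique)
qed

section \<open>Layers around a compact derived set\<close>

locale compact_derived_set =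
  fixes X :: "'a topology" and S :: "'a set" and W :: "nat \<Rightarrow> 'a set"
  assumes metrizable: "metrizable_space X"
    and S_def: "S = X derived_set_of topspace X"
    and compact_S: "compactin X S"
    and W_0: "W 0 = topspace X" and W_Suc: "W (Suc n) \<subseteq> W n"
    and openin_W: "openin X (W n)" and closedin_W: "closedin X (W n)" and S_subset_W: "S \<subseteq> W n"
    and W_base: "\<lbrakk>openin X U; S \<subseteq> U\<rbrakk> \<Longrightarrow> \<exists>n. W n \<subseteq> U"
begin

text \<open>These layers consist of isolated points, so each is a discrete clopen subspace. They
  turn out to be the index sets of the box direct sum.\<close>

definition R :: "nat \<Rightarrow> 'a set" where
  "R n = W n - W (Suc n)"

lemma Hausdorff: "Hausdorff_space X"
  using metrizable by (rule metrizable_imp_Hausdorff_space)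

lemma S_subset: "S \<subseteq> topspace X"
  using compactin_subset_topspace[OF compact_S] .

lemma W_subset: "W n \<subseteq> topspace X"
  using openin_subset[OF openin_W] .

lemma W_antimono: "m \<le> n \<Longrightarrow> W n \<subseteq> W m"
  by (rule lift_Suc_antimono_le[of W]) (use W_Suc in auto)

lemma openin_isolated: "A \<subseteq> topspace X - S \<Longrightarrow> openin X A"
  unfolding S_def by (rule openin_subset_isolated)

lemma R_subset: "R n \<subseteq> topspace X - S"
  using W_subset S_subset_W unfolding R_def by blast

lemma disjoint_R: "disjoint_family R"
proof -
  have "R m \<inter> R n = {}" if "m < n" for m n
    using W_antimono[of "Suc m" n] that unfolding R_def by auto
  then show ?thesis
    unfolding disjoint_family_on_def by (metis Int_commute linorder_neqE_nat)
qed

text \<open>A point \<open>x\<close> outside \<open>S\<close> is missed by some \<open>W n\<close>,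
  because the complement of \<open>{x}\<close> is an open neighbourhood of \<open>S\<close>. The
  least such index is a successor, as \<open>W 0\<close> is the whole space, and its predecessor
  names the layer of \<open>x\<close>.\<close>

lemma UN_R: "(\<Union>n. R n) = topspace X - S"
proof
  show "topspace X - S \<subseteq> (\<Union>n. R n)"
  proof
    fix x assume x: "x \<in> topspace X - S"
    then have "openin X (topspace X - {x})" "S \<subseteq> topspace X - {x}"
      using closedin_Hausdorff_singleton[OF Hausdorff] S_subset by blast+
    then have ex: "\<exists>n. x \<notin> W n" using W_base by blast
    define m where "m = (LEAST n. x \<notin> W n)"
    have m: "x \<notin> W m" unfolding m_def using LeastI_ex[OF ex] .
    then obtain k where k: "m = Suc k" using W_0 x by (cases m) auto
    then have "x \<in> W k" unfolding m_def using not_less_Least lessI by metis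
    then show "x \<in> (\<Union>n. R n)" using m k unfolding R_def by blast
  qed
qed (use R_subset in blast)

lemma not_in_W_iff: "x \<in> topspace X \<Longrightarrow> x \<notin> W m \<longleftrightarrow> (\<exists>n<m. x \<in> R n)"
proof (induction m)
  case (Suc m)
  then show ?case using W_Suc[of m] unfolding R_def by (auto simp: less_Suc_eq)
qed (use W_0 in simp)

lemma subtopology_isolated: "A \<subseteq> topspace X - S \<Longrightarrow> subtopology X A = discrete_topology A"
  unfolding S_def by (rule subtopology_isolated_eq_discrete)

lemma finite_compactin_Int_isolated:
  assumes "compactin X K" "closedin X A" "A \<subseteq> topspace X - S"
  shows "finite (K \<inter> A)"
proof -
  have "compactin (subtopology X A) (K \<inter> A)"
    using compact_Int_closedin[OF assms(1,2)] by (simp add: compactin_subtopology)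
  then show ?thesis
    using subtopology_isolated[OF assms(3)] by (simp add: compactin_discrete_topology)
qed

lemma closedin_R: "closedin X (R n)"
  unfolding R_def using closedin_W openin_W by blast

text \<open>Finitely many members of an open cover already cover \<open>S\<close> and hence contain
  some \<open>W m\<close>, which contains all \<open>F n\<close> with \<open>n \<ge> m\<close>. The
  remaining finitely many finite sets need only finitely many more members.\<close>

lemma compactin_S_Un:
  assumes F: "\<And>n. finite (F n)" "\<And>n. F n \<subseteq> R n"
  shows "compactin X (S \<union> (\<Union>n. F n))"
  unfolding compactin_def
proof (intro conjI allI impI)
  show "S \<union> (\<Union>n. F n) \<subseteq> topspace X" using S_subset F(2) R_subset by blast
  fix \<U> assume U: "(\<forall>U\<in>\<U>. openin X U) \<and> S \<union> (\<Union>n. F n) \<subseteq> \<Union>\<U>"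
  have "\<forall>U\<in>\<U>. openin X U" "S \<subseteq> \<Union>\<U>" using U by blast+
  then obtain \<F> where \<F>: "finite \<F>" "\<F> \<subseteq> \<U>" "S \<subseteq> \<Union>\<F>"
    by (rule compactin_obtains_subcover[OF compact_S])
  have "openin X (\<Union>\<F>)" using \<F>(2) U by blast
  then obtain m where m: "W m \<subseteq> \<Union>\<F>" using W_base \<F>(3) by blast
  have "finite (\<Union>n\<in>{..<m}. F n)" using F(1) by simp
  moreover have "(\<Union>n\<in>{..<m}. F n) \<subseteq> topspace X" using F(2) R_subset by blast
  ultimately have c: "compactin X (\<Union>n\<in>{..<m}. F n)" by (rule finite_imp_compactin[rotated])
  have "\<forall>U\<in>\<U>. openin X U" "(\<Union>n\<in>{..<m}. F n) \<subseteq> \<Union>\<U>" using U by blast+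
  then obtain \<G> where \<G>: "finite \<G>" "\<G> \<subseteq> \<U>" "(\<Union>n\<in>{..<m}. F n) \<subseteq> \<Union>\<G>"
    by (rule compactin_obtains_subcover[OF c])
  have "F n \<subseteq> \<Union>\<F> \<union> \<Union>\<G>" for n
  proof (cases "n < m")
    case False
    then have "F n \<subseteq> W m" using W_antimono[of m n] F(2)[of n] unfolding R_def by auto
    then show ?thesis using m by blast
  qed (use \<G> in blast)
  then have "S \<union> (\<Union>n. F n) \<subseteq> \<Union>(\<F> \<union> \<G>)" using \<F>(3) by blast
  moreover have "finite (\<F> \<union> \<G>)" "\<F> \<union> \<G> \<subseteq> \<U>" using \<F> \<G> by simp_all
  ultimately show "\<exists>\<F>. finite \<F> \<and> \<F> \<subseteq> \<U> \<and> S \<union> (\<Union>n. F n) \<subseteq> \<Union>\<F>" by blast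
qed

lemma Cf_agree_near_S:
  assumes "f \<in> Cf X" "g \<in> Cf X" "\<And>x. x \<in> S \<Longrightarrow> f x = g x"
  obtains m where "\<And>x. x \<in> W m \<Longrightarrow> f x = g x"
proof -
  have "S \<subseteq> {x \<in> topspace X. f x = g x}" using assms(3) S_subset by blast
  then obtain m where "W m \<subseteq> {x \<in> topspace X. f x = g x}"
    using W_base openin_Cf_eq[OF assms(1,2)] by blast
  then show ?thesis using that by blast
qed

text \<open>The complement of \<open>W n\<close> is clopen and discrete, so the functions on it form
  a compact power of 2. Extending them by \<open>f0\<close> on \<open>W n\<close> is continuous,
  since a compact set meets this complement in a finite set, and the image is the set in
  question.\<close>

lemma compactin_Ck2_agree_W:
  assumes f0: "f0 \<in> Cf X"
  shows "compactin (Ck2_topology X) {f \<in> Cf X. \<forall>x\<in>W n. f x = f0 x}"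
proof -
  let ?A = "topspace X - W n"
  let ?T = "Ck2_topology (discrete_topology ?A)"
  define G where "G \<equiv> \<lambda>u::'a \<Rightarrow> int. \<lambda>x\<in>topspace X. if x \<in> W n then f0 x else u x"
  have AS: "?A \<subseteq> topspace X - S" using S_subset_W by blast
  have clA: "closedin X ?A" using openin_W by blast
  have GC: "G u \<in> Cf X" if u: "u \<in> topspace ?T" for u
  proof -
    have "u \<in> Cf (subtopology X ?A)" using u subtopology_isolated[OF AS] by simp
    then have "(\<lambda>x\<in>topspace X. if x \<in> W n then restrict f0 (W n) x else u x) \<in> Cf X"
      using W_subset openin_W closedin_W f0 by (intro Cf_glue[of X "W n" ?A] Cf_restrict) auto
    moreover have "(\<lambda>x\<in>topspace X. if x \<in> W n then restrict f0 (W n) x else u x) = G u"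
      unfolding G_def by (rule restrict_ext) simp
    ultimately show ?thesis by simp
  qed
  have "continuous_map ?T (Ck2_topology X) G"
  proof (rule continuous_map_into_Ck2[OF GC])
    fix u K assume u: "u \<in> topspace ?T" and K: "compactin X K"
    have "finite (K \<inter> ?A)" by (rule finite_compactin_Int_isolated[OF K clA AS])
    then have c: "compactin (discrete_topology ?A) (K \<inter> ?A)" by (simp add: compactin_discrete_topology)
    let ?N = "{v \<in> Cf (discrete_topology ?A). \<forall>x\<in>K \<inter> ?A. v x = u x}"
    have "openin ?T ?N" by (rule openin_Ck2_agree[OF c])
    moreover have "u \<in> ?N" using u by simp
    moreover have "\<forall>z\<in>?N. \<forall>x\<in>K. G z x = G u x"
      using compactin_subset_topspace[OF K] unfolding G_def by auto
    ultimately show "\<exists>N. openin ?T N \<and> u \<in> N \<and> (\<forall>z\<in>N. \<forall>x\<in>K. G z x = G u x)" by blast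
  qed
  moreover have "compactin ?T (topspace ?T)"
    using compact_space_Z2_power_topology[of ?A] unfolding Ck2_topology_discrete compact_space_def .
  ultimately have "compactin (Ck2_topology X) (G ` topspace ?T)"
    by (rule image_compactin[rotated])
  moreover have "G ` topspace ?T = {f \<in> Cf X. \<forall>x\<in>W n. f x = f0 x}"
  proof (intro equalityI subsetI)
    fix f assume "f \<in> G ` topspace ?T"
    then show "f \<in> {f \<in> Cf X. \<forall>x\<in>W n. f x = f0 x}" using GC W_subset[of n] unfolding G_def by auto
  next
    fix f assume f: "f \<in> {f \<in> Cf X. \<forall>x\<in>W n. f x = f0 x}"
    have "restrict f ?A \<in> Cf (subtopology X ?A)" using f by (intro Cf_restrict) auto
    then have "restrict f ?A \<in> topspace ?T" using subtopology_isolated[OF AS] by simp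
    moreover have "f = G (restrict f ?A)"
      using f Cf_extensional[of f X] unfolding G_def by (intro extensionalityI[OF _ restrict_extensional]) auto
    ultimately show "f \<in> G ` topspace ?T" by blast
  qed
  ultimately show ?thesis by simp
qed

text \<open>For \<open>f0\<close> outside \<open>A\<close> a compact set
  \<open>S \<union> (\<Union>n. F n)\<close> is built such that no member of \<open>A\<close> agrees
  with \<open>f0\<close> on it. The finite sets \<open>F n\<close> come from an induction that
  weakens agreement on \<open>W m\<close> to agreement on \<open>W (Suc m)\<close> at the price of
  finitely many points of \<open>R m\<close>. In the end a function agreeing with \<open>f0\<close>
  on \<open>S\<close> agrees with it on some \<open>W m\<close>, where stage \<open>m\<close>
  applies.\<close>

lemma k_space_Ck2: "k_space (Ck2_topology X)"
  unfolding k_space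
proof (intro allI impI, elim conjE)
  fix A assume A: "A \<subseteq> topspace (Ck2_topology X)"
    and AK: "\<forall>K. compactin (Ck2_topology X) K \<longrightarrow> closedin (subtopology (Ck2_topology X) K) (K \<inter> A)"
  have "\<exists>K. compactin X K \<and> {g \<in> Cf X. \<forall>x\<in>K. g x = f0 x} \<subseteq> Cf X - A" if f0: "f0 \<in> Cf X" "f0 \<notin> A" for f0
  proof -
    \<comment> \<open>The invariant: agreement with \<open>f0\<close> on \<open>W m\<close> and on
      the finite set \<open>B\<close> already excludes membership in \<open>A\<close>. At
      \<open>m = 0\<close> only \<open>f0\<close> itself satisfies the condition.\<close>
    define P where "P \<equiv> \<lambda>m B. finite B \<and> {f \<in> Cf X. \<forall>x\<in>W m \<union> B. f x = f0 x} \<inter> A = {}"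
    have P0: "P 0 {}"
    proof -
      have "f = f0" if "f \<in> Cf X" "\<forall>x\<in>W 0. f x = f0 x" for f
        using that f0(1) W_0 by (intro Cf_eqI[of f X]) auto
      then show ?thesis unfolding P_def using f0(2) by auto
    qed
    have step: "\<exists>B'. P (Suc m) B' \<and> (\<exists>F. finite F \<and> F \<subseteq> R m \<and> B' = B \<union> F)" if PB: "P m B" for m B
    proof -
      let ?Z = "{f \<in> Cf X. \<forall>x\<in>W (Suc m). f x = f0 x}"
      \<comment> \<open>The obstruction to keeping \<open>B\<close> unchanged at the next stage. It
        is compact because \<open>?Z\<close> is compact and \<open>A\<close> is closed on compact
        sets. The intersection with \<open>topspace X\<close> is harmless, as extensional functions
        agree off it.\<close>
      let ?Q = "?Z \<inter> A \<inter> {f \<in> Cf X. \<forall>x\<in>topspace X \<inter> B. f x = f0 x}"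
      have Z: "compactin (Ck2_topology X) ?Z" by (rule compactin_Ck2_agree_W[OF f0(1)])
      then have "closedin (subtopology (Ck2_topology X) ?Z) (?Z \<inter> A)" using AK by blast
      then have "closedin (Ck2_topology X) (?Z \<inter> A)"
        using compactin_imp_closedin[OF Hausdorff_Ck2_topology Z] closedin_trans_full by blast
      then have "compactin (Ck2_topology X) (?Z \<inter> A)"
        by (rule closed_compactin[OF Z Int_lower1])
      then have Q: "compactin (Ck2_topology X) ?Q"
        by (rule compact_Int_closedin) (rule closedin_Ck2_agree[OF f0(1)], blast)
      \<comment> \<open>By the invariant every member of \<open>?Q\<close> differs from
        \<open>f0\<close> somewhere on \<open>R m\<close>, so these open sets cover
        \<open>?Q\<close>. A finite subcover gives the points to be added.\<close>
      let ?U = "(\<lambda>x. Cf X - {f \<in> Cf X. \<forall>y\<in>{x}. f y = f0 y}) ` R m"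
      have op: "\<forall>U\<in>?U. openin (Ck2_topology X) U"
      proof clarify
        fix x assume "x \<in> R m"
        then have "{x} \<subseteq> topspace X" using R_subset by blast
        then have "closedin (Ck2_topology X) {f \<in> Cf X. \<forall>y\<in>{x}. f y = f0 y}"
          by (rule closedin_Ck2_agree[OF f0(1)])
        then show "openin (Ck2_topology X) (Cf X - {f \<in> Cf X. \<forall>y\<in>{x}. f y = f0 y})"
          unfolding closedin_def topspace_Ck2_topology by (rule conjunct2)
      qed
      have cov: "?Q \<subseteq> \<Union>?U"
      proof
        fix f assume f: "f \<in> ?Q"
        have "f x = f0 x" if "x \<in> B" "x \<notin> topspace X" for x
          using f f0(1) that Cf_extensional[of f X] Cf_extensional[of f0 X] by (auto simp: extensional_def)
        then have fB: "\<forall>x\<in>B. f x = f0 x" using f by blast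
        have "\<exists>x\<in>R m. f x \<noteq> f0 x"
        proof (rule ccontr)
          assume "\<not> (\<exists>x\<in>R m. f x \<noteq> f0 x)"
          then have "\<forall>x\<in>W m \<union> B. f x = f0 x" using f fB unfolding R_def by blast
          then show False using f PB unfolding P_def by blast
        qed
        then show "f \<in> \<Union>?U" using f by blast
      qed
      obtain \<F> where \<F>: "finite \<F>" "\<F> \<subseteq> ?U" "?Q \<subseteq> \<Union>\<F>"
        by (rule compactin_obtains_subcover[OF Q op cov])
      obtain F where F: "F \<subseteq> R m" "finite F" "\<F> = (\<lambda>x. Cf X - {f \<in> Cf X. \<forall>y\<in>{x}. f y = f0 y}) ` F"
        using finite_subset_image[OF \<F>(1,2)] by blast
      have "{f \<in> Cf X. \<forall>x\<in>W (Suc m) \<union> (B \<union> F). f x = f0 x} \<inter> A = {}"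
      proof (rule equals0I)
        fix f assume f: "f \<in> {f \<in> Cf X. \<forall>x\<in>W (Suc m) \<union> (B \<union> F). f x = f0 x} \<inter> A"
        then have "f \<in> ?Q" by blast
        then obtain x where "x \<in> F" "f x \<noteq> f0 x" using \<F>(3) unfolding F(3) by blast
        then show False using f by blast
      qed
      then have "P (Suc m) (B \<union> F)" using PB F(2) unfolding P_def by simp
      then show ?thesis using F by blast
    qed
    \<comment> \<open>The clause for \<open>m = 0\<close> makes the sequence start with the empty
      set, so each \<open>B m\<close> consists of points of the chosen sets \<open>F n\<close>
      only.\<close>
    have "\<exists>B. \<forall>m. (P m (B m) \<and> (m = 0 \<longrightarrow> B m = {})) \<and> (\<exists>F. finite F \<and> F \<subseteq> R m \<and> B (Suc m) = B m \<union> F)"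
      by (rule dependent_nat_choice) (use P0 step in auto)
    then obtain B where all: "\<forall>m. (P m (B m) \<and> (m = 0 \<longrightarrow> B m = {})) \<and> (\<exists>F. finite F \<and> F \<subseteq> R m \<and> B (Suc m) = B m \<union> F)"
      by (elim exE)
    have B: "P m (B m)" "\<exists>F. finite F \<and> F \<subseteq> R m \<and> B (Suc m) = B m \<union> F" for m
      by (rule conjunct1[OF conjunct1[OF spec[OF all]]], rule conjunct2[OF spec[OF all]])
    have B0: "B 0 = {}" using conjunct2[OF conjunct1[OF spec[OF all, of 0]]] by simp
    have "\<forall>m. \<exists>F. finite F \<and> F \<subseteq> R m \<and> B (Suc m) = B m \<union> F" using B(2) by (rule allI)
    then obtain F where F: "\<And>m. finite (F m)" "\<And>m. F m \<subseteq> R m" "\<And>m. B (Suc m) = B m \<union> F m"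
      unfolding choice_iff by (elim exE) (rule that, (drule spec, elim conjE, assumption)+)
    have BF: "B m \<subseteq> (\<Union>n. F n)" for m
      by (induction m) (use B0 F(3) in auto)
    have "g \<notin> A" if g: "g \<in> Cf X" "\<forall>x\<in>S \<union> (\<Union>n. F n). g x = f0 x" for g
    proof -
      have "\<And>x. x \<in> S \<Longrightarrow> g x = f0 x" using g(2) by blast
      then obtain m where m: "\<And>x. x \<in> W m \<Longrightarrow> g x = f0 x" using Cf_agree_near_S[OF g(1) f0(1)] by blast
      have "\<forall>x\<in>W m \<union> B m. g x = f0 x" using m g(2) BF by blast
      then show ?thesis using B(1)[of m] g(1) unfolding P_def by blast
    qed
    then show ?thesis using compactin_S_Un[OF F(1,2)] by blast
  qed
  then have "openin (Ck2_topology X) (Cf X - A)"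
    unfolding openin_Ck2_topology by blast
  then show "closedin (Ck2_topology X) A" using A by (simp add: closedin_def)
qed

end

section \<open>The direct sum with the box topology\<close>

lemma carrier_Z2_power [simp]: "carrier (Z2_power I) = Cf (discrete_topology I)"
  by (simp add: Z2_power_def Cf_discrete_topology)

lemma one_Z2_power [simp]: "\<one>\<^bsub>Z2_power I\<^esub> = (\<lambda>i\<in>I. 0)"
  and mult_Z2_power [simp]: "u \<otimes>\<^bsub>Z2_power I\<^esub> v = (\<lambda>i\<in>I. (u i + v i) mod 2)"
  by (simp_all add: Z2_power_def)

lemma group_Z2_power: "group (Z2_power I)"
  by (simp add: Z2_power_def)

lemma carrier_Z2_power_sum:
  "carrier (Z2_power_sum \<kappa>) = {u. (\<forall>n. u n \<in> Cf (discrete_topology (\<kappa> n))) \<and> finite {n. u n \<noteq> (\<lambda>i\<in>\<kappa> n. 0)}}"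
  by (auto simp: Z2_power_sum_def carrier_sum_group[OF group_Z2_power])

lemma mult_Z2_power_sum [simp]:
  "u \<otimes>\<^bsub>Z2_power_sum \<kappa>\<^esub> v = (\<lambda>n. \<lambda>i\<in>\<kappa> n. (u n i + v n i) mod 2)"
  by (intro ext) (simp add: Z2_power_sum_def)

lemma openin_Z2_power_topology:
  "openin (Z2_power_topology I) U \<longleftrightarrow> U \<subseteq> Cf (discrete_topology I) \<and>
    (\<forall>u\<in>U. \<exists>F. finite F \<and> F \<subseteq> I \<and> {v \<in> Cf (discrete_topology I). \<forall>i\<in>F. v i = u i} \<subseteq> U)"
  by (simp add: openin_Ck2_topology compactin_discrete_topology conj_ac flip: Ck2_topology_discrete)

text \<open>In each factor a neighbourhood of the identity fixes finitely many coordinates, so a box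
  neighbourhood of \<open>v\<close> prescribes finitely many coordinates of \<open>v\<close> in
  every factor, and the translates disappear from the description.\<close>

lemma openin_Z2_power_sum_box_topology:
  "openin (Z2_power_sum_box_topology \<kappa>) V \<longleftrightarrow> V \<subseteq> carrier (Z2_power_sum \<kappa>) \<and>
    (\<forall>v\<in>V. \<exists>F. (\<forall>n. finite (F n) \<and> F n \<subseteq> \<kappa> n) \<and>
       {w \<in> carrier (Z2_power_sum \<kappa>). \<forall>n. \<forall>i\<in>F n. w n i = v n i} \<subseteq> V)"
  (is "?L \<longleftrightarrow> ?R")
proof
  let ?G = "\<lambda>n. Z2_power (\<kappa> n)"
  let ?C = "carrier (Z2_power_sum \<kappa>)"
  let ?box = "box_topology UNIV ?G (\<lambda>n. Z2_power_topology (\<kappa> n))"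
  have sumC: "v n \<in> Cf (discrete_topology (\<kappa> n))" if "v \<in> ?C" for v n
    using that by (simp add: carrier_Z2_power_sum)
  {
    assume ?L
    then obtain W where W: "openin ?box W" "V = W \<inter> ?C"
      by (auto simp: Z2_power_sum_box_topology_def openin_subtopology)
    show ?R
    proof (intro conjI ballI)
      show "V \<subseteq> ?C" using W(2) by blast
      fix v assume v: "v \<in> V"
      then have "v \<in> W" using W(2) by blast
      then have "\<exists>U. (\<forall>n. openin (Z2_power_topology (\<kappa> n)) (U n) \<and> (\<lambda>i\<in>\<kappa> n. 0) \<in> U n) \<and>
          v <#\<^bsub>product_group UNIV ?G\<^esub> (\<Pi>\<^sub>E n\<in>UNIV. U n) \<subseteq> W"
        using W(1) unfolding openin_box_topology by auto
      then obtain U where U: "\<And>n. openin (Z2_power_topology (\<kappa> n)) (U n)" "\<And>n. (\<lambda>i\<in>\<kappa> n. 0) \<in> U n"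
        "v <#\<^bsub>product_group UNIV ?G\<^esub> (\<Pi>\<^sub>E n\<in>UNIV. U n) \<subseteq> W"
        by blast
      have ex: "\<forall>n. \<exists>F. finite F \<and> F \<subseteq> \<kappa> n \<and>
          {u \<in> Cf (discrete_topology (\<kappa> n)). \<forall>i\<in>F. u i = (\<lambda>i\<in>\<kappa> n. 0) i} \<subseteq> U n"
      proof
        fix n
        show "\<exists>F. finite F \<and> F \<subseteq> \<kappa> n \<and>
          {u \<in> Cf (discrete_topology (\<kappa> n)). \<forall>i\<in>F. u i = (\<lambda>i\<in>\<kappa> n. 0) i} \<subseteq> U n"
          using U(1)[of n] U(2)[of n] unfolding openin_Z2_power_topology by blast
      qed
      obtain F where F: "\<And>n. finite (F n) \<and> F n \<subseteq> \<kappa> n \<and>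
          {u \<in> Cf (discrete_topology (\<kappa> n)). \<forall>i\<in>F n. u i = (\<lambda>i\<in>\<kappa> n. 0) i} \<subseteq> U n"
        using choice[OF ex] by (elim exE) (rule that, erule spec)
      have "w \<in> V" if w: "w \<in> ?C" "\<forall>n. \<forall>i\<in>F n. w n i = v n i" for w
      proof -
        have vw: "v n \<in> Cf (discrete_topology (\<kappa> n))" "w n \<in> Cf (discrete_topology (\<kappa> n))" for n
          using v w(1) W(2) sumC by blast+
        \<comment> \<open>All elements have order at most 2, so \<open>v + w\<close> is the
          translation that carries \<open>v\<close> to \<open>w\<close>. It vanishes on every
          \<open>F n\<close>.\<close>
        define e where "e \<equiv> \<lambda>n. \<lambda>i\<in>\<kappa> n. (v n i + w n i) mod 2"
        have "e n \<in> Cf (discrete_topology (\<kappa> n))" for n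
          using Cf_add[OF vw[of n]] unfolding e_def by simp
        moreover have "e n i = (\<lambda>i\<in>\<kappa> n. 0) i" if i: "i \<in> F n" for n i
        proof -
          have "i \<in> \<kappa> n" "w n i = v n i" using F i w(2) by blast+
          then show ?thesis by (simp add: e_def)
        qed
        ultimately have "e n \<in> U n" for n using F by blast
        then have "e \<in> (\<Pi>\<^sub>E n\<in>UNIV. U n)" by (intro PiE_I) auto
        moreover have "w = v \<otimes>\<^bsub>product_group UNIV ?G\<^esub> e"
        proof
          fix n
          have "(\<lambda>i\<in>\<kappa> n. (v n i + e n i) mod 2) = w n"
          proof (rule extensionalityI[OF restrict_extensional])
            show "w n \<in> extensional (\<kappa> n)" using Cf_extensional[OF vw(2)[of n]] by simp
            fix i assume i: "i \<in> \<kappa> n"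
            then have "v n i \<in> {0, 1}" "w n i \<in> {0, 1}" using Cf_values[OF vw(1)[of n], of i] Cf_values[OF vw(2)[of n], of i] by auto
            then show "(\<lambda>i\<in>\<kappa> n. (v n i + e n i) mod 2) i = w n i" using i by (auto simp: e_def)
          qed
          then show "w n = (v \<otimes>\<^bsub>product_group UNIV ?G\<^esub> e) n" by simp
        qed
        ultimately have "w \<in> W" using U(3) unfolding l_coset_def by blast
        then show ?thesis using W(2) w(1) by blast
      qed
      then show "\<exists>F. (\<forall>n. finite (F n) \<and> F n \<subseteq> \<kappa> n) \<and> {w \<in> ?C. \<forall>n. \<forall>i\<in>F n. w n i = v n i} \<subseteq> V"
        using F by (intro exI[of _ F]) blast
    qed
  next
    assume R: ?R
    obtain F where F0: "\<forall>v\<in>V. (\<forall>n. finite (F v n) \<and> F v n \<subseteq> \<kappa> n) \<and>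
        {w \<in> ?C. \<forall>n. \<forall>i\<in>F v n. w n i = v n i} \<subseteq> V"
      using bchoice[OF conjunct2[OF R]] by (elim exE) (rule that)
    have F: "finite (F v n) \<and> F v n \<subseteq> \<kappa> n" "{w \<in> ?C. \<forall>n. \<forall>i\<in>F v n. w n i = v n i} \<subseteq> V"
      if "v \<in> V" for v n
      by (rule spec[OF conjunct1[OF bspec[OF F0 that]]], rule conjunct2[OF bspec[OF F0 that]])
    \<comment> \<open>The union, in the full product, of the chosen basic neighbourhoods of the
      points of \<open>V\<close>. By the choice of \<open>F\<close> its trace on the direct sum is
      again \<open>V\<close>.\<close>
    define W where "W = {w \<in> carrier (product_group UNIV ?G). \<exists>v\<in>V. \<forall>n. \<forall>i\<in>F v n. w n i = v n i}"
    have "openin ?box W"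
      unfolding openin_box_topology
    proof (intro conjI ballI)
      show "W \<subseteq> carrier (product_group UNIV ?G)" unfolding W_def by blast
      fix w assume "w \<in> W"
      then obtain v where w: "w \<in> carrier (product_group UNIV ?G)" and v: "v \<in> V" "\<forall>n. \<forall>i\<in>F v n. w n i = v n i"
        unfolding W_def by blast
      have wn: "w n \<in> Cf (discrete_topology (\<kappa> n))" for n using w by auto
      \<comment> \<open>Translating by elements vanishing on \<open>F v n\<close> preserves
        agreement with \<open>v\<close> there, so \<open>W\<close> contains this box around
        \<open>w\<close>.\<close>
      define U where "U \<equiv> \<lambda>n. {u \<in> Cf (discrete_topology (\<kappa> n)). \<forall>i\<in>F v n. u i = (\<lambda>i\<in>\<kappa> n. 0) i}"
      have "compactin (discrete_topology (\<kappa> n)) (F v n)" for n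
        using F(1)[OF v(1)] by (simp add: compactin_discrete_topology)
      then have "openin (Z2_power_topology (\<kappa> n)) (U n)" for n
        unfolding U_def Ck2_topology_discrete[symmetric] by (rule openin_Ck2_agree)
      moreover have "\<one>\<^bsub>?G n\<^esub> \<in> U n" for n
        using zero_in_Cf[of "discrete_topology (\<kappa> n)"] unfolding U_def by simp
      moreover have "w <#\<^bsub>product_group UNIV ?G\<^esub> (\<Pi>\<^sub>E n\<in>UNIV. U n) \<subseteq> W"
      proof
        fix z assume "z \<in> w <#\<^bsub>product_group UNIV ?G\<^esub> (\<Pi>\<^sub>E n\<in>UNIV. U n)"
        then obtain e where e: "e \<in> (\<Pi>\<^sub>E n\<in>UNIV. U n)" "z = w \<otimes>\<^bsub>product_group UNIV ?G\<^esub> e"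
          unfolding l_coset_def by blast
        have en: "e n \<in> Cf (discrete_topology (\<kappa> n))" "\<And>i. i \<in> F v n \<Longrightarrow> e n i = (\<lambda>i\<in>\<kappa> n. 0) i" for n
        proof -
          have "e n \<in> U n" using PiE_mem[OF e(1)] by simp
          then show "e n \<in> Cf (discrete_topology (\<kappa> n))" "\<And>i. i \<in> F v n \<Longrightarrow> e n i = (\<lambda>i\<in>\<kappa> n. 0) i"
            unfolding U_def by blast+
        qed
        have zn: "z n = (\<lambda>i\<in>\<kappa> n. (w n i + e n i) mod 2)" for n using e(2) by simp
        have "z n \<in> Cf (discrete_topology (\<kappa> n))" for n
          using Cf_add[OF wn[of n] en(1)[of n]] zn by simp
        moreover have "z n i = v n i" if i: "i \<in> F v n" for n i
        proof -
          have "i \<in> \<kappa> n" using F(1)[OF v(1)] i by blast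
          then show ?thesis
            using zn[of n] en(2)[OF i] v(2) i Cf_values[OF wn[of n], of i] by auto
        qed
        ultimately show "z \<in> W" unfolding W_def using v(1) by auto
      qed
      ultimately show "\<exists>U. (\<forall>n\<in>UNIV. openin (Z2_power_topology (\<kappa> n)) (U n) \<and> \<one>\<^bsub>?G n\<^esub> \<in> U n) \<and>
          w <#\<^bsub>product_group UNIV ?G\<^esub> (\<Pi>\<^sub>E n\<in>UNIV. U n) \<subseteq> W"
        by blast
    qed
    moreover have "V = W \<inter> ?C"
    proof (intro equalityI subsetI)
      fix v assume v: "v \<in> V"
      then have vC: "v \<in> ?C" using R by blast
      then have "v \<in> carrier (product_group UNIV ?G)" using sumC by auto
      then show "v \<in> W \<inter> ?C" using v vC unfolding W_def by blast
    next
      fix w assume "w \<in> W \<inter> ?C"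
      then show "w \<in> V" using F(2) unfolding W_def by blast
    qed
    ultimately show ?L
      unfolding Z2_power_sum_box_topology_def openin_subtopology by blast
  }
qed

section \<open>The open subgroup of functions vanishing on the derived set\<close>

context compact_derived_set
begin

definition H :: "('a \<Rightarrow> int) set" where
  "H = {f \<in> Cf X. \<forall>x\<in>S. f x = 0}"

lemma subgroup_H: "subgroup H (Ck2 X)"
proof (rule group.subgroupI[OF group_Ck2])
  show "H \<subseteq> carrier (Ck2 X)" unfolding H_def by auto
  show "H \<noteq> {}" unfolding H_def using zero_in_Cf[of X] S_subset by force
  fix f assume f: "f \<in> H"
  then show "inv\<^bsub>Ck2 X\<^esub> f \<in> H" unfolding H_def by (auto simp: inv_Ck2)
  fix g assume "g \<in> H"
  then show "f \<otimes>\<^bsub>Ck2 X\<^esub> g \<in> H" using f S_subset unfolding H_def by (auto simp: Cf_add subset_iff)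
qed

lemma openin_H: "openin (Ck2_topology X) H"
  using openin_Ck2_agree[OF compact_S, of "\<lambda>_. 0"] unfolding H_def by simp

text \<open>Members of \<open>H\<close> agree on \<open>S\<close> anyway, so of a compact set only
  its finite traces on the layers matter. Conversely, finite subsets of the layers together with
  \<open>S\<close> form a compact set. This matches the description of the box topology term by
  term.\<close>

lemma openin_subtopology_H:
  "openin (subtopology (Ck2_topology X) H) A \<longleftrightarrow> A \<subseteq> H \<and>
    (\<forall>f\<in>A. \<exists>F. (\<forall>n. finite (F n) \<and> F n \<subseteq> R n) \<and> {g \<in> H. \<forall>n. \<forall>x\<in>F n. g x = f x} \<subseteq> A)"
  (is "?L \<longleftrightarrow> ?R")
proof
  assume ?L
  then have A: "A \<subseteq> H" "openin (Ck2_topology X) A"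
    using openin_open_subtopology[OF openin_H] by auto
  show ?R
  proof (intro conjI ballI)
    fix f assume f: "f \<in> A"
    then obtain K where K: "compactin X K" "{g \<in> Cf X. \<forall>x\<in>K. g x = f x} \<subseteq> A"
      using A(2) unfolding openin_Ck2_topology by blast
    have fin: "finite (K \<inter> R n)" for n
      by (rule finite_compactin_Int_isolated[OF K(1) closedin_R R_subset])
    have "g \<in> A" if g: "g \<in> H" "\<forall>n. \<forall>x\<in>K \<inter> R n. g x = f x" for g
    proof -
      have "g x = f x" if x: "x \<in> K" for x
      proof (cases "x \<in> S")
        case True
        then show ?thesis using g(1) f A(1) unfolding H_def by auto
      next
        case False
        then obtain n where "x \<in> R n" using UN_R x compactin_subset_topspace[OF K(1)] by blast
        then show ?thesis using g(2) x by blast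
      qed
      then show ?thesis using K(2) g(1) unfolding H_def by blast
    qed
    then show "\<exists>F. (\<forall>n. finite (F n) \<and> F n \<subseteq> R n) \<and> {g \<in> H. \<forall>n. \<forall>x\<in>F n. g x = f x} \<subseteq> A"
      using fin by (intro exI[of _ "\<lambda>n. K \<inter> R n"]) blast
  qed (rule A(1))
next
  assume R: ?R
  have "\<exists>K. compactin X K \<and> {g \<in> Cf X. \<forall>x\<in>K. g x = f x} \<subseteq> A" if f: "f \<in> A" for f
  proof -
    obtain F where F': "\<forall>n. finite (F n) \<and> F n \<subseteq> R n"
      and F3: "{g \<in> H. \<forall>n. \<forall>x\<in>F n. g x = f x} \<subseteq> A"
      using bspec[OF conjunct2[OF R] f] by (elim exE conjE) (rule that)
    have F: "\<And>n. finite (F n)" "\<And>n. F n \<subseteq> R n" using F' by simp_all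
    have "{g \<in> Cf X. \<forall>x\<in>S \<union> (\<Union>n. F n). g x = f x} \<subseteq> A"
    proof
      fix g assume g: "g \<in> {g \<in> Cf X. \<forall>x\<in>S \<union> (\<Union>n. F n). g x = f x}"
      have "f \<in> H" using R f by blast
      then have "g \<in> H" using g unfolding H_def by auto
      then show "g \<in> A" using g F3 by auto
    qed
    then show ?thesis using compactin_S_Un[OF F(1,2)] by blast
  qed
  moreover have "A \<subseteq> Cf X" using R unfolding H_def by blast
  ultimately have "openin (Ck2_topology X) A" unfolding openin_Ck2_topology by blast
  then show ?L using R openin_open_subtopology[OF openin_H] by blast
qed

text \<open>The isomorphism restricts a function to the layers. Finite support holds because a
  continuous function vanishing on \<open>S\<close> vanishes on some \<open>W m\<close>. Conversely,
  a finitely supported family glues to a function that vanishes on some \<open>W m\<close>, which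
  makes it continuous. The descriptions of the two topologies by finite subsets of the layers
  correspond under this map.\<close>

lemma topologically_isomorphic_H:
  "topologically_isomorphic ((Ck2 X)\<lparr>carrier := H\<rparr>) (subtopology (Ck2_topology X) H)
     (Z2_power_sum R) (Z2_power_sum_box_topology R)"
proof -
  let ?C = "carrier (Z2_power_sum R)"
  define h where "h \<equiv> \<lambda>f::'a \<Rightarrow> int. \<lambda>n. restrict f (R n)"
  have sub: "subtopology X (R n) = discrete_topology (R n)" for n
    by (rule subtopology_isolated[OF R_subset])
  have RX: "R n \<subseteq> topspace X" for n using R_subset by blast
  have hC: "h f \<in> ?C" if f: "f \<in> H" for f
  proof -
    have fC: "f \<in> Cf X" "\<And>x. x \<in> S \<Longrightarrow> f x = 0" using f unfolding H_def by auto
    have "h f n \<in> Cf (discrete_topology (R n))" for n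
      using Cf_restrict[OF fC(1) RX] unfolding h_def sub .
    moreover obtain m where m: "\<And>x. x \<in> W m \<Longrightarrow> f x = (\<lambda>x\<in>topspace X. 0) x"
    proof (rule Cf_agree_near_S[OF fC(1) zero_in_Cf])
      show "f x = (\<lambda>x\<in>topspace X. 0) x" if "x \<in> S" for x using that fC(2) S_subset by auto
    qed (rule that)
    have "h f n = (\<lambda>x\<in>R n. 0)" if "m \<le> n" for n
      unfolding h_def
    proof (rule restrict_ext)
      fix x assume "x \<in> R n"
      then have "x \<in> W m" "x \<in> topspace X" using W_antimono[OF that] W_subset unfolding R_def by auto
      then show "f x = 0" using m by simp
    qed
    then have "{n. h f n \<noteq> (\<lambda>x\<in>R n. 0)} \<subseteq> {..<m}" by (auto simp: not_le[symmetric])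
    then have "finite {n. h f n \<noteq> (\<lambda>x\<in>R n. 0)}" using finite_subset by blast
    ultimately show ?thesis by (simp add: carrier_Z2_power_sum)
  qed
  have inj: "inj_on h H"
  proof (rule inj_onI)
    fix f g assume fg: "f \<in> H" "g \<in> H" "h f = h g"
    have "f x = g x" if x: "x \<in> topspace X" for x
    proof (cases "x \<in> S")
      case True
      then show ?thesis using fg unfolding H_def by auto
    next
      case False
      then obtain n where "x \<in> R n" using UN_R x by blast
      then show ?thesis using fun_cong[OF fun_cong[OF fg(3), of n], of x] unfolding h_def by simp
    qed
    then show "f = g" using fg unfolding H_def by (intro Cf_eqI[of f X]) auto
  qed
  have surj: "\<exists>f\<in>H. h f = u" if u: "u \<in> ?C" for u
  proof -
    have un: "u n \<in> Cf (discrete_topology (R n))" for n using u by (simp add: carrier_Z2_power_sum)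
    have "finite {n. u n \<noteq> (\<lambda>x\<in>R n. 0)}" using u by (simp add: carrier_Z2_power_sum)
    then obtain m where "{n. u n \<noteq> (\<lambda>x\<in>R n. 0)} \<subseteq> {..<m}" using finite_nat_iff_bounded by blast
    then have m: "u n = (\<lambda>x\<in>R n. 0)" if "m \<le> n" for n using that by force
    define ix where "ix \<equiv> \<lambda>x. THE n. x \<in> R n"
    have ix: "ix x = n" if "x \<in> R n" for x n
      unfolding ix_def using that disjoint_R by (intro the_equality) (auto simp: disjoint_family_on_def)
    define f where "f = (\<lambda>x\<in>topspace X. if x \<in> S then 0 else u (ix x) x)"
    have fR: "f x = u n x" if "x \<in> R n" for x n
      using ix[OF that] that R_subset unfolding f_def by auto
    have val: "f x \<in> {0, 1}" if x: "x \<in> topspace X" for x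
    proof (cases "x \<in> S")
      case False
      then obtain n where n: "x \<in> R n" using UN_R x by blast
      then show ?thesis using fR[OF n] Cf_values[OF un[of n], of x] by auto
    qed (use x in \<open>simp add: f_def\<close>)
    have W0: "f x = 0" if x: "x \<in> W m" for x
    proof (cases "x \<in> S")
      case True
      then show ?thesis using x W_subset unfolding f_def by auto
    next
      case False
      then obtain n where n: "x \<in> R n" using UN_R x W_subset by blast
      have "\<not> n < m" using not_in_W_iff[of x m] x n W_subset by blast
      then show ?thesis using fR[OF n] m[of n] n by simp
    qed
    \<comment> \<open>The set of ones avoids \<open>W m\<close>, hence \<open>S\<close>, and sets of
      isolated points are open. The zero set is \<open>W m\<close> together with isolated
      points.\<close>
    have "{x \<in> topspace X. f x = 1} \<subseteq> topspace X - S"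
      using W0 S_subset_W by force
    then have "openin X {x \<in> topspace X. f x = 1}" by (rule openin_isolated)
    moreover have "openin X {x \<in> topspace X. f x = 0}"
    proof -
      have "{x \<in> topspace X. f x = 0} = W m \<union> ({x \<in> topspace X. f x = 0} - S)"
        using W0 W_subset S_subset_W by blast
      moreover have "openin X ({x \<in> topspace X. f x = 0} - S)" by (rule openin_isolated) blast
      ultimately show ?thesis using openin_W openin_Un by metis
    qed
    moreover have "f \<in> extensional (topspace X)" unfolding f_def by simp
    ultimately have "f \<in> Cf X" unfolding mem_Cf_iff using val by blast
    then have "f \<in> H" unfolding H_def using W0 S_subset_W by blast
    moreover have "h f n = u n" for n
      unfolding h_def using Cf_extensional[OF un[of n]] fR
      by (intro extensionalityI[OF restrict_extensional]) auto
    ultimately show ?thesis by blast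
  qed
  have img: "h ` H = ?C" using hC surj by blast
  have topB: "topspace (Z2_power_sum_box_topology R) = ?C"
  proof -
    have "openin (Z2_power_sum_box_topology R) ?C"
      unfolding openin_Z2_power_sum_box_topology by auto
    moreover have "topspace (Z2_power_sum_box_topology R) \<subseteq> ?C"
      using openin_topspace[of "Z2_power_sum_box_topology R"] unfolding openin_Z2_power_sum_box_topology by blast
    ultimately show ?thesis using openin_subset by blast
  qed
  have topH: "topspace (subtopology (Ck2_topology X) H) = H"
    using openin_subset[OF openin_H] by auto
  have agree: "(\<forall>n. \<forall>x\<in>F n. h g n x = h f n x) \<longleftrightarrow> (\<forall>n. \<forall>x\<in>F n. g x = f x)"
    if "\<And>n. F n \<subseteq> R n" for F :: "nat \<Rightarrow> 'a set" and f g
    using that unfolding h_def by (auto simp: subset_iff)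
  have "homeomorphic_map (subtopology (Ck2_topology X) H) (Z2_power_sum_box_topology R) h"
  proof (rule bijective_open_imp_homeomorphic_map)
    show "continuous_map (subtopology (Ck2_topology X) H) (Z2_power_sum_box_topology R) h"
      unfolding continuous_map_def topH topB
    proof (intro conjI allI impI)
      show "h \<in> H \<rightarrow> ?C" using hC by blast
      fix V assume V: "openin (Z2_power_sum_box_topology R) V"
      show "openin (subtopology (Ck2_topology X) H) {f \<in> H. h f \<in> V}"
        unfolding openin_subtopology_H
      proof (intro conjI ballI)
        fix f assume f: "f \<in> {f \<in> H. h f \<in> V}"
        then have hf: "h f \<in> V" by simp
        have "\<exists>F. (\<forall>n. finite (F n) \<and> F n \<subseteq> R n) \<and> {w \<in> ?C. \<forall>n. \<forall>i\<in>F n. w n i = h f n i} \<subseteq> V"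
          by (rule bspec[OF conjunct2[OF V[unfolded openin_Z2_power_sum_box_topology]] hf])
        then obtain F where F': "\<forall>n. finite (F n) \<and> F n \<subseteq> R n"
          and F3: "{w \<in> ?C. \<forall>n. \<forall>i\<in>F n. w n i = h f n i} \<subseteq> V"
          by (elim exE conjE) (rule that)
        have F2: "\<And>n. F n \<subseteq> R n" using F' by simp
        have "{g \<in> H. \<forall>n. \<forall>x\<in>F n. g x = f x} \<subseteq> {f \<in> H. h f \<in> V}"
        proof
          fix g assume g: "g \<in> {g \<in> H. \<forall>n. \<forall>x\<in>F n. g x = f x}"
          then have "h g \<in> {w \<in> ?C. \<forall>n. \<forall>i\<in>F n. w n i = h f n i}"
            using hC[of g] agree[OF F2, of g f] by simp
          then show "g \<in> {f \<in> H. h f \<in> V}" using F3 g by auto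
        qed
        then show "\<exists>F. (\<forall>n. finite (F n) \<and> F n \<subseteq> R n) \<and>
            {g \<in> H. \<forall>n. \<forall>x\<in>F n. g x = f x} \<subseteq> {f \<in> H. h f \<in> V}"
          using F' by (intro exI[of _ F] conjI)
      qed blast
    qed
    show "open_map (subtopology (Ck2_topology X) H) (Z2_power_sum_box_topology R) h"
      unfolding open_map_def
    proof (intro allI impI)
      fix A assume A: "openin (subtopology (Ck2_topology X) H) A"
      have AH: "A \<subseteq> H" using A unfolding openin_subtopology_H by blast
      show "openin (Z2_power_sum_box_topology R) (h ` A)"
        unfolding openin_Z2_power_sum_box_topology
      proof (intro conjI ballI)
        show "h ` A \<subseteq> ?C" using AH hC by blast
        fix v assume "v \<in> h ` A"
        then obtain f where f: "f \<in> A" "v = h f" by blast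
        have "\<exists>F. (\<forall>n. finite (F n) \<and> F n \<subseteq> R n) \<and> {g \<in> H. \<forall>n. \<forall>x\<in>F n. g x = f x} \<subseteq> A"
          by (rule bspec[OF conjunct2[OF A[unfolded openin_subtopology_H]] f(1)])
        then obtain F where F': "\<forall>n. finite (F n) \<and> F n \<subseteq> R n"
          and F3: "{g \<in> H. \<forall>n. \<forall>x\<in>F n. g x = f x} \<subseteq> A"
          by (elim exE conjE) (rule that)
        have F2: "\<And>n. F n \<subseteq> R n" using F' by simp
        have "{w \<in> ?C. \<forall>n. \<forall>i\<in>F n. w n i = v n i} \<subseteq> h ` A"
        proof
          fix w assume w: "w \<in> {w \<in> ?C. \<forall>n. \<forall>i\<in>F n. w n i = v n i}"
          then obtain g where g: "g \<in> H" "h g = w" using surj by blast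
          have "\<forall>n. \<forall>x\<in>F n. g x = f x"
            using w agree[OF F2, of g f] g(2) f(2) by simp
          then show "w \<in> h ` A" using g F3 by auto
        qed
        then show "\<exists>F. (\<forall>n. finite (F n) \<and> F n \<subseteq> R n) \<and>
            {w \<in> ?C. \<forall>n. \<forall>i\<in>F n. w n i = v n i} \<subseteq> h ` A"
          using F' by (intro exI[of _ F] conjI)
      qed
    qed
  qed (simp_all only: topH topB img inj)
  moreover have "h \<in> iso ((Ck2 X)\<lparr>carrier := H\<rparr>) (Z2_power_sum R)"
  proof -
    have "h (f \<otimes>\<^bsub>Ck2 X\<^esub> g) = h f \<otimes>\<^bsub>Z2_power_sum R\<^esub> h g" for f g
      unfolding h_def mult_Ck2 mult_Z2_power_sum
      using RX by (intro ext) (auto simp: restrict_def)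
    moreover have "bij_betw h H ?C" using inj img by (simp add: bij_betw_def)
    ultimately show ?thesis unfolding iso_def hom_def using hC by (auto simp del: mult_Ck2 mult_Z2_power_sum)
  qed
  ultimately show ?thesis unfolding topologically_isomorphic_def by blast
qed

end

section \<open>Sums of a locally compact space and a discrete space\<close>

lemma compact_open_neighbourhood:
  assumes "zero_dimensional_space X" "openin X U" "x \<in> U" "U \<subseteq> K" "compactin X K"
  obtains C where "openin X C" "compactin X C" "x \<in> C"
proof -
  obtain V where V: "openin X V" "closedin X V" "x \<in> V" "V \<subseteq> U"
    by (rule zero_dimensional_spaceD[OF assms(1-3)])
  moreover have "compactin X V"
    by (rule closed_compactin[OF assms(5) _ V(2)]) (use V(4) assms(4) in blast)
  ultimately show ?thesis using that by blast
qed

lemma Lindelof_obtains_compact_open_cover: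
  assumes "Lindelof_space (subtopology X S)" "S \<subseteq> topspace X"
    and "\<And>x. x \<in> S \<Longrightarrow> \<exists>C. openin X C \<and> compactin X C \<and> x \<in> C"
  obtains \<C> where "countable \<C>" "\<And>C. C \<in> \<C> \<Longrightarrow> openin X C \<and> compactin X C" "S \<subseteq> \<Union>\<C>"
proof -
  let ?U = "{C. openin X C \<and> compactin X C}"
  have "(\<forall>U\<in>?U. openin X U) \<and> S \<subseteq> \<Union>?U" using assms(3) by blast
  then have "\<exists>\<V>. countable \<V> \<and> \<V> \<subseteq> ?U \<and> S \<subseteq> \<Union>\<V>"
    using Lindelof_space_subtopology_subset[OF assms(2), THEN iffD1, OF assms(1), THEN spec, of ?U] by (rule mp[rotated])
  then show ?thesis using that by blast
qed

text \<open>Points of the discrete summand are isolated, so the derived set lies in the open image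
  of \<open>L\<close>. This image is Lindelof, being separable and metrizable up to homeomorphism,
  and each of its points has a compact open neighbourhood by local compactness and
  zero-dimensionality.\<close>

lemma countable_compact_open_cover_if_sum:
  assumes X: "zero_dimensional_space X"
    and a: "separable_locally_compact_plus_discrete X"
  obtains \<C> where "countable \<C>" "\<And>C. C \<in> \<C> \<Longrightarrow> openin X C \<and> compactin X C"
    "X derived_set_of topspace X \<subseteq> \<Union>\<C>"
proof -
  obtain L :: "'a topology" and D :: "'a set" where L: "separable_space L" "metrizable_space L" "locally_compact_space L"
    and "X homeomorphic_space sum_topology (\<lambda>b. if b then L else discrete_topology D) (UNIV :: bool set)"
    using a unfolding separable_locally_compact_plus_discrete_def by blast
  then obtain g where g: "homeomorphic_map (sum_topology (\<lambda>b. if b then L else discrete_topology D) UNIV) X g"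
    by (meson homeomorphic_space homeomorphic_space_sym)
  let ?Y = "\<lambda>b. if b then L else discrete_topology D"
  let ?S = "sum_topology ?Y UNIV"
  define e where "e \<equiv> \<lambda>y. g (True, y)"
  have e: "continuous_map L X e" "open_map L X e"
  proof -
    have "continuous_map (?Y True) X (g \<circ> Pair True)"
      by (rule continuous_map_compose[OF continuous_map_component_injection homeomorphic_imp_continuous_map[OF g]]) simp
    moreover have "open_map (?Y True) X (g \<circ> Pair True)"
      by (rule open_map_compose[OF open_map_component_injection homeomorphic_imp_open_map[OF g]]) simp
    ultimately show "continuous_map L X e" "open_map L X e" by (simp_all add: e_def o_def)
  qed
  let ?E = "e ` topspace L"
  have EX: "?E \<subseteq> topspace X" using e(1) continuous_map_image_subset_topspace by blast
  have "Lindelof_space L"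
    using L metrizable_separable_imp_second_countable second_countable_imp_Lindelof_space by blast
  then have "Lindelof_space (subtopology X ?E)"
  proof (rule Lindelof_space_continuous_map_image)
    show "continuous_map L (subtopology X ?E) e" using e(1) by (auto simp: continuous_map_in_subtopology)
    show "e ` topspace L = topspace (subtopology X ?E)" using EX by auto
  qed
  then obtain \<C> where C: "countable \<C>" "\<And>C. C \<in> \<C> \<Longrightarrow> openin X C \<and> compactin X C" "?E \<subseteq> \<Union>\<C>"
  proof (rule Lindelof_obtains_compact_open_cover[OF _ EX])
    fix x assume "x \<in> ?E"
    then obtain y where y: "y \<in> topspace L" "x = e y" by blast
    then obtain U K where U: "openin L U" "compactin L K" "y \<in> U" "U \<subseteq> K"
      using L(3) unfolding locally_compact_space_def by blast
    have "openin X (e ` U)" "x \<in> e ` U" "e ` U \<subseteq> e ` K" "compactin X (e ` K)"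
      using U y(2) e by (auto simp: open_map_def intro: image_compactin)
    then obtain C where "openin X C" "compactin X C" "x \<in> C"
      by (rule compact_open_neighbourhood[OF X])
    then show "\<exists>C. openin X C \<and> compactin X C \<and> x \<in> C" by blast
  qed (rule that)
  moreover have "X derived_set_of topspace X \<subseteq> ?E"
  proof
    fix x assume x: "x \<in> X derived_set_of topspace X"
    then have "x \<in> topspace X" by (auto simp: derived_set_of_def)
    then have "x \<in> g ` topspace ?S" using homeomorphic_imp_surjective_map[OF g] by simp
    then obtain b y where yb: "x = g (b, y)" "y \<in> topspace (?Y b)" by auto
    show "x \<in> ?E"
    proof (cases b)
      case True
      then show ?thesis using yb unfolding e_def by auto
    next
      case False
      then have "y \<in> D" using yb(2) by simp
      then have "openin ?S {(False, y)}" by (auto simp: openin_sum_topology)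
      then have "openin X (g ` {(False, y)})"
        using homeomorphic_imp_open_map[OF g] unfolding open_map_def by blast
      then have "openin X {x}" using yb(1) False by simp
      then show ?thesis using nonisolated_obtains[OF x, of "{x}"] by blast
    qed
  qed
  ultimately show ?thesis using that[of \<C>] by blast
qed

section \<open>The summands determined by a countable compact open cover of the derived set\<close>

locale countable_compact_cover_of_derived_set =
  fixes X :: "'a topology" and \<C> :: "'a set set"
  assumes metrizable: "metrizable_space X"
    and countable_C: "countable \<C>"
    and C: "C \<in> \<C> \<Longrightarrow> openin X C \<and> compactin X C"
    and cover: "X derived_set_of topspace X \<subseteq> \<Union>\<C>"
begin

definition L :: "'a set" where "L = \<Union>\<C>"
definition D :: "'a set" where "D = topspace X - \<Union>\<C>"

lemma L_D: "openin X L" "openin X D" "L \<inter> D = {}" "L \<union> D = topspace X"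
  and discrete_D: "subtopology X D = discrete_topology D"
proof -
  have D: "D \<subseteq> topspace X - X derived_set_of topspace X" using cover unfolding D_def by blast
  show "openin X D" using D by (rule openin_subset_isolated)
  show "subtopology X D = discrete_topology D" using D by (rule subtopology_isolated_eq_discrete)
  show "openin X L" using C unfolding L_def by blast
  then show "L \<inter> D = {}" "L \<union> D = topspace X" using openin_subset[of X L] unfolding D_def L_def by blast+
qed

lemma cover_L: "C \<in> \<C> \<Longrightarrow> openin (subtopology X L) C \<and> compactin (subtopology X L) C"
  "\<Union>\<C> = topspace (subtopology X L)"
proof -
  have sub: "C \<subseteq> L" if "C \<in> \<C>" for C using that unfolding L_def by blast
  show "C \<in> \<C> \<Longrightarrow> openin (subtopology X L) C \<and> compactin (subtopology X L) C"
    using C[of C] sub[of C] openin_open_subtopology[OF L_D(1)] by (simp add: compactin_subtopology)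
  show "\<Union>\<C> = topspace (subtopology X L)"
    using openin_subset[OF L_D(1)] unfolding L_def by auto
qed

lemma metrizable_L: "metrizable_space (subtopology X L)"
  using metrizable by (rule metrizable_space_subtopology)

text \<open>\<open>L\<close> and \<open>D\<close> are disjoint open sets covering \<open>X\<close>,
  so forgetting the tag is a homeomorphism from their sum onto \<open>X\<close>. As a countable
  union of compact open sets, \<open>L\<close> is second countable and locally compact.\<close>

lemma separable_locally_compact_plus_discrete: "separable_locally_compact_plus_discrete X"
proof -
  let ?Y = "\<lambda>b. if b then subtopology X L else discrete_topology D"
  let ?S = "sum_topology ?Y (UNIV :: bool set)"
  have LX: "L \<subseteq> topspace X" "D \<subseteq> topspace X" using L_D by blast+
  have topY: "topspace (?Y b) = (if b then L else D)" for b using LX by auto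
  have op: "openin (?Y b) A \<longleftrightarrow> openin X A \<and> A \<subseteq> (if b then L else D)" for b A
    using openin_open_subtopology[OF L_D(1)] openin_open_subtopology[OF L_D(2)] by (cases b) (simp_all flip: discrete_D)
  have topS: "topspace ?S = {True} \<times> L \<union> {False} \<times> D"
  proof -
    have "topspace ?S = (SIGMA b:UNIV. if b then L else D)"
      unfolding topspace_sum_topology o_def topY ..
    also have "\<dots> = {True} \<times> L \<union> {False} \<times> D"
      by (auto split: if_splits)
    finally show ?thesis .
  qed
  have "homeomorphic_map ?S X snd"
  proof (rule bijective_open_imp_homeomorphic_map)
    show "continuous_map ?S X snd"
      unfolding continuous_map_def
    proof (intro conjI allI impI)
      show "snd \<in> topspace ?S \<rightarrow> topspace X" unfolding topS using LX by auto
      fix U assume U: "openin X U"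
      have "openin (?Y b) {x. (b, x) \<in> {p \<in> topspace ?S. snd p \<in> U}}" for b
      proof -
        have "{x. (b, x) \<in> {p \<in> topspace ?S. snd p \<in> U}} = (if b then L else D) \<inter> U"
          unfolding topS by auto
        then show ?thesis unfolding op using U L_D by auto
      qed
      moreover have "{p \<in> topspace ?S. snd p \<in> U} \<subseteq> Sigma UNIV (topspace \<circ> ?Y)"
        unfolding topspace_sum_topology by blast
      ultimately show "openin ?S {p \<in> topspace ?S. snd p \<in> U}"
        unfolding openin_sum_topology by blast
    qed
    show "open_map ?S X snd"
      unfolding open_map_def
    proof (intro allI impI)
      fix U assume "openin ?S U"
      then have "openin (?Y b) {x. (b, x) \<in> U}" for b unfolding openin_sum_topology by blast
      then have "openin X {x. (b, x) \<in> U}" for b using op by blast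
      then have "openin X ({x. (True, x) \<in> U} \<union> {x. (False, x) \<in> U})" by blast
      moreover have "snd ` U = {x. (True, x) \<in> U} \<union> {x. (False, x) \<in> U}"
      proof (intro equalityI subsetI)
        fix x assume "x \<in> snd ` U"
        then obtain b where "(b, x) \<in> U" by auto
        then show "x \<in> {x. (True, x) \<in> U} \<union> {x. (False, x) \<in> U}" by (cases b) auto
      qed force
      ultimately show "openin X (snd ` U)" by simp
    qed
    show "snd ` topspace ?S = topspace X" unfolding topS by (simp add: image_Un L_D(4))
    show "inj_on snd (topspace ?S)" unfolding topS using L_D(3) by (auto simp: inj_on_def)
  qed
  then have "X homeomorphic_space ?S"
    using homeomorphic_map_imp_homeomorphic_space homeomorphic_space_sym by blast
  moreover have "separable_space (subtopology X L)"
    by (rule second_countable_imp_separable_space[OF second_countable_if_countable_compact_cover[OF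
          metrizable_L countable_C conjunct2[OF cover_L(1)] cover_L(2)]])
  moreover have "locally_compact_space (subtopology X L)"
    unfolding locally_compact_space_def
  proof
    fix x assume "x \<in> topspace (subtopology X L)"
    then obtain C where "C \<in> \<C>" "x \<in> C" using cover_L(2) by blast
    then show "\<exists>U K. openin (subtopology X L) U \<and> compactin (subtopology X L) K \<and> x \<in> U \<and> U \<subseteq> K"
      using cover_L(1)[of C] by (intro exI[of _ C]) simp
  qed
  ultimately show ?thesis
    unfolding separable_locally_compact_plus_discrete_def using metrizable_L by (intro exI conjI)
qed

lemma Ck2_eq_product:
  "topologically_isomorphic (Ck2 X) (Ck2_topology X)
     (Ck2 (subtopology X L) \<times>\<times> Ck2 (subtopology X D))
     (prod_topology (Ck2_topology (subtopology X L)) (Ck2_topology (subtopology X D)))"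
  by (rule Ck2_clopen_decomposition[OF L_D])

lemma polish_Ck2_L: "polish_abelian_group (Ck2 (subtopology X L)) (Ck2_topology (subtopology X L))"
  by (rule polish_abelian_group_Ck2[OF metrizable_L countable_C cover_L])

lemma compact_Ck2_D: "compact_abelian_group (Ck2 (subtopology X D)) (Ck2_topology (subtopology X D))"
  unfolding discrete_D by (rule compact_abelian_group_Ck2_discrete)

text \<open>A Polish space is metrizable, hence a k-space, and the product of a k-space with a
  locally compact Hausdorff space is again a k-space.\<close>

lemma k_space_Ck2: "k_space (Ck2_topology X)"
proof -
  have "k_space (prod_topology (Ck2_topology (subtopology X L)) (Ck2_topology (subtopology X D)))"
  proof (rule k_space_prod_topology_right)
    show "k_space (Ck2_topology (subtopology X L))"
      using polish_Ck2_L completely_metrizable_imp_metrizable_space metrizable_imp_k_space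
      unfolding polish_abelian_group_def polish_space_def by blast
    show "locally_compact_space (Ck2_topology (subtopology X D))"
      using compact_Ck2_D compact_imp_locally_compact_space unfolding compact_abelian_group_def by blast
  qed (simp add: Hausdorff_Ck2_topology)
  then show ?thesis
    using Ck2_eq_product homeomorphic_k_space homeomorphic_map_imp_homeomorphic_space
    unfolding topologically_isomorphic_def by blast
qed

end

section \<open>Assembly of the characterization\<close>

theorem theorem3p4:
  fixes X :: "'a topology"
  assumes "metrizable_space X" and "zero_dimensional_space X"
  shows "(k_space (Ck2_topology X) \<longleftrightarrow>
            separable_locally_compact_plus_discrete X \<or>
            (\<not> locally_compact_space X \<and> compactin X (X derived_set_of topspace X)))
       \<and> (separable_locally_compact_plus_discrete X \<longrightarrow>
            (\<exists>(P :: ('a \<Rightarrow> int) monoid) TP (K :: ('a \<Rightarrow> int) monoid) TK.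
               polish_abelian_group P TP \<and> compact_abelian_group K TK \<and>
               topologically_isomorphic (Ck2 X) (Ck2_topology X)
                 (P \<times>\<times> K) (prod_topology TP TK)))
       \<and> (\<not> locally_compact_space X \<and> compactin X (X derived_set_of topspace X) \<longrightarrow>
            (\<exists>H (\<kappa> :: nat \<Rightarrow> 'a set).
               subgroup H (Ck2 X) \<and> openin (Ck2_topology X) H \<and>
               topologically_isomorphic
                 ((Ck2 X)\<lparr>carrier := H\<rparr>) (subtopology (Ck2_topology X) H)
                 (Z2_power_sum \<kappa>) (Z2_power_sum_box_topology \<kappa>)))"
  
proof -
  let ?S = "X derived_set_of topspace X"
  have SX: "?S \<subseteq> topspace X" by (rule derived_set_of_subset_topspace)
  \<comment> \<open>Condition (a) enters only through this cover. The decomposition of the function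
    group uses the summands built from the cover, not those given by (a).\<close>
  have sum: "\<exists>\<C>. countable_compact_cover_of_derived_set X \<C>" if "separable_locally_compact_plus_discrete X"
    by (rule countable_compact_open_cover_if_sum[OF assms(2) that])
      (use assms(1) in \<open>auto simp: countable_compact_cover_of_derived_set_def\<close>)
  have base: "\<exists>W. compact_derived_set X ?S W" if "compactin X ?S"
  proof (rule clopen_base_at_compact[OF assms that])
    fix W :: "nat \<Rightarrow> 'a set"
    assume "W 0 = topspace X" "\<And>n. W (Suc n) \<subseteq> W n" "\<And>n. openin X (W n)" "\<And>n. closedin X (W n)"
      "\<And>n. ?S \<subseteq> W n" "\<And>U. \<lbrakk>openin X U; ?S \<subseteq> U\<rbrakk> \<Longrightarrow> \<exists>n. W n \<subseteq> U"
    then have "compact_derived_set X ?S W"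
      using assms(1) that by unfold_locales auto
    then show ?thesis by blast
  qed
  have "separable_locally_compact_plus_discrete X \<or> (\<not> locally_compact_space X \<and> compactin X ?S)"
    if k: "k_space (Ck2_topology X)"
  proof (cases "locally_compact_space X")
    case True
    \<comment> \<open>Local compactness gives compact open neighbourhoods and the Lindelof property
      selects countably many, so (a) holds.\<close>
    have "Lindelof_space (subtopology X ?S)"
      using k_space_Ck2_imp_second_countable_derived_set[OF assms k] by (rule second_countable_imp_Lindelof_space)
    then obtain \<C> where "countable \<C>" "\<And>C. C \<in> \<C> \<Longrightarrow> openin X C \<and> compactin X C" "?S \<subseteq> \<Union>\<C>"
    proof (rule Lindelof_obtains_compact_open_cover[OF _ SX])
      fix x assume "x \<in> ?S"
      then have "x \<in> topspace X" using SX by (rule subsetD[rotated])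
      then obtain U K where U: "openin X U" "x \<in> U" "U \<subseteq> K" "compactin X K"
        using True[unfolded locally_compact_space_def, rule_format] by metis
      show "\<exists>C. openin X C \<and> compactin X C \<and> x \<in> C"
        by (rule compact_open_neighbourhood[OF assms(2) U]) blast
    qed (rule that)
    then interpret countable_compact_cover_of_derived_set X \<C>
      using assms(1) by unfold_locales auto
    show ?thesis using separable_locally_compact_plus_discrete by blast
  next
    case False
    \<comment> \<open>If \<open>X\<close> is not locally compact, the contrapositive yields
      compactness of the derived set, which is (b).\<close>
    then show ?thesis using k_space_Ck2_imp_locally_compact[OF assms k] by blast
  qed
  moreover have "k_space (Ck2_topology X)" if "compactin X ?S"
    using base[OF that] compact_derived_set.k_space_Ck2 by blast
  moreover have "k_space (Ck2_topology X)" if "separable_locally_compact_plus_discrete X"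
    using sum[OF that] countable_compact_cover_of_derived_set.k_space_Ck2 by blast
  moreover have "\<exists>(P :: ('a \<Rightarrow> int) monoid) TP (K :: ('a \<Rightarrow> int) monoid) TK.
      polish_abelian_group P TP \<and> compact_abelian_group K TK \<and>
      topologically_isomorphic (Ck2 X) (Ck2_topology X) (P \<times>\<times> K) (prod_topology TP TK)"
    if a: "separable_locally_compact_plus_discrete X"
  proof -
    obtain \<C> where "countable_compact_cover_of_derived_set X \<C>" using sum[OF a] by blast
    then interpret countable_compact_cover_of_derived_set X \<C> .
    show ?thesis using polish_Ck2_L compact_Ck2_D Ck2_eq_product by blast
  qed
  moreover have "\<exists>H (\<kappa> :: nat \<Rightarrow> 'a set). subgroup H (Ck2 X) \<and> openin (Ck2_topology X) H \<and>
      topologically_isomorphic ((Ck2 X)\<lparr>carrier := H\<rparr>) (subtopology (Ck2_topology X) H)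
        (Z2_power_sum \<kappa>) (Z2_power_sum_box_topology \<kappa>)"
    if c: "compactin X ?S"
  proof -
    obtain W where "compact_derived_set X ?S W" using base[OF c] by blast
    then interpret compact_derived_set X ?S W .
    show ?thesis using subgroup_H openin_H topologically_isomorphic_H by blast
  qed
  ultimately show ?thesis by blast
qed

end
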